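(* Let $\tau=(k_\bullet,p_\bullet,q_\bullet)$ be a type A triple of length $s$, with partition $\lambda=\lambda(\tau)$ and permutation $w=w(\tau)$. Then \[\widetilde{\mathfrak S}_w=S_\lambda(c(1),\ldots,c(k_s))=\det\big(c(k)_{\lambda_k+l-k}\big)_{1\le k,l\le k_s}.\]
   Context: Let $\Lambda=\mathbb{Z}[c_1,c_2,\ldots]$ ($c_k$ of degree $k$) and $\Lambda[x,y]$ the polynomial ring over $\Lambda$ in indeterminates $x_i,y_i$, $i\in\mathbb{Z}$. Chern series: $c=\sum_{k\ge0}c_kt^k$ ($c_0=1$); products and quotients of series with constant term $1$ are formal power series in $t$; $a_j$ denotes the coefficient of $t^j$ in $a$, with $a_0=1$ and $a_j=0$ for $j<0$. $S_\mathbb{Z}$: bijections of $\mathbb{Z}$ fixing all but finitely many integers; $S_+$: those fixing every integer $\le0$; $\ell(w)$: number of inversions. A type A triple $\tau=(k_\bullet,p_\bullet,q_\bullet)$ of length $s$ consists of integers $0<k_1<\cdots<k_s$, $p_1\le\cdots\le p_s$, $q_1\ge\cdots\ge q_s$ such that $l_i:=q_i-p_i+k_i$ satisfy $l_1>l_2>\cdots>l_s>0$. Its partition $\lambda(\tau)$ has length $k_s$ with $\lambda_k=l_i$ for $i$ minimal with $k_i\ge k$. Its permutation $w(\tau)\in S_\mathbb{Z}$ is the permutation of minimal length such that $\#\{a\le p_i: w(a)>q_i\}=k_i$ for $1\le i\le s$. For integers $p,q$ let \[a(p,q)=\frac{\prod_{i=p+1}^0(1-x_it)\prod_{j=1}^q(1+y_jt)}{\prod_{i=1}^p(1-x_it)\prod_{j=q+1}^0(1+y_jt)},\]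 where a product $\prod_{i=u}^v$ with $u>v$ is $1$. For $1\le k\le k_s$, $c(k)=c\cdot a(p_i,q_i)$ with $i$ minimal such that $k_i\ge k$. For $m\in\mathbb{Z}$, $\gamma^m(w)$ is $i+m\mapsto w(i)+m$, and $\gamma^m$ is the ring automorphism of $\Lambda[x,y]$ with $x_i\mapsto x_{i+m}$, $y_i\mapsto y_{i+m}$, $\gamma^m(c)=c\prod_{i=1}^m\frac{1+y_it}{1-x_it}$ ($m>0$), $\gamma^m(c)=c\prod_{i=m+1}^0\frac{1-x_it}{1+y_it}$ ($m<0$). For $w\in S_+$, $\mathfrak S_w(x;y)$ is the classical Lascoux–Schützenberger double Schubert polynomial (with $\mathfrak S_{w_0}=\prod_{i+j\le n}(x_i-y_j)$ for the longest $w_0\in S_n$). The enriched Schubert polynomial $\widetilde{\mathfrak S}_w$ is the unique element of $\Lambda[x,y]$ such that for every positive $m$ with $\gamma^m(w)\in S_+$, setting all $c_k=0$ in $\gamma^m(\widetilde{\mathfrak S}_w)$ gives $\mathfrak S_{\gamma^m(w)}(x;-y)$. *)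

theory Defs
  imports
    "HOL-Library.Poly_Mapping"
    "HOL-Computational_Algebra.Formal_Power_Series"
    "Jordan_Normal_Form.Determinant"
begin

text \<open>
  The ring \<open>\<Lambda>[x,y]\<close>, with \<open>\<Lambda> = \<int>[c\<^sub>1,c\<^sub>2,\<dots>]\<close>, is the ring of finitely supported
  maps from monomials to the integers.  \<open>CVar k\<close> is the indeterminate \<open>c\<^sub>k\<^sub>+\<^sub>1\<close>, so that there
  is no spurious indeterminate \<open>c\<^sub>0\<close>.
\<close>

datatype var = CVar nat | XVar int | YVar int

type_synonym epoly = "(var \<Rightarrow>\<^sub>0 nat) \<Rightarrow>\<^sub>0 int"

definition var_poly :: "var \<Rightarrow> epoly" where
  "var_poly v = Poly_Mapping.single (Poly_Mapping.single v 1) 1"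

abbreviation x_poly :: "int \<Rightarrow> epoly" where "x_poly i \<equiv> var_poly (XVar i)"
abbreviation y_poly :: "int \<Rightarrow> epoly" where "y_poly i \<equiv> var_poly (YVar i)"

text \<open>The ring homomorphism out of \<open>\<Lambda>[x,y]\<close> sending each indeterminate \<open>v\<close> to \<open>f v\<close>.\<close>

definition subst_poly :: "(var \<Rightarrow> epoly) \<Rightarrow> epoly \<Rightarrow> epoly" where
  "subst_poly f P =
     (\<Sum>m\<in>Poly_Mapping.keys P. of_int (Poly_Mapping.lookup P m) *
        (\<Prod>v\<in>Poly_Mapping.keys m. f v ^ Poly_Mapping.lookup m v))"

text \<open>The quotient of series with constant term 1 (\<open>fps_right_inverse b 1\<close> is the inverse of \<open>b\<close>;
  the coefficient ring carries no \<open>inverse\<close>).\<close>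

definition series_quot :: "epoly fps \<Rightarrow> epoly fps \<Rightarrow> epoly fps" where
  "series_quot a b = a * fps_right_inverse b 1"

definition chern :: "epoly fps" where
  "chern = Abs_fps (\<lambda>k. case k of 0 \<Rightarrow> 1 | Suc j \<Rightarrow> var_poly (CVar j))"

definition one_plus :: "epoly \<Rightarrow> epoly fps" where
  "one_plus z = 1 + fps_const z * fps_X"

definition a_series :: "int \<Rightarrow> int \<Rightarrow> epoly fps" where
  "a_series p q = series_quot
     ((\<Prod>i\<in>{p+1..0}. one_plus (- x_poly i)) * (\<Prod>j\<in>{1..q}. one_plus (y_poly j)))
     ((\<Prod>i\<in>{1..p}. one_plus (- x_poly i)) * (\<Prod>j\<in>{q+1..0}. one_plus (y_poly j)))"

definition series_coeff :: "epoly fps \<Rightarrow> int \<Rightarrow> epoly" where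
  "series_coeff a j = (if j < 0 then 0 else fps_nth a (nat j))"

text \<open>\<open>S\<^sub>\<lambda>(a(1),\<dots>,a(n))\<close>; matrix indices start at 0, whence the shift.\<close>

definition multi_schur :: "nat \<Rightarrow> (nat \<Rightarrow> int) \<Rightarrow> (nat \<Rightarrow> epoly fps) \<Rightarrow> epoly" where
  "multi_schur n lam a =
     det (mat n n (\<lambda>(i, j). let k = i + 1; l = j + 1 in
       series_coeff (a k) (lam k + int l - int k)))"

definition S_Z :: "(int \<Rightarrow> int) set" where
  "S_Z = {w. bij w \<and> finite {i. w i \<noteq> i}}"

definition S_plus :: "(int \<Rightarrow> int) set" where
  "S_plus = {w \<in> S_Z. \<forall>i\<le>0. w i = i}"

definition perm_length :: "(int \<Rightarrow> int) \<Rightarrow> nat" where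
  "perm_length w = card {(i, j). i < j \<and> w i > w j}"

definition shift_perm :: "int \<Rightarrow> (int \<Rightarrow> int) \<Rightarrow> int \<Rightarrow> int" where
  "shift_perm m w = (\<lambda>j. w (j - m) + m)"

definition swap_x :: "int \<Rightarrow> epoly \<Rightarrow> epoly" where
  "swap_x i = subst_poly (\<lambda>v. case v of
     CVar k \<Rightarrow> var_poly (CVar k)
   | XVar j \<Rightarrow> x_poly (transpose i (i+1) j)
   | YVar j \<Rightarrow> y_poly j)"

text \<open>The quotient \<open>(f - s\<^sub>i f) / (x\<^sub>i - x\<^sub>i\<^sub>+\<^sub>1)\<close>, an exact division in the polynomial ring.\<close>

definition divided_difference :: "int \<Rightarrow> epoly \<Rightarrow> epoly" where
  "divided_difference i f = (THE g. (x_poly i - x_poly (i+1)) * g = f - swap_x i f)"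

definition longest_perm :: "nat \<Rightarrow> int \<Rightarrow> int" where
  "longest_perm n = (\<lambda>i. if 1 \<le> i \<and> i \<le> int n then int n + 1 - i else i)"

text \<open>
  The Lascoux--Schuetzenberger construction: start from the product formula for the longest element
  of any \<open>S\<^sub>n\<close> and apply divided differences along descents.  The result depends neither on \<open>n\<close>
  nor on the chosen descents.
\<close>

inductive is_double_schubert :: "(int \<Rightarrow> int) \<Rightarrow> epoly \<Rightarrow> bool" where
  longest: "is_double_schubert (longest_perm n)
     (\<Prod>(i, j)\<in>{(i, j). 1 \<le> i \<and> 1 \<le> j \<and> i + j \<le> int n}. x_poly i - y_poly j)"
| descent: "\<lbrakk>is_double_schubert w f; 1 \<le> i; w i > w (i+1)\<rbrakk>
     \<Longrightarrow> is_double_schubert (w \<circ> transpose i (i+1)) (divided_difference i f)"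

definition double_schubert :: "(int \<Rightarrow> int) \<Rightarrow> epoly" where
  "double_schubert w = (THE f. is_double_schubert w f)"

definition negate_y :: "epoly \<Rightarrow> epoly" where
  "negate_y = subst_poly (\<lambda>v. case v of
     CVar k \<Rightarrow> var_poly (CVar k) | XVar i \<Rightarrow> x_poly i | YVar i \<Rightarrow> - y_poly i)"

definition shift_chern :: "int \<Rightarrow> epoly fps" where
  "shift_chern m = (if 0 \<le> m
     then chern * series_quot (\<Prod>i\<in>{1..m}. one_plus (y_poly i))
                              (\<Prod>i\<in>{1..m}. one_plus (- x_poly i))
     else chern * series_quot (\<Prod>i\<in>{m+1..0}. one_plus (- x_poly i))
                              (\<Prod>i\<in>{m+1..0}. one_plus (y_poly i)))"

definition shift_poly :: "int \<Rightarrow> epoly \<Rightarrow> epoly" where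
  "shift_poly m = subst_poly (\<lambda>v. case v of
     CVar k \<Rightarrow> fps_nth (shift_chern m) (Suc k)
   | XVar i \<Rightarrow> x_poly (i + m)
   | YVar i \<Rightarrow> y_poly (i + m))"

definition kill_chern :: "epoly \<Rightarrow> epoly" where
  "kill_chern = subst_poly (\<lambda>v. case v of
     CVar k \<Rightarrow> 0 | XVar i \<Rightarrow> x_poly i | YVar i \<Rightarrow> y_poly i)"

definition is_enriched_schubert :: "(int \<Rightarrow> int) \<Rightarrow> epoly \<Rightarrow> bool" where
  "is_enriched_schubert w P \<longleftrightarrow>
     (\<forall>m>0. shift_perm m w \<in> S_plus \<longrightarrow>
        kill_chern (shift_poly m P) = negate_y (double_schubert (shift_perm m w)))"

definition enriched_schubert :: "(int \<Rightarrow> int) \<Rightarrow> epoly" where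
  "enriched_schubert w = (THE P. is_enriched_schubert w P)"

text \<open>The entries of a triple of length \<open>s\<close> are its values at \<open>1, \<dots>, s\<close>; the others are ignored.\<close>

record triple =
  tlen :: nat
  tk :: "nat \<Rightarrow> nat"
  tp :: "nat \<Rightarrow> int"
  tq :: "nat \<Rightarrow> int"

definition tl_val :: "triple \<Rightarrow> nat \<Rightarrow> int" where
  "tl_val \<tau> i = tq \<tau> i - tp \<tau> i + int (tk \<tau> i)"

definition type_A_triple :: "triple \<Rightarrow> bool" where
  "type_A_triple \<tau> \<longleftrightarrow>
     1 \<le> tlen \<tau> \<and>
     0 < tk \<tau> 1 \<and> strict_mono_on {1..tlen \<tau>} (tk \<tau>) \<and>
     mono_on {1..tlen \<tau>} (tp \<tau>) \<and>
     antimono_on {1..tlen \<tau>} (tq \<tau>) \<and>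
     strict_antimono_on {1..tlen \<tau>} (tl_val \<tau>) \<and> 0 < tl_val \<tau> (tlen \<tau>)"

definition triple_ks :: "triple \<Rightarrow> nat" where
  "triple_ks \<tau> = tk \<tau> (tlen \<tau>)"

definition triple_index :: "triple \<Rightarrow> nat \<Rightarrow> nat" where
  "triple_index \<tau> k = (LEAST i. 1 \<le> i \<and> i \<le> tlen \<tau> \<and> k \<le> tk \<tau> i)"

text \<open>\<open>\<lambda>\<^sub>k\<close> and \<open>c(k)\<close>, meaningful for \<open>1 \<le> k \<le> triple_ks \<tau>\<close>.\<close>

definition triple_part :: "triple \<Rightarrow> nat \<Rightarrow> int" where
  "triple_part \<tau> k = tl_val \<tau> (triple_index \<tau> k)"

definition triple_series :: "triple \<Rightarrow> nat \<Rightarrow> epoly fps" where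
  "triple_series \<tau> k = chern * a_series (tp \<tau> (triple_index \<tau> k)) (tq \<tau> (triple_index \<tau> k))"

definition rank_conditions :: "triple \<Rightarrow> (int \<Rightarrow> int) \<Rightarrow> bool" where
  "rank_conditions \<tau> w \<longleftrightarrow>
     (\<forall>i\<in>{1..tlen \<tau>}. card {a. a \<le> tp \<tau> i \<and> w a > tq \<tau> i} = tk \<tau> i)"

definition triple_perm :: "triple \<Rightarrow> int \<Rightarrow> int" where
  "triple_perm \<tau> = (THE w. w \<in> S_Z \<and> rank_conditions \<tau> w \<and>
     (\<forall>v\<in>S_Z. rank_conditions \<tau> v \<longrightarrow> perm_length w \<le> perm_length v))"

end

theory Submission
  imports
    Defs
    "HOL-Library.Countable"
    "HOL-Computational_Algebra.Fundamental_Theorem_Algebra"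
    "HOL-Computational_Algebra.Polynomial_FPS"
begin

text \<open>
  A double Schubert polynomial is determined by its degree and its values at the points
  \<open>x\<^sub>i = y\<^sub>v\<^sub>(\<^sub>i\<^sub>)\<close>: if the \<open>x\<close>-degree of \<open>h\<close> is at most \<open>d\<close> and \<open>h\<close> vanishes at all \<open>v\<close> of length at
  most \<open>d\<close>, then by induction on \<open>d\<close> all divided differences of \<open>h\<close> vanish, so \<open>h\<close> is symmetric in
  infinitely many variables, hence free of \<open>x\<close>, hence zero.  Among the permutations whose ranks are
  at least those prescribed by \<open>\<tau>\<close>, the one of minimal length is unique, and its inversions are
  exactly the pairs forced by the rank conditions.  At a point \<open>v\<close> violating a rank condition, the
  series in the top rows of the determinant satisfy a common linear recursion that is too short, so
  the determinant vanishes; at \<open>w(\<tau>)\<close> unitriangular row and column operations make the matrix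
  triangular and the determinant is the product of \<open>y\<^sub>w\<^sub>(\<^sub>a\<^sub>) - y\<^sub>w\<^sub>(\<^sub>b\<^sub>)\<close> over the inversions.  Finally, an
  element of \<open>\<Lambda>[x,y]\<close> is determined by its shifts with \<open>c = 1\<close>, since over \<open>\<complex>\<close> every polynomial with
  constant term 1 is a product of factors \<open>1 + y\<^sub>i t\<close>.
\<close>

text \<open>Both the double Schubert polynomial and w(\<tau>) are definite descriptions, so each
  needs existence and uniqueness. For the polynomials, interpolation replaces the braid relations:
  every chain of descents ends in a polynomial with the same prescribed values, and there is only
  one of them. The start of these chains, the longest permutation, is itself the minimal permutation
  of a triple, so the combinatorics of w(\<tau>) also yields the vanishing of the product formula at
  the other points. Minimality is studied under rank inequalities instead of equations: a
  localisation is shown to vanish where an inequality fails, and permutations with larger ranks are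
  excluded by their length. A shift by m followed by c = 1 turns c a(p_i, q_i) into a quotient of
  products over 1..q_i + m and 1..p_i + m. This needs p_i + m and q_i + m to be nonnegative, but not
  m to be large: nonnegativity follows from k_i > 0 and l_i > 0 once the shifted permutation fixes
  all integers up to 0.\<close>

section \<open>Polynomials in the variables \<open>c, x, y\<close>\<close>

text \<open>The order on \<open>var\<close> only serves to make \<open>epoly\<close> an integral domain.\<close>

instance var :: countable
  by countable_datatype

instantiation var :: linorder
begin

definition less_eq_var :: "var \<Rightarrow> var \<Rightarrow> bool" where
  "less_eq_var u v \<longleftrightarrow> to_nat u \<le> to_nat v"

definition less_var :: "var \<Rightarrow> var \<Rightarrow> bool" where
  "less_var u v \<longleftrightarrow> to_nat u < to_nat v"

instance
  by standard (auto simp: less_eq_var_def less_var_def)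

end

definition eval_monom :: "(var \<Rightarrow> 'a) \<Rightarrow> (var \<Rightarrow>\<^sub>0 nat) \<Rightarrow> 'a::comm_ring_1" where
  "eval_monom \<rho> m = (\<Prod>v\<in>Poly_Mapping.keys m. \<rho> v ^ Poly_Mapping.lookup m v)"

text \<open>The target ring varies: \<open>epoly\<close> itself for substitutions, the complex
  numbers for the final uniqueness argument.\<close>

definition eval_epoly :: "(var \<Rightarrow> 'a) \<Rightarrow> epoly \<Rightarrow> 'a::comm_ring_1" where
  "eval_epoly \<rho> P =
     (\<Sum>m\<in>Poly_Mapping.keys P. of_int (Poly_Mapping.lookup P m) * eval_monom \<rho> m)"

lemma subst_poly_eq_eval: "subst_poly = eval_epoly"
  by (intro ext) (simp add: subst_poly_def eval_epoly_def eval_monom_def)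

lemma eval_monom_superset:
  assumes "finite S" "Poly_Mapping.keys m \<subseteq> S"
  shows "eval_monom \<rho> m = (\<Prod>v\<in>S. \<rho> v ^ Poly_Mapping.lookup m v)"
  unfolding eval_monom_def using assms
  by (intro prod.mono_neutral_left) (auto simp: in_keys_iff)

lemma eval_epoly_superset:
  assumes "finite S" "Poly_Mapping.keys P \<subseteq> S"
  shows "eval_epoly \<rho> P = (\<Sum>m\<in>S. of_int (Poly_Mapping.lookup P m) * eval_monom \<rho> m)"
  unfolding eval_epoly_def using assms
  by (intro sum.mono_neutral_left) (auto simp: in_keys_iff)

lemma eval_monom_add: "eval_monom \<rho> (m + n) = eval_monom \<rho> m * eval_monom \<rho> n"
proof -
  let ?S = "Poly_Mapping.keys m \<union> Poly_Mapping.keys n"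
  have "Poly_Mapping.keys (m + n) \<subseteq> ?S" by (rule keys_add)
  then show ?thesis
    by (simp add: eval_monom_superset[of ?S] lookup_add power_add prod.distrib)
qed

lemma eval_diff: "eval_epoly \<rho> (P - Q) = eval_epoly \<rho> P - eval_epoly \<rho> Q"
proof -
  let ?S = "Poly_Mapping.keys P \<union> Poly_Mapping.keys Q"
  have "Poly_Mapping.keys (P - Q) \<subseteq> ?S" by (rule keys_diff)
  then show ?thesis
    by (simp add: eval_epoly_superset[of ?S] lookup_minus sum_subtractf left_diff_distrib)
qed

lemma eval_0 [simp]: "eval_epoly \<rho> 0 = 0"
  by (simp add: eval_epoly_def)

lemma eval_uminus: "eval_epoly \<rho> (- P) = - eval_epoly \<rho> P"
  using eval_diff[of \<rho> 0 P] by simp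

lemma eval_add: "eval_epoly \<rho> (P + Q) = eval_epoly \<rho> P + eval_epoly \<rho> Q"
  using eval_diff[of \<rho> P "- Q"] by (simp add: eval_uminus)

lemma eval_single: "eval_epoly \<rho> (Poly_Mapping.single m 1) = eval_monom \<rho> m"
  by (simp add: eval_epoly_def)

lemma eval_1 [simp]: "eval_epoly \<rho> 1 = 1"
proof -
  have "eval_epoly \<rho> (Poly_Mapping.single 0 1) = 1"
    unfolding eval_single by (simp add: eval_monom_def)
  then show ?thesis by simp
qed

text \<open>With integer coefficients, \<open>epoly\<close> is the free abelian group on the
  monomials, so closure under differences replaces sums and scalar multiples.\<close>

lemma epoly_monom_induct [case_names zero monom diff]:
  assumes "Q 0" "\<And>m. Q (Poly_Mapping.single m 1)" "\<And>a b. Q a \<Longrightarrow> Q b \<Longrightarrow> Q (a - b)"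
  shows "Q (P :: epoly)"
  using subset_UNIV assms by (rule frag_induction)

lemma eval_mult: "eval_epoly \<rho> (P * Q) = eval_epoly \<rho> P * eval_epoly \<rho> Q"
proof (induction P rule: epoly_monom_induct)
  case zero
  show ?case by simp
next
  case (diff a b)
  then show ?case by (simp add: left_diff_distrib eval_diff)
next
  case (monom m)
  show ?case
  proof (induction Q rule: epoly_monom_induct)
    case (monom n)
    show ?case by (simp add: mult_single eval_single eval_monom_add)
  qed (simp_all add: right_diff_distrib eval_diff)
qed

lemma eval_var [simp]: "eval_epoly \<rho> (var_poly v) = \<rho> v"
  by (simp add: var_poly_def eval_single eval_monom_def)

lemma comm_ring_hom_eval: "comm_ring_hom (eval_epoly \<rho>)"
  by unfold_locales (simp_all add: eval_add eval_mult)

lemma eval_sum: "eval_epoly \<rho> (sum f S) = (\<Sum>i\<in>S. eval_epoly \<rho> (f i))"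
  by (induction S rule: infinite_finite_induct) (simp_all add: eval_add)

lemma eval_prod: "eval_epoly \<rho> (prod f S) = (\<Prod>i\<in>S. eval_epoly \<rho> (f i))"
  by (induction S rule: infinite_finite_induct) (simp_all add: eval_mult)

lemmas eval_simps = eval_add eval_diff eval_uminus eval_mult eval_sum eval_prod

lemma single_monom_induct [case_names one var]:
  assumes one: "Q 1" and var: "\<And>v P. Q P \<Longrightarrow> Q (var_poly v * P)"
  shows "Q (Poly_Mapping.single m (1::int) :: epoly)"
proof -
  have pow: "Q (Poly_Mapping.single (Poly_Mapping.single v n) 1 * P)" if "Q P" for v n P
  proof (induction n)
    case 0
    then show ?case using that by simp
  next
    case (Suc n)
    have "Poly_Mapping.single (Poly_Mapping.single v (Suc n)) 1 * P
        = var_poly v * (Poly_Mapping.single (Poly_Mapping.single v n) 1 * P)"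
      by (simp add: var_poly_def mult_single single_add[symmetric] mult.assoc[symmetric])
    then show ?case using var[OF Suc] by metis
  qed
  show ?thesis
  proof (induction m rule: Poly_Mapping.update_induct)
    case const
    then show ?case using one by simp
  next
    case (update f a b)
    have "Poly_Mapping.update a b f = Poly_Mapping.single a b + f"
      using update(1) by (intro poly_mapping_eqI)
        (auto simp: lookup_update lookup_add lookup_single when_def in_keys_iff)
    then show ?case using pow[OF update(3), of a b] by (simp add: mult_single)
  qed
qed

lemma epoly_induct [case_names zero one var diff]:
  assumes "Q 0" "Q 1" "\<And>v P. Q P \<Longrightarrow> Q (var_poly v * P)" "\<And>a b. Q a \<Longrightarrow> Q b \<Longrightarrow> Q (a - b)"
  shows "Q (P :: epoly)"
  by (induction P rule: epoly_monom_induct)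
    (use assms single_monom_induct in blast)+

lemma eval_comp: "eval_epoly \<rho> (eval_epoly \<sigma> P) = eval_epoly (\<lambda>v. eval_epoly \<rho> (\<sigma> v)) P"
  by (induction P rule: epoly_induct) (simp_all add: eval_simps)

lemma eval_id: "eval_epoly var_poly P = P"
  by (induction P rule: epoly_induct) (simp_all add: eval_simps)

definition vars :: "epoly \<Rightarrow> var set" where
  "vars P = (\<Union>m\<in>Poly_Mapping.keys P. Poly_Mapping.keys m)"

lemma finite_vars [simp]: "finite (vars P)"
  by (simp add: vars_def)

lemma eval_cong: "(\<And>v. v \<in> vars P \<Longrightarrow> \<rho> v = \<sigma> v) \<Longrightarrow> eval_epoly \<rho> P = eval_epoly \<sigma> P"
  unfolding eval_epoly_def eval_monom_def vars_def
  by (intro sum.cong prod.cong refl arg_cong2[of _ _ _ _ "(*)"]) (simp add: Bex_def, metis)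

text \<open>Kronecker substitution: \<open>v \<mapsto> z^(B^(to_nat v))\<close> separates the monomials of \<open>P\<close>
  once \<open>B\<close> exceeds all exponents, by uniqueness of base-\<open>B\<close> digits.\<close>

lemma base_digits_unique:
  fixes a b :: "nat \<Rightarrow> nat"
  assumes "\<And>i. i < n \<Longrightarrow> a i < B" "\<And>i. i < n \<Longrightarrow> b i < B"
    and "(\<Sum>i<n. a i * B ^ i) = (\<Sum>i<n. b i * B ^ i)" "i < n"
  shows "a i = b i"
  using assms
proof (induction n arbitrary: a b i)
  case 0
  then show ?case by simp
next
  case (Suc n)
  have split: "(\<Sum>i<Suc n. c i * B ^ i) = c 0 + B * (\<Sum>i<n. c (Suc i) * B ^ i)" for c :: "nat \<Rightarrow> nat"
    by (simp add: sum.lessThan_Suc_shift sum_distrib_left mult.left_commute del: sum.lessThan_Suc)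
  have eq: "a 0 + B * (\<Sum>i<n. a (Suc i) * B ^ i) = b 0 + B * (\<Sum>i<n. b (Suc i) * B ^ i)"
    using Suc.prems(3) unfolding split .
  have a0: "a 0 < B" "b 0 < B" using Suc.prems by auto
  have "a 0 = (a 0 + B * (\<Sum>i<n. a (Suc i) * B ^ i)) mod B" using a0 by simp
  also have "\<dots> = b 0" unfolding eq using a0 by simp
  finally have 0: "a 0 = b 0" .
  with eq a0 have "(\<Sum>i<n. a (Suc i) * B ^ i) = (\<Sum>i<n. b (Suc i) * B ^ i)" by simp
  then have "a (Suc i) = b (Suc i)" if "i < n" for i
    using Suc.IH[of "\<lambda>i. a (Suc i)" "\<lambda>i. b (Suc i)" i] Suc.prems(1,2) that by auto
  with 0 show ?case using Suc.prems(4) by (cases i) auto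
qed

text \<open>Complex points are used because \<open>shift_kill_point\<close> later obtains its points
  from roots of polynomials.\<close>

lemma exists_nonzero_point:
  fixes P :: epoly
  assumes "P \<noteq> 0"
  shows "\<exists>\<rho> :: var \<Rightarrow> complex. eval_epoly \<rho> P \<noteq> 0"
proof -
  let ?K = "Poly_Mapping.keys P"
  have "finite (\<Union>m\<in>?K. Poly_Mapping.lookup m ` Poly_Mapping.keys m)" by simp
  then obtain B where "\<forall>e\<in>(\<Union>m\<in>?K. Poly_Mapping.lookup m ` Poly_Mapping.keys m). e < B"
    using finite_nat_set_iff_bounded by blast
  \<comment> \<open>The successor covers a constant \<open>P\<close>, where \<open>B\<close> may be
    0 although every exponent is 0 and has to stay below the base.\<close>
  then have B0: "Poly_Mapping.lookup m v < Suc B" if "m \<in> ?K" for m v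
    using that by (cases "v \<in> Poly_Mapping.keys m") (auto simp: in_keys_iff intro: less_SucI)
  define C where "C = Suc B"
  have B: "Poly_Mapping.lookup m v < C" if "m \<in> ?K" for m v using B0 that C_def by simp
  obtain n where n: "to_nat v < n" if "v \<in> vars P" for v
    using finite_nat_set_iff_bounded[of "to_nat ` vars P"] by auto
  define E where "E m = (\<Sum>v\<in>vars P. Poly_Mapping.lookup m v * C ^ to_nat v)" for m
  \<comment> \<open>The base-\<open>C\<close> digits of \<open>E m\<close>; positions that code no
    variable of \<open>P\<close> carry the digit 0.\<close>
  define d where "d m i = (if i \<in> to_nat ` vars P then Poly_Mapping.lookup m (from_nat i) else 0)"
    for m :: "var \<Rightarrow>\<^sub>0 nat" and i
  have E: "E m = (\<Sum>i<n. d m i * C ^ i)" for m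
  proof -
    have "E m = (\<Sum>i\<in>to_nat ` vars P. d m i * C ^ i)"
      unfolding E_def by (subst sum.reindex) (auto simp: d_def inj_on_def)
    also have "\<dots> = (\<Sum>i<n. d m i * C ^ i)"
      by (rule sum.mono_neutral_left) (auto simp: d_def n)
    finally show ?thesis .
  qed
  have sub: "Poly_Mapping.keys m \<subseteq> vars P" if "m \<in> ?K" for m
    using that by (auto simp: vars_def)
  have inj: "inj_on E ?K"
  proof (rule inj_onI)
    fix m m' assume m: "m \<in> ?K" "m' \<in> ?K" "E m = E m'"
    have dig: "d m i = d m' i" if "i < n" for i
      using m(3) that unfolding E
      by (rule base_digits_unique[rotated 2]) (use B[OF m(1)] B[OF m(2)] in \<open>auto simp: d_def C_def\<close>)
    show "m = m'"
    proof (rule poly_mapping_eqI)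
      fix v
      show "Poly_Mapping.lookup m v = Poly_Mapping.lookup m' v"
      proof (cases "v \<in> vars P")
        case True
        with dig[of "to_nat v"] n[OF True] show ?thesis by (simp add: d_def)
      next
        case False
        then show ?thesis using sub m by (metis in_keys_iff subsetD)
      qed
    qed
  qed
  define p :: "complex poly" where
    "p = (\<Sum>m\<in>?K. monom (of_int (Poly_Mapping.lookup P m)) (E m))"
  obtain m0 where m0: "m0 \<in> ?K" using assms by (metis all_not_in_conv keys_eq_empty)
  have "coeff p (E m0) = (\<Sum>m\<in>?K. if m = m0 then of_int (Poly_Mapping.lookup P m) else 0)"
    unfolding p_def coeff_sum using inj m0
    by (intro sum.cong refl) (auto dest: inj_onD)
  also have "\<dots> \<noteq> 0" using m0 by (simp add: in_keys_iff)
  finally have "p \<noteq> 0" by auto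
  then obtain z where z: "poly p z \<noteq> 0"
    using poly_all_0_iff_0 by blast
  have "eval_epoly (\<lambda>v. z ^ (C ^ to_nat v)) P = poly p z"
  proof -
    have "eval_monom (\<lambda>v. z ^ (C ^ to_nat v)) m = z ^ E m" if "m \<in> ?K" for m
      unfolding eval_monom_superset[OF finite_vars sub[OF that]] E_def power_sum
      by (simp add: power_mult[symmetric] mult.commute)
    then show ?thesis
      unfolding eval_epoly_def p_def poly_sum by (simp add: poly_monom)
  qed
  with z show ?thesis by metis
qed

section \<open>Permutations of minimal length\<close>

definition inversions :: "(int \<Rightarrow> int) \<Rightarrow> (int \<times> int) set" where
  "inversions w = {(a, b). a < b \<and> w a > w b}"

lemma perm_length_inversions: "perm_length w = card (inversions w)"
  by (simp add: perm_length_def inversions_def)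

lemma S_Z_inj: "w \<in> S_Z \<Longrightarrow> w a = w b \<longleftrightarrow> a = b"
  by (auto simp: S_Z_def bij_def inj_def)

lemma S_Z_surj: "w \<in> S_Z \<Longrightarrow> \<exists>a. w a = b"
  unfolding S_Z_def bij_def by (blast dest: surjD[of w b] intro: sym)

text \<open>A point of the interval sent outside would share its image with a fixed point, so an
  interval containing the support is stable. \<open>M\<close> lets the caller enlarge it.\<close>

lemma S_Z_bound:
  assumes "w \<in> S_Z"
  obtains N :: int where "N \<ge> M" "\<And>i. \<bar>i\<bar> > N \<Longrightarrow> w i = i" "\<And>i. \<bar>i\<bar> \<le> N \<Longrightarrow> \<bar>w i\<bar> \<le> N"
proof -
  have fin: "finite (abs ` {i. w i \<noteq> i})" using assms by (simp add: S_Z_def)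
  define N0 where "N0 = Max (insert 0 (abs ` {i. w i \<noteq> i}))"
  have N0: "\<bar>i\<bar> \<le> N0" if "w i \<noteq> i" for i
    unfolding N0_def using fin that by (intro Max_ge) auto
  define N where "N = max N0 M"
  have fix_out: "w i = i" if "\<bar>i\<bar> > N" for i using N0[of i] that by (auto simp: N_def)
  show thesis
  proof (rule that[of N])
    show "\<bar>w i\<bar> \<le> N" if "\<bar>i\<bar> \<le> N" for i
    proof (rule ccontr)
      assume *: "\<not> \<bar>w i\<bar> \<le> N"
      then have "w (w i) = w i" using fix_out by simp
      then have "w i = i" using S_Z_inj[OF assms] by simp
      then show False using * that by simp
    qed
  qed (use fix_out N_def in auto)
qed

lemma finite_inversions:
  assumes "w \<in> S_Z"
  shows "finite (inversions w)"
proof -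
  obtain N where N: "\<And>i. \<bar>i\<bar> > N \<Longrightarrow> w i = i" "\<And>i. \<bar>i\<bar> \<le> N \<Longrightarrow> \<bar>w i\<bar> \<le> N"
    using S_Z_bound[OF assms] by blast
  have "inversions w \<subseteq> {-N..N} \<times> {-N..N}"
  proof (rule subrelI)
    fix a b assume "(a, b) \<in> inversions w"
    then have ab: "a < b" "w b < w a" by (auto simp: inversions_def)
    have "\<bar>a\<bar> \<le> N"
      using N(1)[of a] N(1)[of b] N(2)[of b] ab by (cases "\<bar>b\<bar> \<le> N"; cases "\<bar>a\<bar> \<le> N") auto
    moreover have "\<bar>b\<bar> \<le> N"
      using N(1)[of a] N(1)[of b] N(2)[of a] ab by (cases "\<bar>b\<bar> \<le> N"; cases "\<bar>a\<bar> \<le> N") auto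
    ultimately show "(a, b) \<in> {-N..N} \<times> {-N..N}" by auto
  qed
  then show ?thesis by (rule finite_subset) simp
qed

lemma S_Z_comp_transpose:
  assumes "w \<in> S_Z"
  shows "w \<circ> transpose a b \<in> S_Z"
proof -
  have "{i. (w \<circ> transpose a b) i \<noteq> i} \<subseteq> {i. w i \<noteq> i} \<union> {a, b}"
    by (auto simp: transpose_def)
  then have "finite {i. (w \<circ> transpose a b) i \<noteq> i}"
    using assms by (auto simp: S_Z_def intro: finite_subset)
  then show ?thesis using assms by (auto simp: S_Z_def intro: bij_comp)
qed

text \<open>The ranks \<open>|high|\<close> are those of the rank conditions, and \<open>low\<close> is the complementary set of
  positions: every element of \<open>high w p q \<times> low w p q\<close> is an inversion.\<close>

definition high :: "(int \<Rightarrow> int) \<Rightarrow> int \<Rightarrow> int \<Rightarrow> int set" where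
  "high w p q = {a. a \<le> p \<and> w a > q}"

definition low :: "(int \<Rightarrow> int) \<Rightarrow> int \<Rightarrow> int \<Rightarrow> int set" where
  "low w p q = {b. p < b \<and> w b \<le> q}"

lemma finite_high:
  assumes "w \<in> S_Z"
  shows "finite (high w p q)"
proof -
  obtain N where N: "\<And>i. \<bar>i\<bar> > N \<Longrightarrow> w i = i"
    using S_Z_bound[OF assms] by blast
  have "min (- N) q \<le> a" if "a \<in> high w p q" for a
    using N[of a] that by (cases "\<bar>a\<bar> \<le> N") (auto simp: high_def)
  then have "high w p q \<subseteq> {min (-N) q..p}" by (auto simp: high_def)
  then show ?thesis by (rule finite_subset) simp
qed

lemma finite_low:
  assumes "w \<in> S_Z"
  shows "finite (low w p q)"
proof -
  obtain N where N: "\<And>i. \<bar>i\<bar> > N \<Longrightarrow> w i = i"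
    using S_Z_bound[OF assms] by blast
  have "b \<le> max N q" if "b \<in> low w p q" for b
    using N[of b] that by (cases "\<bar>b\<bar> \<le> N") (auto simp: low_def)
  then have "low w p q \<subseteq> {p..max N q}" by (force simp: low_def)
  then show ?thesis by (rule finite_subset) simp
qed

text \<open>On a large interval, \<open>high\<close> and \<open>low\<close> are complements of the
  same set \<open>?C\<close>: in the positions up to \<open>p\<close>, and in the positions with
  value up to \<open>q\<close>. Hence rank k at (p, q) leaves q - p + k elements for
  \<open>low\<close>; this is the origin of l_i.\<close>

lemma card_high_low:
  assumes "w \<in> S_Z"
  shows "int (card (high w p q)) - int (card (low w p q)) = p - q"
proof -
  obtain N where N: "N \<ge> max \<bar>p\<bar> \<bar>q\<bar>" "\<And>i. \<bar>i\<bar> > N \<Longrightarrow> w i = i" "\<And>i. \<bar>i\<bar> \<le> N \<Longrightarrow> \<bar>w i\<bar> \<le> N"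
    using S_Z_bound[OF assms] by blast
  let ?I = "{-N..p}" and ?J = "{-N..q}"
  let ?C = "{a \<in> ?I. w a \<in> ?J}"
  have bij: "bij w" using assms by (simp add: S_Z_def)
  have ge: "- N \<le> a \<longleftrightarrow> - N \<le> w a" for a
    using N(1) N(2)[of a] N(3)[of a] by (cases "\<bar>a\<bar> \<le> N") auto
  have far: "- N \<le> a" if "a \<le> p" "q < w a" for a
    using N(1) N(2)[of a] that by (cases "\<bar>a\<bar> \<le> N") auto
  have I: "?I = high w p q \<union> ?C" and disj1: "high w p q \<inter> ?C = {}"
    using ge far by (auto simp: high_def)
  have far': "- N \<le> a" if "p < a" for a
    using N(1) that by auto
  have J: "w -` ?J = low w p q \<union> ?C" and disj2: "low w p q \<inter> ?C = {}"
    using ge far' by (auto simp: low_def)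
  have finC: "finite ?C" by (rule finite_subset[of _ ?I]) auto
  have "card ?I = card (high w p q) + card ?C"
    by (subst I, rule card_Un_disjoint[OF finite_high[OF assms] finC disj1])
  moreover have "card ?J = card (low w p q) + card ?C"
  proof -
    have "card ?J = card (w -` ?J)"
      by (rule card_vimage_inj[symmetric]) (use bij in \<open>auto simp: bij_def\<close>)
    also have "\<dots> = card (low w p q) + card ?C"
      by (subst J, rule card_Un_disjoint[OF finite_low[OF assms] finC disj2])
    finally show ?thesis .
  qed
  moreover have "int (card ?I) = p + N + 1" "int (card ?J) = q + N + 1"
    using N(1) by auto
  ultimately show ?thesis by linarith
qed

section \<open>Length under transpositions\<close>

lemma perm_length_transpose_less:
  assumes w: "w \<in> S_Z" and ab: "a < b" "w a > w b"
  shows "perm_length (w \<circ> transpose a b) < perm_length w"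
proof -
  let ?t = "transpose a b"
  \<comment> \<open>A pair is transported by the transposition if its order survives and is left
    alone otherwise. On increasing pairs this is an involution, hence injective.\<close>
  define \<phi> where "\<phi> = (\<lambda>(c, d). if ?t c < ?t d then (?t c, ?t d) else (c, d))"
  let ?v = "w \<circ> ?t"
  have fin: "finite (inversions w)" by (rule finite_inversions[OF w])
  have "\<phi> (c, d) \<in> inversions w - {(a, b)}" if "(c, d) \<in> inversions ?v" for c d
  proof -
    have cd: "c < d" "w (?t d) < w (?t c)" using that by (auto simp: inversions_def)
    show ?thesis
    proof (cases "?t c < ?t d")
      case True
      have "(?t c, ?t d) \<noteq> (a, b)"
      proof
        assume "(?t c, ?t d) = (a, b)"
        then have "?t (?t c) = b" "?t (?t d) = a" by simp_all
        then show False using cd(1) ab(1) by simp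
      qed
      then show ?thesis using True cd by (simp add: \<phi>_def inversions_def)
    next
      case False
      \<comment> \<open>Only pairs starting at \<open>a\<close> or ending at \<open>b\<close> can
        lose their order, and for these \<open>w b < w a\<close> links the two comparisons.\<close>
      then consider "c = a" "d \<noteq> b" "d \<noteq> a" | "d = b" "c \<noteq> a" "c \<noteq> b" | "c = a" "d = b"
        using cd(1) ab(1) unfolding transpose_def by (auto split: if_splits)
      then have "w d < w c \<and> (c, d) \<noteq> (a, b)"
        using cd ab by cases (auto simp: transpose_def)
      then show ?thesis using False cd by (simp add: \<phi>_def inversions_def)
    qed
  qed
  then have sub: "\<phi> ` inversions ?v \<subseteq> inversions w - {(a, b)}"
    by (simp add: image_subset_iff split_paired_all)
  have inj: "inj_on \<phi> (inversions ?v)"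
  proof (rule inj_on_inverseI)
    show "\<phi> (\<phi> x) = x" if "x \<in> inversions ?v" for x
      using that by (cases x) (auto simp: \<phi>_def inversions_def)
  qed
  have "card (inversions ?v) = card (\<phi> ` inversions ?v)"
    by (rule card_image[OF inj, symmetric])
  also have "\<dots> \<le> card (inversions w - {(a, b)})"
    by (rule card_mono[OF _ sub]) (use fin in simp)
  also have "\<dots> < card (inversions w)"
    by (rule card_Diff1_less) (use fin ab in \<open>auto simp: inversions_def\<close>)
  finally show ?thesis by (simp add: perm_length_inversions)
qed

text \<open>An adjacent transposition preserves the order of every pair except (i, i+1). The set
  itself is recorded, not only its size, because products over inversions are compared
  later.\<close>

lemma inversions_descent:
  assumes "w i > w (i + 1)"
  shows "inversions w = insert (i, i + 1)
    ((\<lambda>(a, b). (transpose i (i+1) a, transpose i (i+1) b)) ` inversions (w \<circ> transpose i (i+1)))"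
    (is "_ = insert _ (?f ` _)")
proof -
  let ?t = "transpose i (i+1)"
  have less: "?t a < ?t b" if "a < b" "(a, b) \<noteq> (i, i+1)" for a b
    using that by (auto simp: transpose_def)
  have "(a, b) \<in> ?f ` inversions (w \<circ> ?t)" if "(a, b) \<in> inversions w" "(a, b) \<noteq> (i, i+1)" for a b
  proof -
    have "(a, b) = ?f (?t a, ?t b)" by simp
    moreover have "(?t a, ?t b) \<in> inversions (w \<circ> ?t)"
      using that less[of a b] by (simp add: inversions_def)
    ultimately show ?thesis by (rule image_eqI)
  qed
  moreover have "(?t a, ?t b) \<in> inversions w" if "(a, b) \<in> inversions (w \<circ> ?t)" for a b
  proof -
    have "(a, b) \<noteq> (i, i + 1)" using that assms by (auto simp: inversions_def)
    then show ?thesis using that less[of a b] by (simp add: inversions_def)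
  qed
  ultimately show ?thesis using assms by (auto simp: inversions_def)
qed

lemma perm_length_descent:
  assumes "w \<in> S_Z" "w i > w (i + 1)"
  shows "perm_length w = Suc (perm_length (w \<circ> transpose i (i+1)))"
proof -
  let ?t = "transpose i (i+1)"
  let ?f = "\<lambda>(a, b). (?t a, ?t b)"
  have "inj_on ?f (inversions (w \<circ> ?t))"
    by (intro inj_onI) (auto simp: inj_eq[OF inj_transpose])
  then have "card (?f ` inversions (w \<circ> ?t)) = perm_length (w \<circ> ?t)"
    by (simp add: card_image perm_length_inversions)
  moreover have "(i, i + 1) \<notin> ?f ` inversions (w \<circ> ?t)"
    by (auto simp: inversions_def transpose_def split: if_splits)
  ultimately show ?thesis
    using finite_inversions[OF S_Z_comp_transpose[OF assms(1)]]
    by (simp add: perm_length_inversions inversions_descent[OF assms(2)])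
qed

lemma perm_length_adjacent_le:
  assumes "w \<in> S_Z"
  shows "perm_length (w \<circ> transpose i (i+1)) \<le> Suc (perm_length w)"
proof (cases "w i > w (i+1)")
  case True
  then show ?thesis using perm_length_descent[OF assms] by simp
next
  case False
  then have "w i < w (i+1)" using S_Z_inj[OF assms, of i "i+1"] by auto
  then have "perm_length (w \<circ> transpose i (i+1)) = Suc (perm_length (w \<circ> transpose i (i+1) \<circ> transpose i (i+1)))"
    by (intro perm_length_descent S_Z_comp_transpose assms) simp
  then show ?thesis by (simp add: comp_assoc)
qed

text \<open>Unlike a type A triple, a staircase triple may have length 0.\<close>

definition staircase :: "triple \<Rightarrow> bool" where
  "staircase \<tau> \<longleftrightarrow> strict_mono_on {1..tlen \<tau>} (tk \<tau>) \<and>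
     mono_on {1..tlen \<tau>} (tp \<tau>) \<and> antimono_on {1..tlen \<tau>} (tq \<tau>) \<and>
     strict_antimono_on {1..tlen \<tau>} (tl_val \<tau>) \<and>
     (\<forall>i\<in>{1..tlen \<tau>}. 0 < tk \<tau> i \<and> 0 < tl_val \<tau> i)"

definition essential :: "triple \<Rightarrow> (int \<Rightarrow> int) \<Rightarrow> int \<Rightarrow> int \<Rightarrow> nat \<Rightarrow> bool" where
  "essential \<tau> w a b j \<longleftrightarrow> j \<in> {1..tlen \<tau>} \<and> a \<in> high w (tp \<tau> j) (tq \<tau> j) \<and> b \<in> low w (tp \<tau> j) (tq \<tau> j)"

text \<open>An intrinsic form of minimality: it does not quantify over other permutations, and it
  describes the inversion set.\<close>

definition tight :: "triple \<Rightarrow> (int \<Rightarrow> int) \<Rightarrow> bool" where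
  "tight \<tau> w \<longleftrightarrow> w \<in> S_Z \<and> rank_conditions \<tau> w \<and>
     (\<forall>(a, b)\<in>inversions w. \<exists>j. essential \<tau> w a b j)"

text \<open>Inequalities leave room to remove inversions from a permutation with excess rank, which
  is how minimality is exploited.\<close>

definition dominates :: "triple \<Rightarrow> (int \<Rightarrow> int) \<Rightarrow> bool" where
  "dominates \<tau> w \<longleftrightarrow> w \<in> S_Z \<and>
     (\<forall>j\<in>{1..tlen \<tau>}. tk \<tau> j \<le> card (high w (tp \<tau> j) (tq \<tau> j)))"

lemma rank_conditions_high:
  "rank_conditions \<tau> w \<longleftrightarrow> (\<forall>j\<in>{1..tlen \<tau>}. card (high w (tp \<tau> j) (tq \<tau> j)) = tk \<tau> j)"
  by (simp add: rank_conditions_def high_def)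

lemma type_A_staircase:
  assumes "type_A_triple \<tau>"
  shows "staircase \<tau>"
proof -
  have "0 < tk \<tau> i" if "i \<in> {1..tlen \<tau>}" for i
  proof (cases "i = 1")
    case False
    then have "tk \<tau> 1 < tk \<tau> i"
      using assms that by (intro strict_mono_onD[of "{1..tlen \<tau>}" "tk \<tau>"]) (auto simp: type_A_triple_def)
    then show ?thesis by simp
  qed (use assms in \<open>simp add: type_A_triple_def\<close>)
  moreover have "0 < tl_val \<tau> i" if "i \<in> {1..tlen \<tau>}" for i
  proof (cases "i = tlen \<tau>")
    case False
    then have "tl_val \<tau> (tlen \<tau>) < tl_val \<tau> i"
      using assms that by (intro monotone_onD[of "{1..tlen \<tau>}" "(<)" "(>)" "tl_val \<tau>"]) (auto simp: type_A_triple_def)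
    then show ?thesis using assms by (simp add: type_A_triple_def)
  qed (use assms in \<open>simp add: type_A_triple_def\<close>)
  ultimately show ?thesis using assms by (simp add: type_A_triple_def staircase_def)
qed

section \<open>The minimal permutation of a staircase triple\<close>

context
  fixes \<tau> :: triple
  assumes staircase: "staircase \<tau>"
begin

lemma tk_less: "i \<in> {1..tlen \<tau>} \<Longrightarrow> j \<in> {1..tlen \<tau>} \<Longrightarrow> i < j \<Longrightarrow> tk \<tau> i < tk \<tau> j"
  using staircase strict_mono_onD[of "{1..tlen \<tau>}" "tk \<tau>" i j] by (simp add: staircase_def)

lemma tl_less: "i \<in> {1..tlen \<tau>} \<Longrightarrow> j \<in> {1..tlen \<tau>} \<Longrightarrow> i < j \<Longrightarrow> tl_val \<tau> j < tl_val \<tau> i"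
  using staircase monotone_onD[of "{1..tlen \<tau>}" "(<)" "(>)" "tl_val \<tau>" i j]
  by (simp add: staircase_def)

lemma tp_le: "i \<in> {1..tlen \<tau>} \<Longrightarrow> j \<in> {1..tlen \<tau>} \<Longrightarrow> i \<le> j \<Longrightarrow> tp \<tau> i \<le> tp \<tau> j"
  using staircase monotone_onD[of "{1..tlen \<tau>}" "(\<le>)" "(\<le>)" "tp \<tau>" i j]
  by (simp add: staircase_def)

lemma tq_le: "i \<in> {1..tlen \<tau>} \<Longrightarrow> j \<in> {1..tlen \<tau>} \<Longrightarrow> i \<le> j \<Longrightarrow> tq \<tau> j \<le> tq \<tau> i"
  using staircase monotone_onD[of "{1..tlen \<tau>}" "(\<le>)" "(\<ge>)" "tq \<tau>" i j]
  by (simp add: staircase_def)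

lemma tk_pos: "i \<in> {1..tlen \<tau>} \<Longrightarrow> 0 < tk \<tau> i"
  using staircase by (simp add: staircase_def)

lemma tl_pos: "i \<in> {1..tlen \<tau>} \<Longrightarrow> 0 < tl_val \<tau> i"
  using staircase by (simp add: staircase_def)

lemma high_mono:
  "i \<in> {1..tlen \<tau>} \<Longrightarrow> j \<in> {1..tlen \<tau>} \<Longrightarrow> i \<le> j \<Longrightarrow>
    high w (tp \<tau> i) (tq \<tau> i) \<subseteq> high w (tp \<tau> j) (tq \<tau> j)"
  using tp_le[of i j] tq_le[of i j] by (auto simp: high_def)

lemma low_antimono:
  "i \<in> {1..tlen \<tau>} \<Longrightarrow> j \<in> {1..tlen \<tau>} \<Longrightarrow> i \<le> j \<Longrightarrow>
    low w (tp \<tau> j) (tq \<tau> j) \<subseteq> low w (tp \<tau> i) (tq \<tau> i)"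
  using tp_le[of i j] tq_le[of i j] by (auto simp: low_def)

text \<open>Let \<open>j\<close> be the first index at which \<open>a\<close> is high for
  \<open>v\<close>. Then all positions from \<open>a\<close> to p_j are high for \<open>v\<close>,
  while \<open>a\<close> is not high for \<open>v'\<close>; as the two agree before
  \<open>a\<close>, the rank of \<open>v'\<close> at \<open>j\<close> is too small.\<close>

lemma tight_first_difference:
  assumes v: "tight \<tau> v" and v': "tight \<tau> v'"
    and agree: "\<And>c. c < a \<Longrightarrow> v c = v' c" and gt: "v' a < v a"
  shows False
proof -
  have S: "v \<in> S_Z" "v' \<in> S_Z" using v v' by (auto simp: tight_def)
  obtain b where b: "v b = v' a" using S_Z_surj[OF S(1)] by blast
  have "\<not> b < a" using agree[of b] b S_Z_inj[OF S(2), of b a] by auto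
  moreover have "b \<noteq> a" using b gt by auto
  ultimately have "(a, b) \<in> inversions v" using b gt by (simp add: inversions_def)
  then obtain i0 where i0: "essential \<tau> v a b i0" using v by (auto simp: tight_def)
  define J where "J i \<longleftrightarrow> i \<in> {1..tlen \<tau>} \<and> a \<in> high v (tp \<tau> i) (tq \<tau> i)" for i
  have Ji0: "J i0" using i0 by (auto simp: J_def essential_def)
  define j where "j = (LEAST i. J i)"
  have Jj: "J j" unfolding j_def using Ji0 by (rule LeastI)
  have least: "j \<le> i" if "J i" for i unfolding j_def using that by (rule Least_le)
  have j: "j \<in> {1..tlen \<tau>}" "a \<le> tp \<tau> j" "tq \<tau> j < v a" using Jj by (auto simp: J_def high_def)
  \<comment> \<open>The inversion formed by \<open>a\<close> and the later position of the value
    \<open>v' a\<close> is forced at \<open>i0\<close>, so this value is at most q at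
    \<open>i0\<close>, and q decreases with the index.\<close>
  have v'a: "v' a \<le> tq \<tau> j"
    using i0 b tq_le[OF j(1), of i0] least[OF Ji0] by (auto simp: essential_def low_def)
  have after: "tq \<tau> j < v d" if d: "a < d" "d \<le> tp \<tau> j" for d
  proof (rule ccontr)
    assume "\<not> tq \<tau> j < v d"
    with j d have "(a, d) \<in> inversions v" by (simp add: inversions_def)
    then obtain i where i: "essential \<tau> v a d i" using v by (auto simp: tight_def)
    then have "J i" by (auto simp: J_def essential_def)
    then have "tp \<tau> j \<le> tp \<tau> i" using least[of i] j(1) by (auto simp: J_def intro: tp_le)
    then show False using i d by (auto simp: essential_def low_def)
  qed
  have "high v' (tp \<tau> j) (tq \<tau> j) \<subset> high v (tp \<tau> j) (tq \<tau> j)"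
  proof
    show "high v' (tp \<tau> j) (tq \<tau> j) \<subseteq> high v (tp \<tau> j) (tq \<tau> j)"
    proof
      fix c assume c: "c \<in> high v' (tp \<tau> j) (tq \<tau> j)"
      consider "c < a" | "c = a" | "a < c" by linarith
      then show "c \<in> high v (tp \<tau> j) (tq \<tau> j)"
        using c agree[of c] v'a after[of c] by cases (auto simp: high_def)
    qed
    show "high v' (tp \<tau> j) (tq \<tau> j) \<noteq> high v (tp \<tau> j) (tq \<tau> j)"
      using j v'a by (auto simp: high_def set_eq_iff intro!: exI[of _ a])
  qed
  then have "card (high v' (tp \<tau> j) (tq \<tau> j)) < card (high v (tp \<tau> j) (tq \<tau> j))"
    by (rule psubset_card_mono[OF finite_high[OF S(1)]])
  then show False using v v' j(1) by (auto simp: tight_def rank_conditions_high)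
qed

lemma tight_unique:
  assumes v: "tight \<tau> v" and v': "tight \<tau> v'"
  shows "v = v'"
proof (rule ccontr)
  assume ne: "v \<noteq> v'"
  let ?D = "{a. v a \<noteq> v' a}"
  have "?D \<subseteq> {a. v a \<noteq> a} \<union> {a. v' a \<noteq> a}" by auto
  then have fin: "finite ?D" using v v' by (auto simp: tight_def S_Z_def intro: finite_subset)
  have "?D \<noteq> {}" using ne by auto
  from Min_in[OF fin this] have diff: "v (Min ?D) \<noteq> v' (Min ?D)" by simp
  have agree: "v c = v' c" if "c < Min ?D" for c
  proof (rule ccontr)
    assume "v c \<noteq> v' c"
    then have "Min ?D \<le> c" by (intro Min_le[OF fin]) simp
    then show False using that by simp
  qed
  show False
  proof (cases "v' (Min ?D) < v (Min ?D)")
    case True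
    show ?thesis by (rule tight_first_difference[OF v v' agree True])
  next
    case False
    then have lt: "v (Min ?D) < v' (Min ?D)" using diff by simp
    have agree': "v' c = v c" if "c < Min ?D" for c using agree[OF that] by simp
    show ?thesis by (rule tight_first_difference[OF v' v agree' lt])
  qed
qed

definition minimal :: "(int \<Rightarrow> int) \<Rightarrow> bool" where
  "minimal w \<longleftrightarrow> dominates \<tau> w \<and> (\<forall>v. dominates \<tau> v \<longrightarrow> perm_length w \<le> perm_length v)"

text \<open>Exchanging the two values lowers only the ranks at which the inversion is essential,
  each by at most 1. If all of these have slack, the result still dominates and is shorter. Without
  essential indices the condition is vacuous, so every inversion of a minimal permutation is
  essential somewhere.\<close>

lemma minimal_inversion:
  assumes min: "minimal w" and inv: "(a, b) \<in> inversions w"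
    and loose: "\<And>j. essential \<tau> w a b j \<Longrightarrow> tk \<tau> j < card (high w (tp \<tau> j) (tq \<tau> j))"
  shows False
proof -
  let ?v = "w \<circ> transpose a b"
  have S: "w \<in> S_Z" and dom: "dominates \<tau> w" using min by (auto simp: minimal_def dominates_def)
  have Sv: "?v \<in> S_Z" by (rule S_Z_comp_transpose[OF S])
  have ab: "a < b" "w b < w a" using inv by (auto simp: inversions_def)
  have "tk \<tau> j \<le> card (high ?v (tp \<tau> j) (tq \<tau> j))" if j: "j \<in> {1..tlen \<tau>}" for j
  proof -
    let ?p = "tp \<tau> j" and ?q = "tq \<tau> j"
    have kj: "tk \<tau> j \<le> card (high w ?p ?q)" using dom j by (auto simp: dominates_def)
    consider "b \<le> ?p" | "?p < a" | "a \<le> ?p" "?p < b" "essential \<tau> w a b j"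
      | "a \<le> ?p" "?p < b" "\<not> essential \<tau> w a b j" by linarith
    then show ?thesis
    proof cases
      case 1
      have "high ?v ?p ?q = transpose a b ` high w ?p ?q"
      proof -
        have iff: "c \<in> high ?v ?p ?q \<longleftrightarrow> transpose a b c \<in> high w ?p ?q" for c
          using 1 ab(1) by (cases "c = a"; cases "c = b") (simp_all add: high_def)
        show ?thesis
        proof (intro equalityI subsetI)
          fix c assume "c \<in> high ?v ?p ?q"
          then have "transpose a b (transpose a b c) \<in> transpose a b ` high w ?p ?q"
            unfolding iff by (rule imageI)
          then show "c \<in> transpose a b ` high w ?p ?q" by simp
        next
          fix c assume "c \<in> transpose a b ` high w ?p ?q"
          then obtain d where d: "d \<in> high w ?p ?q" "c = transpose a b d" by blast
          then show "c \<in> high ?v ?p ?q" unfolding iff by simp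
        qed
      qed
      then have "card (high ?v ?p ?q) = card (high w ?p ?q)"
        by (simp add: card_image[OF inj_on_subset[OF inj_transpose subset_UNIV]])
      then show ?thesis using kj by simp
    next
      case 2
      have "c \<in> high ?v ?p ?q \<longleftrightarrow> c \<in> high w ?p ?q" for c
        using 2 ab(1) by (simp add: high_def transpose_def)
      then have "high ?v ?p ?q = high w ?p ?q" by blast
      then show ?thesis using kj by simp
    next
      case 3
      have "high w ?p ?q - {a} \<subseteq> high ?v ?p ?q"
        using 3(1,2) by (auto simp: high_def transpose_def)
      then have "card (high w ?p ?q - {a}) \<le> card (high ?v ?p ?q)"
        by (rule card_mono[OF finite_high[OF Sv]])
      then show ?thesis using loose[OF 3(3)] finite_high[OF S, of ?p ?q]
        by (simp add: card_Diff_singleton_if split: if_splits)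
    next
      case 4
      have "c \<in> high ?v ?p ?q" if "c \<in> high w ?p ?q" for c
        using 4 j ab that
        by (cases "c = a"; cases "c = b") (simp_all add: high_def low_def essential_def)
      then have "high w ?p ?q \<subseteq> high ?v ?p ?q" by (rule subsetI)
      then have "card (high w ?p ?q) \<le> card (high ?v ?p ?q)"
        by (rule card_mono[OF finite_high[OF Sv]])
      then show ?thesis using kj by simp
    qed
  qed
  then have "dominates \<tau> ?v" using Sv by (simp add: dominates_def)
  then have "perm_length w \<le> perm_length ?v" using min by (simp add: minimal_def)
  then show False using perm_length_transpose_less[OF S ab] by simp
qed

lemma high_low_inversion: "a \<in> high w p q \<Longrightarrow> b \<in> low w p q \<Longrightarrow> (a, b) \<in> inversions w"
  by (auto simp: high_def low_def inversions_def)

lemma card_low_tl: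
  assumes "w \<in> S_Z"
  shows "int (card (low w (tp \<tau> j) (tq \<tau> j)))
       = tl_val \<tau> j + int (card (high w (tp \<tau> j) (tq \<tau> j))) - int (tk \<tau> j)"
  using card_high_low[OF assms, of "tp \<tau> j" "tq \<tau> j"] by (simp add: tl_val_def)

text \<open>Suppose some rank is too large, first at \<open>j0\<close>. Strict growth of k gives
  \<open>a\<close> high at \<open>j0\<close> but not earlier; strict decrease of l gives
  \<open>b\<close> low at \<open>j0\<close> but not at any later index with exact rank. The
  inversion (a, b) is then essential only at indices with slack, so it could be removed.\<close>

lemma minimal_tight:
  assumes min: "minimal w"
  shows "tight \<tau> w"
proof -
  let ?A = "\<lambda>j. high w (tp \<tau> j) (tq \<tau> j)" and ?B = "\<lambda>j. low w (tp \<tau> j) (tq \<tau> j)"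
  have S: "w \<in> S_Z" and dom: "dominates \<tau> w" using min by (auto simp: minimal_def dominates_def)
  have "card (?A j) = tk \<tau> j" if "j \<in> {1..tlen \<tau>}" for j
  proof (rule ccontr)
    assume "card (?A j) \<noteq> tk \<tau> j"
    define L where "L i \<longleftrightarrow> i \<in> {1..tlen \<tau>} \<and> tk \<tau> i < card (?A i)" for i
    have tightI: "card (?A i) = tk \<tau> i" if "i \<in> {1..tlen \<tau>}" "\<not> L i" for i
      using that dom by (force simp: L_def dominates_def)
    have "L j" using tightI[of j] that \<open>card (?A j) \<noteq> tk \<tau> j\<close> by blast
    define j0 where "j0 = (LEAST i. L i)"
    have Lj0: "L j0" unfolding j0_def using \<open>L j\<close> by (rule LeastI)
    have least: "j0 \<le> i" if "L i" for i unfolding j0_def using that by (rule Least_le)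
    have j0: "j0 \<in> {1..tlen \<tau>}" "tk \<tau> j0 < card (?A j0)" using Lj0 by (auto simp: L_def)
    have "\<exists>a\<in>?A j0. \<forall>i\<in>{1..tlen \<tau>}. i < j0 \<longrightarrow> a \<notin> ?A i"
    proof (cases "j0 = 1")
      case True
      have "?A j0 \<noteq> {}" using j0(2) by auto
      then show ?thesis using True by auto
    next
      case False
      then have pred: "j0 - 1 \<in> {1..tlen \<tau>}" "j0 - 1 < j0" using j0(1) by auto
      then have "card (?A (j0 - 1)) = tk \<tau> (j0 - 1)" using least[of "j0 - 1"] by (intro tightI) auto
      also have "\<dots> < card (?A j0)" using tk_less[OF pred(1) j0(1) pred(2)] j0(2) by simp
      finally have "\<not> ?A j0 \<subseteq> ?A (j0 - 1)"
        using card_mono[OF finite_high[OF S]] by (meson leD)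
      then obtain a where a: "a \<in> ?A j0" "a \<notin> ?A (j0 - 1)" by auto
      have "a \<notin> ?A i" if "i \<in> {1..tlen \<tau>}" "i < j0" for i
      proof -
        have "i \<le> j0 - 1" using that(2) by simp
        then show ?thesis using a(2) high_mono[OF that(1) pred(1), of w] by blast
      qed
      then show ?thesis using a(1) by blast
    qed
    then obtain a where a: "a \<in> ?A j0" "\<And>i. i \<in> {1..tlen \<tau>} \<Longrightarrow> i < j0 \<Longrightarrow> a \<notin> ?A i" by blast
    define T where "T i \<longleftrightarrow> i \<in> {1..tlen \<tau>} \<and> j0 < i \<and> \<not> L i" for i
    have cardB: "tl_val \<tau> j0 < int (card (?B j0))"
      using card_low_tl[OF S, of j0] j0(2) by simp
    have "\<exists>b\<in>?B j0. \<forall>i. T i \<longrightarrow> b \<notin> ?B i"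
    proof (cases "\<exists>i. T i")
      case False
      have "?B j0 \<noteq> {}" using cardB tl_pos[OF j0(1)] by auto
      then show ?thesis using False by auto
    next
      case True
      define j1 where "j1 = (LEAST i. T i)"
      have Tj1: "T j1" unfolding j1_def using True by (rule LeastI_ex)
      have least1: "j1 \<le> i" if "T i" for i unfolding j1_def using that by (rule Least_le)
      have j1: "j1 \<in> {1..tlen \<tau>}" "j0 < j1" using Tj1 by (auto simp: T_def)
      have "int (card (?B j1)) = tl_val \<tau> j1"
        using card_low_tl[OF S, of j1] tightI[of j1] Tj1 by (simp add: T_def)
      also have "\<dots> < int (card (?B j0))" using tl_less[OF j0(1) j1] cardB by simp
      finally have "\<not> ?B j0 \<subseteq> ?B j1"
        using card_mono[OF finite_low[OF S]] by (meson leD of_nat_less_iff)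
      then obtain b where b: "b \<in> ?B j0" "b \<notin> ?B j1" by auto
      have "b \<notin> ?B i" if "T i" for i
        using b(2) low_antimono[OF j1(1), of i w] least1[OF that] that by (auto simp: T_def)
      then show ?thesis using b(1) by blast
    qed
    then obtain b where b: "b \<in> ?B j0" "\<And>i. T i \<Longrightarrow> b \<notin> ?B i" by blast
    show False
    proof (rule minimal_inversion[OF min high_low_inversion[OF a(1) b(1)]])
      fix i assume i: "essential \<tau> w a b i"
      then have "\<not> i < j0" "\<not> T i" using a(2) b(2) by (auto simp: essential_def)
      then have "L i" using i Lj0 by (cases "i = j0") (auto simp: T_def essential_def)
      then show "tk \<tau> i < card (?A i)" by (simp add: L_def)
    qed
  qed
  then have "rank_conditions \<tau> w" by (simp add: rank_conditions_high)
  moreover have "\<exists>j. essential \<tau> w a b j" if "(a, b) \<in> inversions w" for a b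
    using minimal_inversion[OF min that] by blast
  ultimately show ?thesis using S by (auto simp: tight_def)
qed

text \<open>Reversing a large interval sends its first k_j positions, all at most p_j, to values
  above q_j. The sum defining \<open>N\<close> bounds all indices at once.\<close>

lemma dominates_exists: "\<exists>w. dominates \<tau> w"
proof -
  define N where "N = (\<Sum>j\<in>{1..tlen \<tau>}. \<bar>tp \<tau> j\<bar> + \<bar>tq \<tau> j\<bar> + int (tk \<tau> j)) + 1"
  define w :: "int \<Rightarrow> int" where "w = (\<lambda>i. if \<bar>i\<bar> \<le> N then - i else i)"
  have "w \<circ> w = id" by (auto simp: w_def)
  then have "bij w" using o_bij by blast
  moreover have "{i. w i \<noteq> i} \<subseteq> {-N..N}" by (auto simp: w_def)
  then have "finite {i. w i \<noteq> i}" by (rule finite_subset) simp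
  ultimately have S: "w \<in> S_Z" by (simp add: S_Z_def)
  have "tk \<tau> j \<le> card (high w (tp \<tau> j) (tq \<tau> j))" if j: "j \<in> {1..tlen \<tau>}" for j
  proof -
    have N: "\<bar>tp \<tau> j\<bar> + \<bar>tq \<tau> j\<bar> + int (tk \<tau> j) < N"
      using member_le_sum[OF j, of "\<lambda>j. \<bar>tp \<tau> j\<bar> + \<bar>tq \<tau> j\<bar> + int (tk \<tau> j)"] by (simp add: N_def)
    have "{-N..<-N + int (tk \<tau> j)} \<subseteq> high w (tp \<tau> j) (tq \<tau> j)"
      using N by (auto simp: high_def w_def)
    from card_mono[OF finite_high[OF S] this] show ?thesis by simp
  qed
  then show ?thesis using S by (auto simp: dominates_def)
qed

lemma minimal_exists: "\<exists>w. minimal w"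
proof -
  obtain w1 where "dominates \<tau> w1" using dominates_exists by (rule exE)
  from ex_has_least_nat[of "dominates \<tau>", OF this, of perm_length]
  show ?thesis unfolding minimal_def by simp
qed

lemma tight_iff_minimal: "tight \<tau> w \<longleftrightarrow> minimal w"
proof -
  obtain w0 where w0: "minimal w0" using minimal_exists by (rule exE)
  show ?thesis
  proof
    assume "tight \<tau> w"
    then have "w = w0" using minimal_tight[OF w0] by (rule tight_unique)
    then show "minimal w" using w0 by simp
  qed (rule minimal_tight)
qed

text \<open>The form in which minimality is used: a permutation other than \<open>w\<close> and no
  longer than \<open>w\<close> violates some rank inequality.\<close>

lemma tight_least:
  assumes "tight \<tau> w" "dominates \<tau> v" "perm_length v \<le> perm_length w"
  shows "v = w"
proof -
  have "minimal v" using assms unfolding tight_iff_minimal by (auto simp: minimal_def intro: order_trans)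
  then show ?thesis using minimal_tight tight_unique assms(1) by simp
qed

text \<open>The minimiser under inequalities satisfies the equations, so both minimisation problems
  have the same solution.\<close>

lemma tight_triple_perm: "tight \<tau> (triple_perm \<tau>)"
proof -
  obtain w0 where w0: "minimal w0" using minimal_exists by (rule exE)
  have dom: "dominates \<tau> v" if "v \<in> S_Z" "rank_conditions \<tau> v" for v
    using that by (auto simp: dominates_def rank_conditions_high)
  have t: "tight \<tau> w0" using w0 by (rule minimal_tight)
  have "triple_perm \<tau> = w0"
    unfolding triple_perm_def
  proof (rule the_equality)
    show "w0 \<in> S_Z \<and> rank_conditions \<tau> w0 \<and> (\<forall>v\<in>S_Z. rank_conditions \<tau> v \<longrightarrow> perm_length w0 \<le> perm_length v)"
      using t w0 dom by (auto simp: tight_def minimal_def)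
  next
    fix w assume w: "w \<in> S_Z \<and> rank_conditions \<tau> w \<and> (\<forall>v\<in>S_Z. rank_conditions \<tau> v \<longrightarrow> perm_length w \<le> perm_length v)"
    then have "perm_length w \<le> perm_length w0" using t by (auto simp: tight_def)
    then show "w = w0" using tight_least[OF t dom] w by blast
  qed
  then show ?thesis using t by simp
qed

lemma triple_index:
  assumes "1 \<le> tlen \<tau>" "k \<le> triple_ks \<tau>"
  shows "triple_index \<tau> k \<in> {1..tlen \<tau>}" "k \<le> tk \<tau> (triple_index \<tau> k)"
    and "j \<in> {1..tlen \<tau>} \<Longrightarrow> k \<le> tk \<tau> j \<Longrightarrow> triple_index \<tau> k \<le> j"
proof -
  let ?P = "\<lambda>i. 1 \<le> i \<and> i \<le> tlen \<tau> \<and> k \<le> tk \<tau> i"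
  have "?P (tlen \<tau>)" using assms by (simp add: triple_ks_def)
  then have "?P (triple_index \<tau> k)" unfolding triple_index_def by (rule LeastI)
  then show "triple_index \<tau> k \<in> {1..tlen \<tau>}" "k \<le> tk \<tau> (triple_index \<tau> k)" by auto
  show "triple_index \<tau> k \<le> j" if "j \<in> {1..tlen \<tau>}" "k \<le> tk \<tau> j"
    unfolding triple_index_def using that by (intro Least_le) auto
qed

lemma tk_le_ks: "j \<in> {1..tlen \<tau>} \<Longrightarrow> tk \<tau> j \<le> triple_ks \<tau>"
  using tk_less[of j "tlen \<tau>"] by (cases "j = tlen \<tau>") (auto simp: triple_ks_def)

end

section \<open>The inversions of a tight permutation\<close>

text \<open>A single enumeration has every member of the chain as an initial segment. It will match
  the rows of the determinant with positions of the permutation.\<close>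

lemma enumerate_chain:
  fixes A :: "nat \<Rightarrow> 'a set" and c :: "nat \<Rightarrow> nat"
  assumes "\<And>j. j \<in> {1..s} \<Longrightarrow> finite (A j) \<and> card (A j) = c j"
    and "\<And>i j. i \<in> {1..s} \<Longrightarrow> j \<in> {1..s} \<Longrightarrow> i \<le> j \<Longrightarrow> A i \<subseteq> A j \<and> c i \<le> c j"
    and "1 \<le> s"
  shows "\<exists>\<alpha>. inj_on \<alpha> {1..c s} \<and> (\<forall>j\<in>{1..s}. \<alpha> ` {1..c j} = A j)"
  using assms(3,1,2)
proof (induction s rule: nat_induct_at_least)
  case base
  have "finite (A 1)" "card (A 1) = card {1..c 1}" using base by auto
  then have "\<exists>f. bij_betw f {1..c 1} (A 1)" by (intro finite_same_card_bij) auto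
  then show ?case by (auto simp: bij_betw_def)
next
  case (Suc s)
  have "\<exists>\<alpha>. inj_on \<alpha> {1..c s} \<and> (\<forall>j\<in>{1..s}. \<alpha> ` {1..c j} = A j)"
    by (rule Suc.IH) (use Suc.prems in auto)
  then obtain \<alpha> where \<alpha>: "inj_on \<alpha> {1..c s}" "\<And>j. j \<in> {1..s} \<Longrightarrow> \<alpha> ` {1..c j} = A j" by blast
  have le: "A s \<subseteq> A (Suc s)" "c s \<le> c (Suc s)" using Suc.prems(2)[of s "Suc s"] Suc.hyps by auto
  have fin: "finite (A s)" "card (A s) = c s" using Suc.prems(1)[of s] Suc.hyps by auto
  have fin': "finite (A (Suc s))" "card (A (Suc s)) = c (Suc s)" using Suc.prems(1)[of "Suc s"] by auto
  have "card (A (Suc s) - A s) = card {c s<..c (Suc s)}"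
    using fin fin' le by (simp add: card_Diff_subset)
  then obtain \<beta> where \<beta>: "bij_betw \<beta> {c s<..c (Suc s)} (A (Suc s) - A s)"
    using fin' finite_same_card_bij[of "{c s<..c (Suc s)}" "A (Suc s) - A s"] by auto
  define \<gamma> where "\<gamma> i = (if i \<le> c s then \<alpha> i else \<beta> i)" for i
  have split: "{1..c (Suc s)} = {1..c s} \<union> {c s<..c (Suc s)}" using le by auto
  have \<gamma>1: "\<gamma> ` {1..c j} = A j" if "j \<in> {1..s}" for j
  proof -
    have "c j \<le> c s" using Suc.prems(2)[of j s] that by auto
    then have "\<gamma> ` {1..c j} = \<alpha> ` {1..c j}" by (auto simp: \<gamma>_def)
    then show ?thesis using \<alpha>(2) that by simp
  qed
  have "bij_betw \<alpha> {1..c s} (A s)" using \<alpha> Suc.hyps by (auto simp: bij_betw_def)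
  then have "bij_betw \<gamma> {1..c s} (A s)" by (rule bij_betw_cong[THEN iffD1, rotated]) (simp add: \<gamma>_def)
  moreover have "bij_betw \<gamma> {c s<..c (Suc s)} (A (Suc s) - A s)"
    using \<beta> by (rule bij_betw_cong[THEN iffD1, rotated]) (simp add: \<gamma>_def)
  ultimately have "bij_betw \<gamma> {1..c (Suc s)} (A s \<union> (A (Suc s) - A s))"
    unfolding split by (rule bij_betw_combine) auto
  then have "bij_betw \<gamma> {1..c (Suc s)} (A (Suc s))" using le by (simp add: Un_absorb1)
  then have \<gamma>2: "inj_on \<gamma> {1..c (Suc s)}" "\<gamma> ` {1..c (Suc s)} = A (Suc s)"
    by (simp_all add: bij_betw_def)
  have "\<gamma> ` {1..c j} = A j" if "j \<in> {1..Suc s}" for j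
    using \<gamma>1[of j] \<gamma>2(2) that by (cases "j = Suc s") auto
  then show ?case using \<gamma>2(1) by blast
qed

text \<open>The position \<alpha> k is high exactly from the index \<open>triple_index\<close> of k
  onwards, and \<open>low\<close> shrinks with the index. So all forced inversions at \<alpha> k
  already come from that first index.\<close>

lemma tight_inversions:
  assumes st: "staircase \<tau>" and t: "tight \<tau> w" and s: "1 \<le> tlen \<tau>"
  obtains \<alpha> where "inj_on \<alpha> {1..triple_ks \<tau>}"
    "\<And>j. j \<in> {1..tlen \<tau>} \<Longrightarrow> \<alpha> ` {1..tk \<tau> j} = high w (tp \<tau> j) (tq \<tau> j)"
    "bij_betw (\<lambda>(k, b). (\<alpha> k, b))
      (SIGMA k:{1..triple_ks \<tau>}. low w (tp \<tau> (triple_index \<tau> k)) (tq \<tau> (triple_index \<tau> k)))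
      (inversions w)"
proof -
  let ?A = "\<lambda>j. high w (tp \<tau> j) (tq \<tau> j)" and ?B = "\<lambda>j. low w (tp \<tau> j) (tq \<tau> j)"
  let ?i = "triple_index \<tau>"
  have S: "w \<in> S_Z" using t by (simp add: tight_def)
  have "\<exists>\<alpha>. inj_on \<alpha> {1..tk \<tau> (tlen \<tau>)} \<and> (\<forall>j\<in>{1..tlen \<tau>}. \<alpha> ` {1..tk \<tau> j} = ?A j)"
  proof (rule enumerate_chain[of "tlen \<tau>" ?A "tk \<tau>"])
    show "finite (?A j) \<and> card (?A j) = tk \<tau> j" if "j \<in> {1..tlen \<tau>}" for j
      using t that finite_high[OF S] by (auto simp: tight_def rank_conditions_high)
    show "?A i \<subseteq> ?A j \<and> tk \<tau> i \<le> tk \<tau> j" if "i \<in> {1..tlen \<tau>}" "j \<in> {1..tlen \<tau>}" "i \<le> j" for i j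
      using high_mono[OF st that] tk_less[OF st that(1,2)] that(3) by (cases "i = j") auto
  qed (rule s)
  then obtain \<alpha> where \<alpha>: "inj_on \<alpha> {1..triple_ks \<tau>}"
    "\<forall>j\<in>{1..tlen \<tau>}. \<alpha> ` {1..tk \<tau> j} = ?A j"
    unfolding triple_ks_def by (elim exE conjE)
  note \<alpha>2 = \<alpha>(2)[rule_format]
  have \<alpha>A: "\<alpha> k \<in> ?A (?i k)" if "k \<in> {1..triple_ks \<tau>}" for k
  proof -
    have "\<alpha> k \<in> \<alpha> ` {1..tk \<tau> (?i k)}"
      using triple_index(2)[OF st s, of k] that by (intro imageI) simp
    then show ?thesis using \<alpha>2[OF triple_index(1)[OF st s, of k]] that by simp
  qed
  have "bij_betw (\<lambda>(k, b). (\<alpha> k, b)) (SIGMA k:{1..triple_ks \<tau>}. ?B (?i k)) (inversions w)"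
    unfolding bij_betw_def
  proof
    show "inj_on (\<lambda>(k, b). (\<alpha> k, b)) (SIGMA k:{1..triple_ks \<tau>}. ?B (?i k))"
    proof (rule inj_onI)
      fix x y
      assume "x \<in> (SIGMA k:{1..triple_ks \<tau>}. ?B (?i k))" "y \<in> (SIGMA k:{1..triple_ks \<tau>}. ?B (?i k))"
        and eq: "(case x of (k, b) \<Rightarrow> (\<alpha> k, b)) = (case y of (k, b) \<Rightarrow> (\<alpha> k, b))"
      then have "fst x \<in> {1..triple_ks \<tau>}" "fst y \<in> {1..triple_ks \<tau>}" by (simp_all add: mem_Sigma_iff split: prod.splits)
      moreover have "\<alpha> (fst x) = \<alpha> (fst y)" "snd x = snd y" using eq by (simp_all split: prod.splits)
      ultimately show "x = y" using inj_onD[OF \<alpha>(1)] by (simp add: prod_eq_iff)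
    qed
    show "(\<lambda>(k, b). (\<alpha> k, b)) ` (SIGMA k:{1..triple_ks \<tau>}. ?B (?i k)) = inversions w"
    proof (intro equalityI subsetI)
      fix x assume "x \<in> (\<lambda>(k, b). (\<alpha> k, b)) ` (SIGMA k:{1..triple_ks \<tau>}. ?B (?i k))"
      then obtain k b where x: "x = (\<alpha> k, b)" "k \<in> {1..triple_ks \<tau>}" "b \<in> ?B (?i k)" by auto
      show "x \<in> inversions w" unfolding x(1) by (rule high_low_inversion[OF st \<alpha>A[OF x(2)] x(3)])
    next
      fix x assume "x \<in> inversions w"
      then obtain a b j where x: "x = (a, b)" "essential \<tau> w a b j"
        using t unfolding tight_def by (cases x) fast
      then have j: "j \<in> {1..tlen \<tau>}" "a \<in> ?A j" "b \<in> ?B j" by (auto simp: essential_def)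
      then obtain k where k: "k \<in> {1..tk \<tau> j}" "a = \<alpha> k"
        unfolding \<alpha>2[OF j(1), symmetric] by fast
      have kks: "k \<in> {1..triple_ks \<tau>}" using k(1) tk_le_ks[OF st j(1)] by auto
      have "b \<in> ?B (?i k)"
      proof -
        have "?i k \<le> j" using triple_index(3)[OF st s, of k j] j(1) k(1) kks by simp
        moreover have "?i k \<in> {1..tlen \<tau>}" using triple_index(1)[OF st s, of k] kks by simp
        ultimately show ?thesis using low_antimono[OF st _ j(1), of "?i k" w] j(3) by blast
      qed
      then show "x \<in> (\<lambda>(k, b). (\<alpha> k, b)) ` (SIGMA k:{1..triple_ks \<tau>}. ?B (?i k))"
        using x k kks by (intro image_eqI[of _ _ "(k, b)"]) auto
    qed
  qed
  with \<alpha>(1) \<alpha>2 show thesis by (rule that)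
qed

text \<open>Needed to match the x-degree of the determinant with the length.\<close>

lemma tight_perm_length:
  assumes st: "staircase \<tau>" and t: "tight \<tau> w" and s: "1 \<le> tlen \<tau>"
  shows "int (perm_length w) = (\<Sum>k=1..triple_ks \<tau>. triple_part \<tau> k)"
proof -
  let ?B = "\<lambda>k. low w (tp \<tau> (triple_index \<tau> k)) (tq \<tau> (triple_index \<tau> k))"
  have S: "w \<in> S_Z" using t by (simp add: tight_def)
  obtain \<alpha> where "bij_betw (\<lambda>(k, b). (\<alpha> k, b)) (SIGMA k:{1..triple_ks \<tau>}. ?B k) (inversions w)"
    by (rule tight_inversions[OF assms])
  then have "perm_length w = card (SIGMA k:{1..triple_ks \<tau>}. ?B k)"
    by (simp add: perm_length_inversions bij_betw_same_card)
  also have "\<dots> = (\<Sum>k=1..triple_ks \<tau>. card (?B k))"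
    by (rule card_SigmaI) (auto intro: finite_low[OF S])
  also have "int \<dots> = (\<Sum>k=1..triple_ks \<tau>. triple_part \<tau> k)"
    unfolding of_nat_sum
  proof (rule sum.cong[OF refl])
    fix k assume k: "k \<in> {1..triple_ks \<tau>}"
    then have "triple_index \<tau> k \<in> {1..tlen \<tau>}" using triple_index(1)[OF st s] by simp
    then show "int (card (?B k)) = triple_part \<tau> k"
      using t card_low_tl[OF st S] by (simp add: triple_part_def tight_def rank_conditions_high)
  qed
  finally show ?thesis .
qed

section \<open>Interpolation characterises double Schubert polynomials\<close>

text \<open>\<open>xfil d f\<close> says that the degree of \<open>f\<close> in the variables \<open>x\<^sub>i\<close> is at most \<open>d\<close>.\<close>

inductive xfil :: "nat \<Rightarrow> epoly \<Rightarrow> bool" where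
  zero: "xfil d 0"
| one: "xfil d 1"
| var: "xfil d f \<Longrightarrow> (\<And>i. v \<noteq> XVar i) \<Longrightarrow> xfil d (var_poly v * f)"
| xvar: "xfil d f \<Longrightarrow> xfil (Suc d) (x_poly i * f)"
| diff: "xfil d f \<Longrightarrow> xfil d g \<Longrightarrow> xfil d (f - g)"

lemma xfil_mono: "xfil d f \<Longrightarrow> d \<le> e \<Longrightarrow> xfil e f"
proof (induction arbitrary: e rule: xfil.induct)
  case (xvar d f i)
  then obtain e' where "e = Suc e'" "d \<le> e'" by (cases e) auto
  then show ?case using xvar.IH xfil.xvar by simp
qed (simp_all add: xfil.zero xfil.one xfil.var xfil.diff)

lemma xfil_uminus: "xfil d f \<Longrightarrow> xfil d (- f)"
  using xfil.diff[OF xfil.zero] by fastforce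

lemma xfil_add: "xfil d f \<Longrightarrow> xfil d g \<Longrightarrow> xfil d (f + g)"
  using xfil.diff[OF _ xfil_uminus, of d f g] by simp

lemma xfil_mult: "xfil a f \<Longrightarrow> xfil b g \<Longrightarrow> xfil (a + b) (f * g)"
proof (induction rule: xfil.induct)
  case (one d)
  then show ?case by (simp add: xfil_mono)
next
  case (xvar d f i)
  then show ?case using xfil.xvar[of "d + b" "f * g" i] by (simp add: mult.assoc)
qed (simp_all add: xfil.zero xfil.var xfil.diff mult.assoc left_diff_distrib)

lemma xfil_sum: "(\<And>i. i \<in> S \<Longrightarrow> xfil d (f i)) \<Longrightarrow> xfil d (sum f S)"
  by (induction S rule: infinite_finite_induct) (simp_all add: xfil.zero xfil_add)

lemma xfil_prod: "(\<And>i. i \<in> S \<Longrightarrow> xfil (d i) (f i)) \<Longrightarrow> xfil (sum d S) (prod f S)"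
  by (induction S rule: infinite_finite_induct) (simp_all add: xfil.one xfil_mult)

lemma xfil_x: "xfil (Suc 0) (x_poly i)"
  using xfil.xvar[OF xfil.one, of 0 i] by simp

lemma xfil_y: "xfil d (y_poly i)"
  using xfil.var[OF xfil.one, of "YVar i" d] by simp

definition permute_x :: "(int \<Rightarrow> int) \<Rightarrow> epoly \<Rightarrow> epoly" where
  "permute_x \<sigma> = eval_epoly (\<lambda>v. case v of
     CVar k \<Rightarrow> var_poly (CVar k) | XVar j \<Rightarrow> x_poly (\<sigma> j) | YVar j \<Rightarrow> y_poly j)"

lemma swap_x_permute: "swap_x i = permute_x (transpose i (i+1))"
  by (simp add: swap_x_def subst_poly_eq_eval permute_x_def)

lemma permute_x_comp: "permute_x \<sigma> (permute_x \<tau> f) = permute_x (\<sigma> \<circ> \<tau>) f"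
  unfolding permute_x_def eval_comp by (rule eval_cong) (simp split: var.split)

lemma permute_x_simps [simp]:
  "permute_x \<sigma> 0 = 0" "permute_x \<sigma> 1 = 1"
  "permute_x \<sigma> (f * g) = permute_x \<sigma> f * permute_x \<sigma> g"
  "permute_x \<sigma> (f - g) = permute_x \<sigma> f - permute_x \<sigma> g"
  "permute_x \<sigma> (x_poly i) = x_poly (\<sigma> i)"
  by (simp_all add: permute_x_def eval_mult eval_diff)

lemma permute_x_var: "(\<And>i. v \<noteq> XVar i) \<Longrightarrow> permute_x \<sigma> (var_poly v) = var_poly v"
  by (simp add: permute_x_def split: var.split)

lemma xfil_permute_x: "xfil d f \<Longrightarrow> xfil d (permute_x \<sigma> f)"
  by (induction rule: xfil.induct)
    (simp_all add: permute_x_var xfil.zero xfil.one xfil.var xfil.xvar xfil.diff)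

lemma var_poly_inj [simp]: "var_poly u = var_poly v \<longleftrightarrow> u = v"
proof
  assume "var_poly u = var_poly v"
  then have "Poly_Mapping.keys (var_poly u) = Poly_Mapping.keys (var_poly v)" by simp
  then have "Poly_Mapping.keys (Poly_Mapping.single u (1::nat)) = Poly_Mapping.keys (Poly_Mapping.single v (1::nat))"
    by (simp add: var_poly_def)
  then show "u = v" by simp
qed simp

text \<open>The twisted Leibniz rule \<open>\<partial>(f g) = (\<partial>f) g + (s f) (\<partial>g)\<close> gives both divisibility and the drop in
  \<open>x\<close>-degree.\<close>

lemma divided_difference_exists:
  assumes "xfil d f"
  shows "\<exists>g. (x_poly i - x_poly (i+1)) * g = f - swap_x i f \<and>
           (case d of 0 \<Rightarrow> g = 0 | Suc e \<Rightarrow> xfil e g)"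
  using assms unfolding swap_x_permute
proof (induction rule: xfil.induct)
  case (zero d)
  show ?case by (rule exI[of _ 0]) (simp add: xfil.zero split: nat.split)
next
  case (one d)
  show ?case by (rule exI[of _ 0]) (simp add: xfil.zero split: nat.split)
next
  case (var d f v)
  then obtain g where g: "(x_poly i - x_poly (i+1)) * g = f - permute_x (transpose i (i+1)) f"
    "case d of 0 \<Rightarrow> g = 0 | Suc e \<Rightarrow> xfil e g" by blast
  have "(x_poly i - x_poly (i+1)) * (var_poly v * g)
      = var_poly v * f - permute_x (transpose i (i+1)) (var_poly v * f)"
    using g(1) by (simp add: permute_x_var[OF var.hyps(2)] mult.left_commute right_diff_distrib)
  then show ?case
    using g(2) xfil.var[OF _ var.hyps(2)] by (intro exI[of _ "var_poly v * g"]) (simp split: nat.splits)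
next
  case (xvar d f j)
  then obtain g where g: "(x_poly i - x_poly (i+1)) * g = f - permute_x (transpose i (i+1)) f"
    "case d of 0 \<Rightarrow> g = 0 | Suc e \<Rightarrow> xfil e g" by blast
  let ?s = "permute_x (transpose i (i+1)) f"
  \<comment> \<open>The divided difference of the single variable \<open>x_poly j\<close>.\<close>
  define \<delta> :: epoly where "\<delta> = (if j = i then 1 else if j = i + 1 then -1 else 0)"
  have \<delta>: "(x_poly i - x_poly (i+1)) * \<delta> = x_poly j - x_poly (transpose i (i+1) j)"
    by (auto simp: \<delta>_def)
  have "(x_poly i - x_poly (i+1)) * (x_poly j * g + \<delta> * ?s)
     = x_poly j * ((x_poly i - x_poly (i+1)) * g) + ((x_poly i - x_poly (i+1)) * \<delta>) * ?s"
    by (simp only: ring_distribs ac_simps)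
  also have "\<dots> = x_poly j * f - permute_x (transpose i (i+1)) (x_poly j * f)"
    unfolding g(1) \<delta> by (simp add: ring_distribs)
  finally have eq: "(x_poly i - x_poly (i+1)) * (x_poly j * g + \<delta> * ?s)
      = x_poly j * f - permute_x (transpose i (i+1)) (x_poly j * f)" .
  have s: "xfil d ?s" using xvar.hyps by (rule xfil_permute_x)
  then have "xfil d (\<delta> * ?s)" by (auto simp: \<delta>_def xfil.zero xfil_uminus)
  moreover have "xfil d (x_poly j * g)"
    using g(2) by (cases d) (simp_all add: xfil.zero xfil.xvar)
  ultimately have "xfil d (x_poly j * g + \<delta> * ?s)" by (intro xfil_add)
  then show ?case using eq by (intro exI[of _ "x_poly j * g + \<delta> * ?s"]) simp
next
  case (diff d f f')
  obtain g where g: "(x_poly i - x_poly (i+1)) * g = f - permute_x (transpose i (i+1)) f"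
    "case d of 0 \<Rightarrow> g = 0 | Suc e \<Rightarrow> xfil e g" using diff.IH(1) by blast
  obtain g' where g': "(x_poly i - x_poly (i+1)) * g' = f' - permute_x (transpose i (i+1)) f'"
    "case d of 0 \<Rightarrow> g' = 0 | Suc e \<Rightarrow> xfil e g'" using diff.IH(2) by blast
  have "(x_poly i - x_poly (i+1)) * (g - g') = (f - f') - permute_x (transpose i (i+1)) (f - f')"
    unfolding right_diff_distrib g(1) g'(1) by simp
  moreover have "case d of 0 \<Rightarrow> g - g' = 0 | Suc e \<Rightarrow> xfil e (g - g')"
    using g(2) g'(2) by (cases d) (simp_all add: xfil.diff)
  ultimately show ?case by blast
qed

lemma divided_difference_eqI:
  assumes "(x_poly i - x_poly (i+1)) * g = f - swap_x i f"
  shows "divided_difference i f = g"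
  unfolding divided_difference_def
proof (rule the_equality)
  fix h assume "(x_poly i - x_poly (i+1)) * h = f - swap_x i f"
  then have "(x_poly i - x_poly (i+1)) * h = (x_poly i - x_poly (i+1)) * g" using assms by simp
  then show "h = g" by simp
qed (rule assms)

text \<open>Localisation at the torus fixed point \<open>v\<close>.\<close>

definition loc :: "(int \<Rightarrow> int) \<Rightarrow> epoly \<Rightarrow> epoly" where
  "loc v = eval_epoly (\<lambda>u. case u of
     CVar k \<Rightarrow> var_poly (CVar k)
   | XVar j \<Rightarrow> if 1 \<le> j then y_poly (v j) else x_poly j
   | YVar j \<Rightarrow> y_poly j)"

lemma loc_simps [simp]:
  "loc v 0 = 0" "loc v 1 = 1"
  "loc v (f * g) = loc v f * loc v g"
  "loc v (f + g) = loc v f + loc v g"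
  "loc v (f - g) = loc v f - loc v g"
  "loc v (- f) = - loc v f"
  "1 \<le> i \<Longrightarrow> loc v (x_poly i) = y_poly (v i)"
  "loc v (y_poly i) = y_poly i"
  by (simp_all add: loc_def eval_simps)

lemma loc_prod: "loc v (prod f S) = (\<Prod>i\<in>S. loc v (f i))"
  by (simp add: loc_def eval_prod)

lemma loc_swap:
  assumes "1 \<le> i"
  shows "loc v (swap_x i f) = loc (v \<circ> transpose i (i+1)) f"
  unfolding swap_x_permute permute_x_def loc_def eval_comp
proof (rule eval_cong)
  fix u
  show "eval_epoly (\<lambda>u. case u of CVar k \<Rightarrow> var_poly (CVar k)
          | XVar j \<Rightarrow> if 1 \<le> j then y_poly (v j) else x_poly j | YVar j \<Rightarrow> y_poly j)
         (case u of CVar k \<Rightarrow> var_poly (CVar k) | XVar j \<Rightarrow> x_poly (transpose i (i+1) j) | YVar j \<Rightarrow> y_poly j)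
      = (case u of CVar k \<Rightarrow> var_poly (CVar k)
          | XVar j \<Rightarrow> if 1 \<le> j then y_poly ((v \<circ> transpose i (i+1)) j) else x_poly j | YVar j \<Rightarrow> y_poly j)"
    using assms by (cases u) (simp_all add: transpose_def)
qed

text \<open>The value of a divided difference at \<open>v\<close> involves only the values of
  \<open>f\<close> at \<open>v\<close> and at its neighbour, whose lengths differ by one; the
  inductions on length rest on this.\<close>

lemma loc_divided_difference:
  assumes "1 \<le> i" "(x_poly i - x_poly (i+1)) * g = f - swap_x i f"
  shows "(y_poly (v i) - y_poly (v (i+1))) * loc v g = loc v f - loc (v \<circ> transpose i (i+1)) f"
  using arg_cong[OF assms(2), of "loc v"] assms(1) by (simp add: loc_swap)

lemma loc_xfil_0: "xfil d f \<Longrightarrow> d = 0 \<Longrightarrow> loc v f = f"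
proof (induction rule: xfil.induct)
  case (var d f u)
  then have "loc v (var_poly u) = var_poly u" by (cases u) (auto simp: loc_def)
  then show ?case using var by simp
qed simp_all

section \<open>Symmetric polynomials\<close>

text \<open>Conjugation by adjacent transpositions moves the second index outwards step by step,
  beyond all variables that occur.\<close>

lemma permute_x_transpose_invariant:
  assumes sym: "\<And>i. 1 \<le> i \<Longrightarrow> swap_x i h = h" and a: "1 \<le> a"
  shows "permute_x (transpose a (a + 1 + int n)) h = h"
proof (induction n)
  case 0
  then show ?case using sym[OF a] by (simp add: swap_x_permute)
next
  case (Suc n)
  let ?b = "a + 1 + int n"
  have s: "permute_x (transpose ?b (?b + 1)) h = h"
    using sym[of ?b] a by (simp add: swap_x_permute)
  have "transpose a (?b + 1) = transpose ?b (?b + 1) \<circ> transpose a ?b \<circ> transpose ?b (?b + 1)"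
    by (auto simp: fun_eq_iff transpose_def)
  then have "permute_x (transpose a (?b + 1)) h
      = permute_x (transpose ?b (?b + 1)) (permute_x (transpose a ?b) (permute_x (transpose ?b (?b + 1)) h))"
    by (simp only: permute_x_comp comp_assoc)
  also have "\<dots> = h" by (simp only: s Suc.IH)
  finally show ?case by (simp add: algebra_simps)
qed

text \<open>A partial \<open>loc id\<close>: widening the range replaces the variables one at a
  time.\<close>

definition subst_x_range :: "int \<Rightarrow> int \<Rightarrow> epoly \<Rightarrow> epoly" where
  "subst_x_range a b = eval_epoly (\<lambda>u. case u of
     CVar k \<Rightarrow> var_poly (CVar k)
   | XVar j \<Rightarrow> if a \<le> j \<and> j \<le> b then y_poly j else x_poly j
   | YVar j \<Rightarrow> y_poly j)"

lemma x_index_bound: "\<exists>N::nat. \<forall>j. XVar j \<in> vars h \<longrightarrow> j \<le> int N"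
proof -
  have "finite {j. XVar j \<in> vars h}"
    using finite_vimageI[OF finite_vars, of XVar h] by (simp add: inj_def vimage_def)
  then have "bdd_above {j. XVar j \<in> vars h}" by (rule bdd_above_finite)
  then obtain M where M: "\<And>j. XVar j \<in> vars h \<Longrightarrow> j \<le> M" by (auto simp: bdd_above_def)
  have "j \<le> int (nat M)" if "XVar j \<in> vars h" for j using M[OF that] by simp
  then show ?thesis by blast
qed

text \<open>A symmetric \<open>h\<close> equals its image under exchanging \<open>x\<^sub>i\<close> with a variable that does not occur in
  \<open>h\<close>, so \<open>x\<^sub>i\<close> does not occur either.\<close>

lemma symmetric_no_x:
  assumes sym: "\<And>i. 1 \<le> i \<Longrightarrow> swap_x i h = h" and i: "1 \<le> i"
  shows "subst_x_range i i h = h"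
proof -
  obtain N :: nat where "\<forall>j. XVar j \<in> vars h \<longrightarrow> j \<le> int N" using x_index_bound by (rule exE)
  then have N: "j \<le> int N" if "XVar j \<in> vars h" for j using that by simp
  let ?M = "i + 1 + int N"
  have inv: "permute_x (transpose i ?M) h = h"
    by (rule permute_x_transpose_invariant[OF sym i])
  have "subst_x_range i i (permute_x (transpose i ?M) h) = permute_x (transpose i ?M) h"
    unfolding subst_x_range_def permute_x_def eval_comp
  proof (rule eval_cong)
    fix u assume u: "u \<in> vars h"
    show "eval_epoly (\<lambda>u. case u of CVar k \<Rightarrow> var_poly (CVar k)
            | XVar j \<Rightarrow> if i \<le> j \<and> j \<le> i then y_poly j else x_poly j | YVar j \<Rightarrow> y_poly j)
          (case u of CVar k \<Rightarrow> var_poly (CVar k) | XVar j \<Rightarrow> x_poly (transpose i ?M j) | YVar j \<Rightarrow> y_poly j)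
        = (case u of CVar k \<Rightarrow> var_poly (CVar k) | XVar j \<Rightarrow> x_poly (transpose i ?M j) | YVar j \<Rightarrow> y_poly j)"
    proof (cases u)
      case (XVar j)
      then have "j \<noteq> ?M" using N[of j] u i by auto
      then have "transpose i ?M j \<noteq> i" by (auto simp: transpose_def)
      then show ?thesis using XVar by auto
    qed simp_all
  qed
  then show ?thesis by (simp only: inv)
qed

lemma symmetric_loc_id:
  assumes sym: "\<And>i. 1 \<le> i \<Longrightarrow> swap_x i h = h"
  shows "loc id h = h"
proof -
  have range: "subst_x_range 1 (int n) h = h" for n
  proof (induction n)
    case 0
    have "subst_x_range 1 (int 0) h = eval_epoly var_poly h"
      unfolding subst_x_range_def by (rule eval_cong) (auto split: var.split)
    then show ?case by (simp add: eval_id)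
  next
    case (Suc n)
    have "subst_x_range 1 (int (Suc n)) h = subst_x_range 1 (int n) (subst_x_range (int (Suc n)) (int (Suc n)) h)"
      unfolding subst_x_range_def eval_comp by (rule eval_cong) (auto split: var.split)
    also have "\<dots> = h" using symmetric_no_x[OF sym, of "int (Suc n)"] Suc by simp
    finally show ?case .
  qed
  obtain N :: nat where "\<forall>j. XVar j \<in> vars h \<longrightarrow> j \<le> int N" using x_index_bound by (rule exE)
  then have N: "j \<le> int N" if "XVar j \<in> vars h" for j using that by simp
  have "loc id h = subst_x_range 1 (int N) h"
    unfolding loc_def subst_x_range_def by (rule eval_cong) (auto split: var.split dest: N)
  then show ?thesis using range by simp
qed

lemma S_plus_comp_transpose:
  assumes "v \<in> S_plus" "1 \<le> i"
  shows "v \<circ> transpose i (i+1) \<in> S_plus"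
  using assms S_Z_comp_transpose[of v i "i+1"] by (auto simp: S_plus_def transpose_def)

lemma id_S_plus: "id \<in> S_plus"
  by (simp add: S_plus_def S_Z_def)

lemma perm_length_id: "perm_length id = 0"
proof -
  have "inversions id = {}" by (auto simp: inversions_def)
  then show ?thesis by (simp add: perm_length_inversions)
qed

text \<open>If \<open>v\<close> has length at most \<open>d\<close>, then \<open>v\<close> and its
  neighbour have length at most \<open>Suc d\<close>, where \<open>h\<close> vanishes. Since the two
  y-variables differ, the divided difference vanishes at \<open>v\<close>, and the induction
  hypothesis applies to it.\<close>

lemma vanishing_imp_zero:
  assumes "xfil d h" "\<And>v. v \<in> S_plus \<Longrightarrow> perm_length v \<le> d \<Longrightarrow> loc v h = 0"
  shows "h = 0"
  using assms
proof (induction d arbitrary: h)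
  case 0
  have "perm_length id \<le> 0" using perm_length_id by (rule eq_imp_le)
  then have "loc id h = 0" by (rule 0(2)[OF id_S_plus])
  then show ?case using loc_xfil_0[OF 0(1) refl, of id] by simp
next
  case (Suc d)
  have "swap_x i h = h" if i: "1 \<le> i" for i
  proof -
    obtain g where g: "(x_poly i - x_poly (i+1)) * g = h - swap_x i h" "xfil d g"
      using divided_difference_exists[OF Suc.prems(1), of i] by auto
    have "loc v g = 0" if v: "v \<in> S_plus" "perm_length v \<le> d" for v
    proof -
      have S: "v \<in> S_Z" using v by (simp add: S_plus_def)
      have "perm_length v \<le> Suc d" using v(2) by simp
      then have 1: "loc v h = 0" by (rule Suc.prems(2)[OF v(1)])
      have "perm_length (v \<circ> transpose i (i+1)) \<le> Suc d"
        by (rule order_trans[OF perm_length_adjacent_le[OF S]]) (simp add: v(2))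
      then have 2: "loc (v \<circ> transpose i (i+1)) h = 0"
        by (rule Suc.prems(2)[OF S_plus_comp_transpose[OF v(1) i]])
      have "(y_poly (v i) - y_poly (v (i+1))) * loc v g = 0"
        unfolding loc_divided_difference[OF i g(1), of v] 1 2 by simp
      then show ?thesis using S_Z_inj[OF S, of i "i+1"] by simp
    qed
    then have "g = 0" by (rule Suc.IH[OF g(2)])
    then show ?thesis using g(1) by simp
  qed
  then have "loc id h = h" by (rule symmetric_loc_id)
  moreover have "perm_length id \<le> Suc d" unfolding perm_length_id by simp
  then have "loc id h = 0" by (rule Suc.prems(2)[OF id_S_plus])
  ultimately show ?case by simp
qed

text \<open>The classical localisation properties of double Schubert polynomials. Nothing is
  prescribed at permutations longer than \<open>w\<close>.\<close>

definition interpolates :: "(int \<Rightarrow> int) \<Rightarrow> epoly \<Rightarrow> bool" where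
  "interpolates w f \<longleftrightarrow> w \<in> S_plus \<and> xfil (perm_length w) f \<and>
     loc w f = (\<Prod>(a, b)\<in>inversions w. y_poly (w a) - y_poly (w b)) \<and>
     (\<forall>v\<in>S_plus. perm_length v \<le> perm_length w \<longrightarrow> v \<noteq> w \<longrightarrow> loc v f = 0)"

lemma interpolates_unique:
  assumes f: "interpolates w f" and g: "interpolates w g"
  shows "f = g"
proof -
  have "f - g = 0"
  proof (rule vanishing_imp_zero)
    show "xfil (perm_length w) (f - g)" using f g by (auto simp: interpolates_def intro: xfil.diff)
    show "loc v (f - g) = 0" if "v \<in> S_plus" "perm_length v \<le> perm_length w" for v
      using f g that by (cases "v = w") (simp_all add: interpolates_def)
  qed
  then show ?thesis by simp
qed

text \<open>For \<open>v\<close> no longer than the new permutation, \<open>f\<close> vanishes at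
  \<open>v\<close> itself, and it vanishes at the neighbour unless that is \<open>w\<close>. There,
  the factor of the inversion (i, i+1) cancels against the denominator, leaving the product over the
  remaining inversions.\<close>

lemma interpolates_descent:
  assumes f: "interpolates w f" and i: "1 \<le> i" and desc: "w i > w (i+1)"
  shows "interpolates (w \<circ> transpose i (i+1)) (divided_difference i f)"
proof -
  let ?t = "transpose i (i+1)"
  let ?w = "w \<circ> ?t"
  have wp: "w \<in> S_plus" and S: "w \<in> S_Z" using f by (auto simp: interpolates_def S_plus_def)
  have len: "perm_length w = Suc (perm_length ?w)" by (rule perm_length_descent[OF S desc])
  have wp': "?w \<in> S_plus" by (rule S_plus_comp_transpose[OF wp i])
  have "xfil (perm_length w) f" using f by (simp add: interpolates_def)
  then obtain g where g: "(x_poly i - x_poly (i+1)) * g = f - swap_x i f" "xfil (perm_length ?w) g"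
    using divided_difference_exists[of "perm_length w" f i] by (auto simp: len)
  have dd: "divided_difference i f = g" by (rule divided_difference_eqI[OF g(1)])
  have van: "loc v f = 0" if "v \<in> S_plus" "perm_length v \<le> perm_length w" "v \<noteq> w" for v
    using f that by (simp add: interpolates_def)
  have vanish: "loc v g = 0" if v: "v \<in> S_plus" "perm_length v \<le> perm_length ?w" "v \<noteq> ?w" for v
  proof -
    have Sv: "v \<in> S_Z" using v by (simp add: S_plus_def)
    have "v \<circ> ?t \<noteq> w"
    proof
      assume "v \<circ> ?t = w"
      then have "v \<circ> ?t \<circ> ?t = ?w" by simp
      moreover have "v \<circ> ?t \<circ> ?t = v" by (simp add: comp_assoc)
      ultimately show False using v(3) by simp
    qed
    moreover have "perm_length (v \<circ> ?t) \<le> perm_length w"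
      by (rule order_trans[OF perm_length_adjacent_le[OF Sv]]) (unfold len, use v(2) in simp)
    ultimately have 1: "loc (v \<circ> ?t) f = 0"
      by (intro van S_plus_comp_transpose[OF v(1) i])
    have "perm_length v < perm_length w" unfolding len using v(2) by (rule le_imp_less_Suc)
    then have 2: "loc v f = 0" by (intro van[OF v(1)]) auto
    have "(y_poly (v i) - y_poly (v (i+1))) * loc v g = 0"
      unfolding loc_divided_difference[OF i g(1), of v] 1 2 by simp
    then show ?thesis using S_Z_inj[OF Sv, of i "i+1"] by simp
  qed
  let ?P = "\<Prod>(a, b)\<in>inversions ?w. y_poly (?w a) - y_poly (?w b)"
  have "loc w f = (\<Prod>(a, b)\<in>inversions w. y_poly (w a) - y_poly (w b))"
    using f by (simp add: interpolates_def)
  also have "\<dots> = (y_poly (w i) - y_poly (w (i+1))) * ?P"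
  proof -
    let ?f = "\<lambda>(a, b). (?t a, ?t b)"
    have inj: "inj_on ?f (inversions ?w)"
      by (intro inj_onI) (auto simp: inj_eq[OF inj_transpose])
    have notin: "(i, i + 1) \<notin> ?f ` inversions ?w"
      by (auto simp: inversions_def transpose_def split: if_splits)
    have fin: "finite (?f ` inversions ?w)"
      using finite_inversions[OF S_Z_comp_transpose[OF S]] by (rule finite_imageI)
    show ?thesis
      unfolding inversions_descent[OF desc] prod.insert[OF fin notin] prod.reindex[OF inj]
      by (simp add: case_prod_unfold)
  qed
  finally have locw: "loc w f = (y_poly (w i) - y_poly (w (i+1))) * ?P" .
  have less: "perm_length ?w < perm_length w" unfolding len by (rule lessI)
  then have "?w \<noteq> w" by (rule contrapos_pn) (simp only: less_irrefl not_False_eq_True)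
  then have 1: "loc ?w f = 0" by (rule van[OF wp' less_imp_le[OF less]])
  have "?w \<circ> ?t = w" by (simp add: comp_assoc)
  moreover have "(y_poly (w (i+1)) - y_poly (w i)) * loc ?w g = loc ?w f - loc (?w \<circ> ?t) f"
    using loc_divided_difference[OF i g(1), of ?w] by simp
  ultimately have "(y_poly (w (i+1)) - y_poly (w i)) * loc ?w g = - loc w f"
    using 1 by (simp only: diff_0)
  also have "\<dots> = (y_poly (w (i+1)) - y_poly (w i)) * ?P"
    unfolding locw by (simp add: algebra_simps)
  finally have "loc ?w g = ?P"
    by (rule mult_left_cancel[THEN iffD1, rotated]) (use desc in simp)
  then show ?thesis unfolding interpolates_def dd using wp' g(2) vanish by blast
qed

section \<open>The longest permutation and the chains starting from it\<close>

lemma involution_S_Z: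
  assumes "\<And>i. w (w i) = i" "finite {i. w i \<noteq> i}"
  shows "w \<in> S_Z"
proof -
  have inv: "w \<circ> w = id" using assms(1) by (simp add: fun_eq_iff)
  show ?thesis using o_bij[OF inv inv] assms(2) by (simp add: S_Z_def)
qed

lemma longest_perm_S_plus: "longest_perm n \<in> S_plus"
proof -
  have "finite {i. longest_perm n i \<noteq> i}"
    by (rule finite_subset[of _ "{1..int n}"]) (auto simp: longest_perm_def)
  then have "longest_perm n \<in> S_Z"
    by (rule involution_S_Z[rotated]) (auto simp: longest_perm_def)
  then show ?thesis by (simp add: S_plus_def longest_perm_def)
qed

lemma S_plus_pos:
  assumes "v \<in> S_plus" "1 \<le> i"
  shows "1 \<le> v i"
proof (rule ccontr)
  assume neg: "\<not> 1 \<le> v i"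
  then have "v (v i) = v i" using assms by (simp add: S_plus_def)
  then have "v i = i" using S_Z_inj[of v] assms by (simp add: S_plus_def)
  then show False using neg assms by simp
qed

lemma inversions_longest:
  "inversions (longest_perm n) = {(a, b). 1 \<le> a \<and> a < b \<and> b \<le> int n}"
  by (auto simp: inversions_def longest_perm_def split: if_splits)

text \<open>The longest permutation sends b to j = n + 1 - b, so the factor for (i, j) in the
  product formula localises to the factor of the inversion (i, b).\<close>

lemma staircase_pairs_bij:
  "bij_betw (\<lambda>(a, b). (a, int n + 1 - b)) (inversions (longest_perm n))
     {(i, j). 1 \<le> i \<and> 1 \<le> j \<and> i + j \<le> int n}"
  by (rule bij_betw_byWitness[of _ "\<lambda>(a, b). (a, int n + 1 - b)"]) (auto simp: inversions_longest)

text \<open>The longest permutation is its minimal permutation, with k_j = j and l_j = n - j. For n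
  at most 1 the triple is empty, which is why \<open>staircase\<close> admits length 0.\<close>

definition staircase_triple :: "nat \<Rightarrow> triple" where
  "staircase_triple n = \<lparr>tlen = n - 1, tk = (\<lambda>i. i), tp = int, tq = (\<lambda>i. int n - int i)\<rparr>"

lemma staircase_staircase_triple: "staircase (staircase_triple n)"
  by (auto simp: staircase_def staircase_triple_def tl_val_def monotone_on_def)

lemma tight_longest: "tight (staircase_triple n) (longest_perm n)"
proof -
  have "high (longest_perm n) (int j) (int n - int j) = {1..int j}" if "j \<in> {1..n - 1}" for j
    using that by (auto simp: high_def longest_perm_def split: if_splits)
  then have "rank_conditions (staircase_triple n) (longest_perm n)"
    by (simp add: rank_conditions_high staircase_triple_def)
  moreover have "essential (staircase_triple n) (longest_perm n) a b (nat a)"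
    if "(a, b) \<in> inversions (longest_perm n)" for a b
  proof -
    have "1 \<le> a" "a < b" "b \<le> int n" using that by (auto simp: inversions_longest)
    then show ?thesis by (auto simp: essential_def staircase_triple_def high_def low_def longest_perm_def)
  qed
  ultimately show ?thesis
    using longest_perm_S_plus[of n] by (auto simp: tight_def S_plus_def)
qed

text \<open>If the product does not vanish at \<open>v\<close>, then i + v i > n for all i in 1..n -
  1, so the first j values exceed n - j. Thus \<open>v\<close> dominates the staircase triple, and
  being no longer than the longest permutation it equals it.\<close>

lemma interpolates_longest:
  "interpolates (longest_perm n)
     (\<Prod>(i, j)\<in>{(i, j). 1 \<le> i \<and> 1 \<le> j \<and> i + j \<le> int n}. x_poly i - y_poly j)"
    (is "interpolates ?w ?f")
proof -
  let ?S = "{(i, j). 1 \<le> i \<and> 1 \<le> j \<and> i + j \<le> int n}"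
  let ?h = "\<lambda>(a, b). (a, int n + 1 - b)"
  have S: "?w \<in> S_Z" using longest_perm_S_plus by (simp add: S_plus_def)
  have card: "card ?S = perm_length ?w"
    using bij_betw_same_card[OF staircase_pairs_bij] by (simp add: perm_length_inversions)
  have fin: "finite ?S"
    using bij_betw_finite[OF staircase_pairs_bij[of n]] finite_inversions[OF S] by simp
  have loc_f: "loc v ?f = (\<Prod>(i, j)\<in>?S. y_poly (v i) - y_poly j)" for v
    unfolding loc_prod by (rule prod.cong) auto
  have "xfil (\<Sum>ij\<in>?S. 1) ?f"
    by (rule xfil_prod) (auto intro!: xfil.diff xfil_x xfil_y)
  then have deg: "xfil (perm_length ?w) ?f" using card by simp
  have "loc ?w ?f = (\<Prod>x\<in>inversions ?w. case ?h x of (i, j) \<Rightarrow> y_poly (?w i) - y_poly j)"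
    unfolding loc_f by (rule prod.reindex_bij_betw[OF staircase_pairs_bij, symmetric])
  also have "\<dots> = (\<Prod>(a, b)\<in>inversions ?w. y_poly (?w a) - y_poly (?w b))"
    unfolding inversions_longest by (rule prod.cong) (auto simp: longest_perm_def)
  finally have locw: "loc ?w ?f = (\<Prod>(a, b)\<in>inversions ?w. y_poly (?w a) - y_poly (?w b))" .
  have "loc v ?f = 0" if v: "v \<in> S_plus" "perm_length v \<le> perm_length ?w" "v \<noteq> ?w" for v
  proof (rule ccontr)
    assume nz: "loc v ?f \<noteq> 0"
    have Sv: "v \<in> S_Z" using v(1) by (simp add: S_plus_def)
    have ne: "v i \<noteq> j" if "(i, j) \<in> ?S" for i j
      using nz fin that unfolding loc_f by (auto simp: prod_zero_iff)
    have "j \<le> card (high v (int j) (int n - int j))" if j: "j \<in> {1..n - 1}" for j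
    proof -
      have "int n - int j < v a" if a: "a \<in> {1..int j}" for a
      proof (rule ccontr)
        assume "\<not> int n - int j < v a"
        then have "(a, v a) \<in> ?S" using a j S_plus_pos[OF v(1), of a] by simp
        then show False using ne by blast
      qed
      then have "{1..int j} \<subseteq> high v (int j) (int n - int j)" by (auto simp: high_def)
      from card_mono[OF finite_high[OF Sv] this] show ?thesis by simp
    qed
    then have "dominates (staircase_triple n) v"
      using Sv by (simp add: dominates_def staircase_triple_def)
    then have "v = ?w"
      by (rule tight_least[OF staircase_staircase_triple tight_longest _ v(2)])
    then show False using v(3) by simp
  qed
  then show ?thesis using deg locw longest_perm_S_plus by (simp add: interpolates_def)
qed

lemma is_double_schubert_interpolates: "is_double_schubert w f \<Longrightarrow> interpolates w f"
  by (induction rule: is_double_schubert.induct) (rule interpolates_longest, rule interpolates_descent)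

text \<open>Descending from the left bounds each value from above by n + 1 - i, and from the right
  bounds it from below by the same number.\<close>

lemma no_ascent_longest:
  assumes w: "w \<in> S_plus" and fixed: "\<And>i. int n < i \<Longrightarrow> w i = i"
    and desc: "\<And>i. 1 \<le> i \<Longrightarrow> i < int n \<Longrightarrow> w (i + 1) < w i"
  shows "w = longest_perm n"
proof -
  have S: "w \<in> S_Z" using w by (simp add: S_plus_def)
  have le_n: "w i \<le> int n" if "i \<le> int n" for i
  proof (rule ccontr)
    assume "\<not> w i \<le> int n"
    then have "w (w i) = w i" using fixed by simp
    then have "w i = i" using S_Z_inj[OF S] by simp
    then show False using that \<open>\<not> w i \<le> int n\<close> by simp
  qed
  have up: "w (int k + 1) \<le> int n - int k" if "k < n" for k
    using that
  proof (induction k)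
    case 0
    then show ?case using le_n[of 1] by simp
  next
    case (Suc k)
    then show ?case using desc[of "int k + 1"] by (simp add: add.commute)
  qed
  have down: "int k + 1 \<le> w (int n - int k)" if "k < n" for k
    using that
  proof (induction k)
    case 0
    then show ?case using S_plus_pos[OF w, of "int n"] by simp
  next
    case (Suc k)
    then show ?case using desc[of "int n - int k - 1"] by (simp add: algebra_simps)
  qed
  show ?thesis
  proof
    fix i
    consider "i \<le> 0" | "int n < i" | "1 \<le> i" "i \<le> int n" by linarith
    then show "w i = longest_perm n i"
    proof cases
      case 3
      then have "nat (i - 1) < n" "nat (int n - i) < n" by auto
      from up[OF this(1)] down[OF this(2)] show ?thesis using 3 by (simp add: longest_perm_def)
    qed (use w fixed in \<open>simp_all add: S_plus_def longest_perm_def\<close>)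
  qed
qed

text \<open>Climbing ascents within 1..n lengthens the permutation until the longest one is reached;
  read backwards, this is a chain of descents.\<close>

lemma is_double_schubert_exists_aux:
  assumes "w \<in> S_plus" "\<And>i. int n < i \<Longrightarrow> w i = i" "n * n - perm_length w = d"
  shows "\<exists>f. is_double_schubert w f"
  using assms
proof (induction d arbitrary: w rule: less_induct)
  case (less d)
  note w = less.prems(1)
  have S: "w \<in> S_Z" using w by (simp add: S_plus_def)
  show ?case
  proof (cases "\<exists>i. 1 \<le> i \<and> i < int n \<and> w i < w (i+1)")
    case False
    have "w = longest_perm n"
    proof (rule no_ascent_longest[OF w less.prems(2)])
      fix i assume "1 \<le> i" "i < int n"
      then show "w (i + 1) < w i" using False S_Z_inj[OF S, of i "i+1"] by force
    qed
    then show ?thesis using is_double_schubert.longest by blast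
  next
    case True
    then obtain i where i: "1 \<le> i" "i < int n" "w i < w (i+1)" by blast
    let ?t = "transpose i (i+1)"
    let ?v = "w \<circ> ?t"
    have v: "?v \<in> S_plus" by (rule S_plus_comp_transpose[OF w i(1)])
    then have Sv: "?v \<in> S_Z" by (simp add: S_plus_def)
    have vfix: "?v j = j" if "int n < j" for j
      using less.prems(2)[OF that] that i by (simp add: transpose_def)
    have vv: "?v \<circ> ?t = w" by (simp add: comp_assoc)
    have len: "perm_length ?v = Suc (perm_length w)"
      using perm_length_descent[OF Sv, of i] i(3) vv by simp
    have "inversions ?v \<subseteq> {1..int n} \<times> {1..int n}"
    proof (rule subrelI)
      fix a b assume ab: "(a, b) \<in> inversions ?v"
      have "1 \<le> a"
      proof (rule ccontr)
        assume "\<not> 1 \<le> a"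
        then have "?v a = a" using v by (simp add: S_plus_def)
        moreover have "?v b < ?v a" "a < b" using ab by (auto simp: inversions_def)
        ultimately show False
          using S_plus_pos[OF v, of b] v \<open>\<not> 1 \<le> a\<close> by (cases "1 \<le> b") (auto simp: S_plus_def)
      qed
      moreover have "b \<le> int n"
      proof (rule ccontr)
        assume b: "\<not> b \<le> int n"
        then have vb: "?v b = b" using vfix by simp
        moreover have vab: "?v b < ?v a" "a < b" using ab by (auto simp: inversions_def)
        ultimately have "?v (?v a) = ?v a" using vfix[of "?v a"] b by simp
        then have "?v a = a" using S_Z_inj[OF Sv] by blast
        then show False using vab vb by simp
      qed
      ultimately show "(a, b) \<in> {1..int n} \<times> {1..int n}" using ab by (auto simp: inversions_def)
    qed
    \<comment> \<open>The crude bound n * n ensures that the truncated subtraction in the induction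
      measure strictly decreases.\<close>
    from card_mono[OF _ this] have "perm_length ?v \<le> n * n" by (simp add: perm_length_inversions)
    then have "n * n - perm_length ?v < d" using len less.prems(3) by simp
    from less.IH[OF this v vfix refl] obtain f where "is_double_schubert ?v f" by blast
    from is_double_schubert.descent[OF this i(1)] i(3) vv show ?thesis by auto
  qed
qed

text \<open>Independence of n and of the chosen descents comes for free: whatever chain is used, its
  result interpolates, and interpolation is unique.\<close>

lemma double_schubert_eqI:
  assumes f: "interpolates w f"
  shows "double_schubert w = f"
proof -
  have w: "w \<in> S_plus" using f by (simp add: interpolates_def)
  then have S: "w \<in> S_Z" by (simp add: S_plus_def)
  obtain N where "N \<ge> 0" and N: "\<And>i. \<bar>i\<bar> > N \<Longrightarrow> w i = i" "\<And>i. \<bar>i\<bar> \<le> N \<Longrightarrow> \<bar>w i\<bar> \<le> N"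
    using S_Z_bound[OF S, of 0] by blast
  have "w i = i" if "int (nat N) < i" for i using N(1)[of i] that by (simp split: if_splits)
  from is_double_schubert_exists_aux[OF w this refl] obtain g where g: "is_double_schubert w g" by blast
  have eq: "h = f" if "is_double_schubert w h" for h
    using interpolates_unique[OF is_double_schubert_interpolates[OF that] f] .
  show ?thesis
    unfolding double_schubert_def
    by (rule the_equality) (use g eq in auto)
qed

section \<open>Determinants of series coefficients\<close>

no_notation vec_index (infixl \<open>$\<close> 100)
unbundle fps_syntax

lemma one_plus_nth [simp]:
  "one_plus z $ 0 = 1" "one_plus z $ Suc 0 = z" "1 < m \<Longrightarrow> one_plus z $ m = 0"
  by (auto simp: one_plus_def)

lemma mult_one_plus_nth: "(a * one_plus z) $ Suc n = a $ Suc n + z * a $ n"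
proof -
  have "a * one_plus z = a + fps_const z * (a * fps_X)"
    by (simp add: one_plus_def algebra_simps)
  then show ?thesis by simp
qed

lemma prod_one_plus_nth_0 [simp]: "(\<Prod>i\<in>S. one_plus (f i)) $ 0 = 1"
  by (induction S rule: infinite_finite_induct) simp_all

lemma fps_mult_degree:
  fixes a b :: "epoly fps"
  assumes "\<And>m. m > k \<Longrightarrow> a $ m = 0" "\<And>m. m > l \<Longrightarrow> b $ m = 0" "m > k + l"
  shows "(a * b) $ m = 0"
  unfolding fps_mult_nth
proof (rule sum.neutral, rule ballI)
  fix i assume "i \<in> {0..m}"
  then have "k < i \<or> l < m - i" using assms(3) by auto
  then show "a $ i * b $ (m - i) = 0" using assms(1,2) by auto
qed

lemma prod_one_plus_degree:
  assumes "finite S" "m > card S"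
  shows "(\<Prod>i\<in>S. one_plus (f i)) $ m = 0"
  using assms
proof (induction S arbitrary: m rule: finite_induct)
  case (insert i S)
  have deg: "one_plus (f i) $ k = 0" if "k > 1" for k using that by simp
  have "(one_plus (f i) * (\<Prod>i\<in>S. one_plus (f i))) $ m = 0"
    by (rule fps_mult_degree[of 1 _ "card S"]) (use insert deg in simp_all)
  then show ?case using insert by simp
qed simp

text \<open>Identities between quotients of series are proved by multiplying with a denominator and
  cancelling it here.\<close>

lemma fps_cancel_unit:
  fixes a b c :: "epoly fps"
  assumes "b $ 0 = 1" "a * b = c * b"
  shows "a = c"
proof -
  have inv: "b * fps_right_inverse b 1 = 1" by (rule fps_right_inverse) (use assms(1) in simp)
  have "a * (b * fps_right_inverse b 1) = c * (b * fps_right_inverse b 1)"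
    using assms(2) by (metis mult.assoc)
  then show ?thesis unfolding inv by simp
qed

lemma series_quot_mult:
  assumes "b $ 0 = 1"
  shows "series_quot a b * b = a"
proof -
  have inv: "b * fps_right_inverse b 1 = 1" by (rule fps_right_inverse) (use assms in simp)
  have "series_quot a b * b = a * (b * fps_right_inverse b 1)"
    by (simp add: series_quot_def ac_simps)
  then show ?thesis unfolding inv by simp
qed

text \<open>As coefficients at negative indices are 0, the summation range can be independent of
  \<open>e\<close>; this makes the coefficient a fixed linear combination of matrix entries.\<close>

lemma series_coeff_mult:
  assumes "\<And>j. j \<ge> n \<Longrightarrow> g $ j = 0"
  shows "series_coeff (a * g) e = (\<Sum>j<n. g $ j * series_coeff a (e - int j))"
proof (cases "e < 0")
  case True
  then show ?thesis by (simp add: series_coeff_def)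
next
  case False
  then obtain N where N: "e = int N" using zero_le_imp_eq_int by force
  have "series_coeff (a * g) e = (\<Sum>j=0..N. g $ j * a $ (N - j))"
    unfolding N by (simp add: series_coeff_def mult.commute[of a] fps_mult_nth)
  also have "\<dots> = (\<Sum>j=0..N. g $ j * series_coeff a (e - int j))"
    by (rule sum.cong) (auto simp: N series_coeff_def nat_diff_distrib)
  also have "\<dots> = (\<Sum>j\<in>{0..N} \<union> {..<n}. g $ j * series_coeff a (e - int j))"
    by (rule sum.mono_neutral_left) (auto simp: N series_coeff_def)
  also have "\<dots> = (\<Sum>j<n. g $ j * series_coeff a (e - int j))"
    by (rule sum.mono_neutral_right) (auto simp: assms)
  finally show ?thesis .
qed

lemma series_coeff_degree:
  assumes "\<And>m. m > k \<Longrightarrow> a $ m = 0" "e > int k"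
  shows "series_coeff a e = 0"
  using assms(1)[of "nat e"] assms(2) by (simp add: series_coeff_def)

text \<open>The value at \<open>z = \<alpha>\<close> of the polynomial with roots \<open>\<beta>\<close>, read off as a coefficient.\<close>

lemma resultant_coeff:
  assumes "finite B" "S * one_plus (- \<alpha>) = (\<Prod>b\<in>B. one_plus (- \<beta> b))"
  shows "S $ card B = (\<Prod>b\<in>B. \<alpha> - \<beta> b)"
  using assms
proof (induction B arbitrary: S rule: finite_induct)
  case empty
  then have "(S * one_plus (- \<alpha>)) $ 0 = 1 $ 0" by simp
  then show ?case by simp
next
  case (insert b B)
  let ?T = "series_quot (\<Prod>b\<in>B. one_plus (- \<beta> b)) (one_plus (- \<alpha>))"
  have T: "?T * one_plus (- \<alpha>) = (\<Prod>b\<in>B. one_plus (- \<beta> b))" by (rule series_quot_mult) simp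
  have "S * one_plus (- \<alpha>) = (?T * one_plus (- \<beta> b)) * one_plus (- \<alpha>)"
    using insert T by (simp add: ac_simps)
  then have S: "S = ?T * one_plus (- \<beta> b)" by (rule fps_cancel_unit[rotated]) simp
  \<comment> \<open>Above the degree of the product the coefficients of \<open>?T\<close> obey a
    geometric recursion with ratio \<alpha>, so the new factor contributes the difference \<alpha> -
    \<beta> b.\<close>
  have "(?T * one_plus (- \<alpha>)) $ Suc (card B) = 0"
    unfolding T by (rule prod_one_plus_degree) (use insert in auto)
  then have "?T $ Suc (card B) = \<alpha> * ?T $ card B" by (simp add: mult_one_plus_nth)
  then have "S $ Suc (card B) = (\<alpha> - \<beta> b) * ?T $ card B"
    unfolding S mult_one_plus_nth by (simp add: left_diff_distrib)
  then show ?case using insert.hyps insert.IH[OF T] by simp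
qed

text \<open>The series may depend on the column, so that column operations preserve this
  form.\<close>

definition series_mat :: "nat \<Rightarrow> (nat \<Rightarrow> nat \<Rightarrow> epoly fps) \<Rightarrow> (nat \<Rightarrow> int) \<Rightarrow> epoly mat" where
  "series_mat n a e = mat n n (\<lambda>(i, j). series_coeff (a i j) (e i + int j))"

lemma det_unitriangular:
  assumes "\<And>j. j < n \<Longrightarrow> g j j = (1::epoly)"
  shows "det (mat n n (\<lambda>(i, j). if i \<le> j then g i j else 0)) = 1"
proof -
  let ?G = "mat n n (\<lambda>(i, j). if i \<le> j then g i j else 0)"
  have "det ?G = prod_list (diag_mat ?G)"
    by (rule det_upper_triangular[of _ n]) (auto simp: upper_triangular_def)
  also have "\<dots> = 1" using assms by (simp add: prod_list_diag_prod)
  finally show ?thesis .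
qed

text \<open>Moving l columns to the left lowers the index by l, so multiplying by \<open>g m\<close>
  combines column m with at most m preceding ones. The transition matrix is upper
  unitriangular.\<close>

lemma det_series_column_op:
  assumes "\<And>m. m < n \<Longrightarrow> g m $ 0 = 1" "\<And>m j. m < n \<Longrightarrow> m < j \<Longrightarrow> g m $ j = 0"
  shows "det (series_mat n (\<lambda>i j. R i) e) = det (series_mat n (\<lambda>i j. R i * g j) e)"
proof -
  let ?M = "series_mat n (\<lambda>i j. R i) e"
  let ?G = "mat n n (\<lambda>(l, m). if l \<le> m then g m $ (m - l) else 0)"
  have "?M * ?G = series_mat n (\<lambda>i j. R i * g j) e"
  proof (rule eq_matI)
    fix i m assume "i < dim_row (series_mat n (\<lambda>i j. R i * g j) e)" "m < dim_col (series_mat n (\<lambda>i j. R i * g j) e)"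
    then have im: "i < n" "m < n" by (simp_all add: series_mat_def)
    have "(?M * ?G) $$ (i, m)
        = (\<Sum>l=0..<n. series_coeff (R i) (e i + int l) * (if l \<le> m then g m $ (m - l) else 0))"
      using im by (simp add: series_mat_def scalar_prod_def)
    also have "\<dots> = (\<Sum>l\<in>{..m}. series_coeff (R i) (e i + int l) * g m $ (m - l))"
      by (rule sum.mono_neutral_cong_right) (use im in auto)
    also have "\<dots> = (\<Sum>j<Suc m. g m $ j * series_coeff (R i) (e i + int m - int j))"
      by (rule sum.reindex_bij_witness[of _ "\<lambda>j. m - j" "\<lambda>l. m - l"])
        (auto simp: mult.commute of_nat_diff)
    also have "\<dots> = series_coeff (R i * g m) (e i + int m)"
      by (rule series_coeff_mult[symmetric]) (use assms(2) im in auto)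
    finally show "(?M * ?G) $$ (i, m) = series_mat n (\<lambda>i j. R i * g j) e $$ (i, m)"
      using im by (simp add: series_mat_def)
  qed (simp_all add: series_mat_def)
  moreover have "det (?M * ?G) = det ?M * det ?G"
    by (rule det_mult[of _ n]) (simp_all add: series_mat_def)
  moreover have "det ?G = 1" by (rule det_unitriangular) (use assms(1) in simp)
  ultimately show ?thesis by simp
qed

text \<open>Within a block of rows with a common series, going d rows down lowers the index by d.
  The number \<open>b i\<close> of rows available from row i on limits the degree of
  \<open>h i\<close>.\<close>

lemma det_series_row_op:
  assumes "\<And>i. i < n \<Longrightarrow> h i $ 0 = 1" "\<And>i. i < n \<Longrightarrow> i + b i \<le> n"
    and "\<And>i d. i < n \<Longrightarrow> b i \<le> d \<Longrightarrow> h i $ d = 0"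
    and "\<And>i d. i < n \<Longrightarrow> d < b i \<Longrightarrow> R (i + d) = R i \<and> e (i + d) = e i - int d"
  shows "det (series_mat n (\<lambda>i j. R i) e) = det (series_mat n (\<lambda>i j. R i * h i) e)"
proof -
  let ?M = "series_mat n (\<lambda>i j. R i) e"
  let ?H = "mat n n (\<lambda>(i, k). if i \<le> k then h i $ (k - i) else 0)"
  have "?H * ?M = series_mat n (\<lambda>i j. R i * h i) e"
  proof (rule eq_matI)
    fix i m assume "i < dim_row (series_mat n (\<lambda>i j. R i * h i) e)" "m < dim_col (series_mat n (\<lambda>i j. R i * h i) e)"
    then have im: "i < n" "m < n" by (simp_all add: series_mat_def)
    have "(?H * ?M) $$ (i, m)
        = (\<Sum>k=0..<n. (if i \<le> k then h i $ (k - i) else 0) * series_coeff (R k) (e k + int m))"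
      using im by (simp add: series_mat_def scalar_prod_def)
    also have "\<dots> = (\<Sum>k\<in>{i..<i + b i}. h i $ (k - i) * series_coeff (R k) (e k + int m))"
      by (rule sum.mono_neutral_cong_right) (use im assms(2)[of i] assms(3)[of i] in auto)
    also have "\<dots> = (\<Sum>d<b i. h i $ d * series_coeff (R i) (e i + int m - int d))"
    proof (rule sum.reindex_bij_witness[of _ "\<lambda>d. i + d" "\<lambda>k. k - i"])
      fix k assume "k \<in> {i..<i + b i}"
      then have k: "k \<in> {i..<i + b i}" .
      show "h i $ (k - i) * series_coeff (R i) (e i + int m - int (k - i))
          = h i $ (k - i) * series_coeff (R k) (e k + int m)"
      proof -
        have "k - i < b i" "i + (k - i) = k" using k by auto
        then have R: "R k = R i" and e: "e k = e i - int (k - i)" using assms(4)[of i "k - i"] im by simp_all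
        have "e i + int m - int (k - i) = e k + int m" unfolding e by linarith
        then show ?thesis unfolding R by (rule arg_cong)
      qed
    qed auto
    also have "\<dots> = series_coeff (R i * h i) (e i + int m)"
      by (rule series_coeff_mult[symmetric]) (use assms(3) im in auto)
    finally show "(?H * ?M) $$ (i, m) = series_mat n (\<lambda>i j. R i * h i) e $$ (i, m)"
      using im by (simp add: series_mat_def)
  qed (simp_all add: series_mat_def)
  moreover have "det (?H * ?M) = det ?H * det ?M"
    by (rule det_mult[of _ n]) (simp_all add: series_mat_def)
  moreover have "det ?H = 1" by (rule det_unitriangular) (use assms(1) in simp)
  ultimately show ?thesis by simp
qed

text \<open>Column \<open>m\<close> is combined according to \<open>\<Prod>\<^sub>k\<^sub><\<^sub>m (z - \<alpha>\<^sub>k)\<close>, and row \<open>i\<close> according to the factors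
  \<open>\<alpha>\<^sub>k\<close> with \<open>i < k < K i\<close>; the result is lower triangular.\<close>

lemma det_series_factors:
  fixes \<alpha> :: "nat \<Rightarrow> epoly" and \<beta> :: "'b \<Rightarrow> epoly"
  assumes K: "\<And>i. i < n \<Longrightarrow> i < K i \<and> K i \<le> n"
    and block: "\<And>i i'. i < n \<Longrightarrow> i \<le> i' \<Longrightarrow> i' < K i \<Longrightarrow> R i' = R i \<and> card (B i') = card (B i)"
    and R: "\<And>i. i < n \<Longrightarrow> R i * (\<Prod>k<K i. one_plus (- \<alpha> k)) = (\<Prod>b\<in>B i. one_plus (- \<beta> b))"
    and B: "\<And>i. i < n \<Longrightarrow> finite (B i)"
  shows "det (series_mat n (\<lambda>i j. R i) (\<lambda>i. int (card (B i)) - int i)) = (\<Prod>i<n. \<Prod>b\<in>B i. \<alpha> i - \<beta> b)"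
proof -
  define h where "h i = (\<Prod>k\<in>{i<..<K i}. one_plus (- \<alpha> k))" for i
  define g where "g m = (\<Prod>k<m. one_plus (- \<alpha> k))" for m
  let ?e = "\<lambda>i. int (card (B i)) - int i"
  have "det (series_mat n (\<lambda>i j. R i) ?e) = det (series_mat n (\<lambda>i j. R i * h i) ?e)"
  proof (rule det_series_row_op[where b = "\<lambda>i. K i - i"])
    show "h i $ d = 0" if "i < n" "K i - i \<le> d" for i d
      unfolding h_def by (rule prod_one_plus_degree) (use that K[of i] in auto)
    show "R (i + d) = R i \<and> int (card (B (i + d))) - int (i + d) = ?e i - int d"
      if "i < n" "d < K i - i" for i d
      using block[of i "i + d"] that by simp
    show "i + (K i - i) \<le> n" if "i < n" for i using K[OF that] by simp
  qed (simp add: h_def)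
  also have "\<dots> = det (series_mat n (\<lambda>i j. R i * h i * g j) ?e)"
  proof (rule det_series_column_op)
    show "g m $ j = 0" if "m < j" for m j
      unfolding g_def by (rule prod_one_plus_degree) (use that in auto)
  qed (simp add: g_def)
  also have "\<dots> = prod_list (diag_mat (series_mat n (\<lambda>i j. R i * h i * g j) ?e))"
  proof (rule det_lower_triangular[of n])
    fix i m assume im: "i < m" "m < n"
    have "{..<m} = {..i} \<union> {i<..<m}" using im by auto
    then have gm: "g m = (\<Prod>k\<le>i. one_plus (- \<alpha> k)) * (\<Prod>k\<in>{i<..<m}. one_plus (- \<alpha> k))"
      unfolding g_def by (simp add: prod.union_disjoint[symmetric] ivl_disj_int)
    have "{..<K i} = {..i} \<union> {i<..<K i}" using K[of i] im by auto
    then have hi: "(\<Prod>k<K i. one_plus (- \<alpha> k)) = (\<Prod>k\<le>i. one_plus (- \<alpha> k)) * h i"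
      unfolding h_def by (simp add: prod.union_disjoint[symmetric] ivl_disj_int)
    have "R i * h i * g m = (R i * (\<Prod>k<K i. one_plus (- \<alpha> k))) * (\<Prod>k\<in>{i<..<m}. one_plus (- \<alpha> k))"
      unfolding gm hi by (simp add: ac_simps)
    also have "\<dots> = (\<Prod>b\<in>B i. one_plus (- \<beta> b)) * (\<Prod>k\<in>{i<..<m}. one_plus (- \<alpha> k))"
      using R[of i] im by simp
    finally have eq: "R i * h i * g m = \<dots>" .
    \<comment> \<open>Above the diagonal all denominators have cancelled. The degree is at most card
      (B i) + (m - i - 1), one less than the index extracted.\<close>
    have "series_coeff (R i * h i * g m) (?e i + int m) = 0"
      unfolding eq
    proof (rule series_coeff_degree)
      show "((\<Prod>b\<in>B i. one_plus (- \<beta> b)) * (\<Prod>k\<in>{i<..<m}. one_plus (- \<alpha> k))) $ d = 0"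
        if "card (B i) + card {i<..<m} < d" for d
        by (rule fps_mult_degree[OF _ _ that]; rule prod_one_plus_degree) (use B[of i] im in auto)
      show "int (card (B i) + card {i<..<m}) < ?e i + int m" using im by simp
    qed
    then show "series_mat n (\<lambda>i j. R i * h i * g j) ?e $$ (i, m) = 0"
      using im by (simp add: series_mat_def)
  qed (simp add: series_mat_def)
  also have "\<dots> = (\<Prod>i=0..<n. series_coeff (R i * h i * g i) (?e i + int i))"
    by (simp add: prod_list_diag_prod series_mat_def)
  also have "\<dots> = (\<Prod>i<n. \<Prod>b\<in>B i. \<alpha> i - \<beta> b)"
  proof (rule prod.cong)
    fix i assume "i \<in> {..<n}"
    then have i: "i < n" by simp
    \<comment> \<open>On the diagonal exactly the factor of \<alpha> i is missing, the situation of
      \<open>resultant_coeff\<close>.\<close>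
    have "{..<K i} = insert i ({..<i} \<union> {i<..<K i})" using K[of i] i by auto
    then have "(\<Prod>k<K i. one_plus (- \<alpha> k)) = one_plus (- \<alpha> i) * (\<Prod>k\<in>{..<i} \<union> {i<..<K i}. one_plus (- \<alpha> k))"
      by simp
    also have "(\<Prod>k\<in>{..<i} \<union> {i<..<K i}. one_plus (- \<alpha> k)) = g i * h i"
      unfolding g_def h_def by (rule prod.union_disjoint) auto
    finally have "(R i * h i * g i) * one_plus (- \<alpha> i) = (\<Prod>b\<in>B i. one_plus (- \<beta> b))"
      using R[OF i] by (simp add: ac_simps)
    from resultant_coeff[OF B[OF i] this]
    show "series_coeff (R i * h i * g i) (?e i + int i) = (\<Prod>b\<in>B i. \<alpha> i - \<beta> b)"
      by (simp add: series_coeff_def)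
  qed auto
  finally show ?thesis .
qed

text \<open>After the column operation the first \<open>k\<close> rows vanish outside \<open>r < k\<close> columns.\<close>

lemma det_series_zero:
  assumes rk: "r < k" "k \<le> n" and d: "d $ 0 = 1" "\<And>j. r < j \<Longrightarrow> d $ j = 0"
    and zero: "\<And>i m. i < k \<Longrightarrow> r \<le> m \<Longrightarrow> series_coeff (R i * d) (e i + int m) = 0"
  shows "det (series_mat n (\<lambda>i j. R i) e) = 0"
proof -
  define g where "g m = (if r \<le> m then d else 1)" for m :: nat
  let ?A = "series_mat n (\<lambda>i j. R i * g j) e"
  have "det (series_mat n (\<lambda>i j. R i) e) = det ?A"
  proof (rule det_series_column_op)
    show "g m $ j = 0" if "m < j" for m j using d(2)[of j] that by (simp add: g_def)
  qed (simp add: g_def d)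
  also have "\<dots> = 0"
  proof -
    have dim: "dim_row ?A = n" "dim_col ?A = n" by (simp_all add: series_mat_def)
    have "(\<Prod>i=0..<n. ?A $$ (i, p i)) = 0" if p: "p permutes {0..<n}" for p
    proof -
      \<comment> \<open>Pigeonhole: each term of the Leibniz expansion has one of the first k rows
        in a column from r on.\<close>
      have "\<not> p ` {0..<k} \<subseteq> {0..<r}"
      proof
        assume "p ` {0..<k} \<subseteq> {0..<r}"
        then have "card (p ` {0..<k}) \<le> card {0..<r}" by (intro card_mono) auto
        moreover have "card (p ` {0..<k}) = card {0..<k}"
          by (rule card_image[OF inj_on_subset[OF permutes_inj[OF p] subset_UNIV]])
        ultimately show False using rk by simp
      qed
      then obtain i where i: "i < k" "r \<le> p i" by force
      have pi: "p i < n" using permutes_in_image[OF p, of i] i rk by simp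
      have "?A $$ (i, p i) = 0"
        using zero[OF i] i pi rk by (simp add: series_mat_def g_def)
      then show ?thesis using i rk by (intro prod_zero) auto
    qed
    then show ?thesis unfolding det_def dim by (simp add: sum.neutral)
  qed
  finally show ?thesis .
qed

lemma multi_schur_series_mat:
  "multi_schur n lam a = det (series_mat n (\<lambda>i j. a (Suc i)) (\<lambda>i. lam (Suc i) - int i))"
  unfolding multi_schur_def series_mat_def by (simp add: Let_def algebra_simps)

lemma multi_schur_cong:
  assumes "\<And>k. k \<in> {1..n} \<Longrightarrow> lam k = lam' k \<and> a k = a' k"
  shows "multi_schur n lam a = multi_schur n lam' a'"
  unfolding multi_schur_def
  by (intro arg_cong[of _ _ det] cong_mat) (use assms in \<open>auto simp: Let_def\<close>)

section \<open>Specialisation and degree of the determinant\<close>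

definition hom_fps :: "(var \<Rightarrow> 'a) \<Rightarrow> epoly fps \<Rightarrow> 'a::comm_ring_1 fps" where
  "hom_fps \<rho> a = Abs_fps (\<lambda>n. eval_epoly \<rho> (a $ n))"

lemma hom_fps_nth [simp]: "hom_fps \<rho> a $ n = eval_epoly \<rho> (a $ n)"
  by (simp add: hom_fps_def)

lemma hom_fps_mult: "hom_fps \<rho> (a * b) = hom_fps \<rho> a * hom_fps \<rho> b"
  by (rule fps_ext) (simp add: fps_mult_nth eval_sum eval_mult)

lemma hom_fps_one_plus_linear: "hom_fps \<rho> (one_plus z) = 1 + fps_const (eval_epoly \<rho> z) * fps_X"
  by (rule fps_ext) (simp add: one_plus_def eval_add eval_mult fps_X_def)

lemma hom_fps_one_plus: "hom_fps \<rho> (one_plus z) = one_plus (eval_epoly \<rho> z)"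
  unfolding hom_fps_one_plus_linear by (simp add: one_plus_def)

lemma hom_fps_1 [simp]: "hom_fps \<rho> 1 = 1"
  by (rule fps_ext) simp

lemma hom_fps_prod: "hom_fps \<rho> (prod f S) = (\<Prod>i\<in>S. hom_fps \<rho> (f i))"
  by (induction S rule: infinite_finite_induct) (simp_all add: hom_fps_mult)

lemma eval_multi_schur: "eval_epoly \<rho> (multi_schur n lam a) = multi_schur n lam (\<lambda>k. hom_fps \<rho> (a k))"
proof -
  interpret comm_ring_hom "eval_epoly \<rho>" by (rule comm_ring_hom_eval)
  have "map_mat (eval_epoly \<rho>) (mat n n (\<lambda>(i, j). let k = i + 1; l = j + 1 in series_coeff (a k) (lam k + int l - int k)))
      = mat n n (\<lambda>(i, j). let k = i + 1; l = j + 1 in series_coeff (hom_fps \<rho> (a k)) (lam k + int l - int k))"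
    by (rule eq_matI) (simp_all add: Let_def series_coeff_def)
  then show ?thesis unfolding multi_schur_def hom_det[symmetric] by simp
qed

definition graded :: "epoly fps \<Rightarrow> bool" where
  "graded a \<longleftrightarrow> (\<forall>n. xfil n (a $ n))"

lemma graded_mult: "graded a \<Longrightarrow> graded b \<Longrightarrow> graded (a * b)"
  unfolding graded_def fps_mult_nth
proof (intro allI xfil_sum)
  fix n i :: nat assume "\<forall>n. xfil n (a $ n)" "\<forall>n. xfil n (b $ n)" "i \<in> {0..n}"
  then show "xfil n (a $ i * b $ (n - i))" using xfil_mult[of i "a $ i" "n - i" "b $ (n - i)"] by simp
qed

lemma graded_one_plus:
  assumes "xfil (Suc 0) z"
  shows "graded (one_plus z)"
  unfolding graded_def
proof
  fix n
  consider "n = 0" | "n = Suc 0" | "1 < n" by linarith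
  then show "xfil n (one_plus z $ n)" by cases (simp_all add: assms xfil.zero xfil.one)
qed

lemma graded_1: "graded 1"
  by (simp add: graded_def xfil.zero xfil.one)

lemma graded_prod: "(\<And>i. i \<in> S \<Longrightarrow> graded (f i)) \<Longrightarrow> graded (prod f S)"
  by (induction S rule: infinite_finite_induct) (simp_all add: graded_1 graded_mult)

lemma graded_quot:
  assumes "a * b = c" "b $ 0 = 1" "graded b" "graded c"
  shows "graded a"
proof -
  have "xfil n (a $ n)" for n
  proof (induction n rule: less_induct)
    case (less n)
    have "c $ n = (\<Sum>i=0..n. a $ i * b $ (n - i))" unfolding assms(1)[symmetric] by (rule fps_mult_nth)
    also have "{0..n} = insert n {0..<n}" by auto
    finally have "a $ n = c $ n - (\<Sum>i=0..<n. a $ i * b $ (n - i))" using assms(2) by simp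
    moreover have "xfil n (\<Sum>i=0..<n. a $ i * b $ (n - i))"
    proof (rule xfil_sum)
      fix i assume "i \<in> {0..<n}"
      then show "xfil n (a $ i * b $ (n - i))"
        using xfil_mult[of i "a $ i" "n - i" "b $ (n - i)"] less assms(3) by (simp add: graded_def)
    qed
    ultimately show ?case using assms(4) by (simp add: graded_def xfil.diff)
  qed
  then show ?thesis by (simp add: graded_def)
qed

text \<open>The column and row shifts cancel in each Leibniz term, leaving the sum of the parts.
  Terms with a negative index are zero and are split off first, since \<open>nat\<close> would
  truncate there.\<close>

lemma xfil_multi_schur:
  assumes "\<And>k. k \<in> {1..n} \<Longrightarrow> graded (a k)" "(\<Sum>k=1..n. lam k) = int d"
  shows "xfil d (multi_schur n lam a)"
proof -
  let ?e = "\<lambda>i. lam (Suc i) - int i"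
  let ?A = "series_mat n (\<lambda>i j. a (Suc i)) ?e"
  have dim: "dim_row ?A = n" "dim_col ?A = n" by (simp_all add: series_mat_def)
  have summand: "xfil d (\<Prod>i=0..<n. ?A $$ (i, p i))" if p: "p permutes {0..<n}" for p
  proof (cases "\<exists>i<n. ?e i + int (p i) < 0")
    case True
    then obtain i where i: "i < n" "?e i + int (p i) < 0" by blast
    then have "?A $$ (i, p i) = 0"
      using permutes_in_image[OF p, of i] by (simp add: series_mat_def series_coeff_def)
    then have "(\<Prod>i=0..<n. ?A $$ (i, p i)) = 0" using i(1) by (intro prod_zero) auto
    then show ?thesis by (simp only: xfil.zero)
  next
    case False
    have "xfil (\<Sum>i=0..<n. nat (?e i + int (p i))) (\<Prod>i=0..<n. ?A $$ (i, p i))"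
    proof (rule xfil_prod)
      fix i assume i: "i \<in> {0..<n}"
      then have "?A $$ (i, p i) = a (Suc i) $ nat (?e i + int (p i))"
        using permutes_in_image[OF p, of i] False by (auto simp: series_mat_def series_coeff_def)
      then show "xfil (nat (?e i + int (p i))) (?A $$ (i, p i))"
        using assms(1)[of "Suc i"] i by (simp add: graded_def)
    qed
    moreover have "int (\<Sum>i=0..<n. nat (?e i + int (p i))) = int d"
    proof -
      have "int (\<Sum>i=0..<n. nat (?e i + int (p i))) = (\<Sum>i=0..<n. ?e i + int (p i))"
        unfolding of_nat_sum using False by (intro sum.cong) auto
      also have "\<dots> = (\<Sum>i=0..<n. lam (Suc i)) - (\<Sum>i=0..<n. int i) + (\<Sum>i=0..<n. int (p i))"
        by (simp add: sum.distrib sum_subtractf)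
      also have "(\<Sum>i=0..<n. int (p i)) = (\<Sum>i=0..<n. int i)"
        using sum.permute[OF p, of int] by (simp add: comp_def)
      also have "(\<Sum>i=0..<n. lam (Suc i)) = (\<Sum>k=1..n. lam k)"
        by (simp add: sum.atLeast_Suc_atMost_Suc_shift sum.shift_bounds_Suc_ivl[symmetric] atLeastLessThanSuc_atLeastAtMost)
      finally show ?thesis using assms(2) by simp
    qed
    ultimately show ?thesis by (simp only: of_nat_eq_iff)
  qed
  have "xfil d (signof p * (\<Prod>i=0..<n. ?A $$ (i, p i)))" if "p permutes {0..<n}" for p
    using summand[OF that] by (simp add: sign_def xfil_uminus)
  then have "xfil d (det ?A)" unfolding det_def dim by (auto intro!: xfil_sum)
  then show ?thesis by (simp add: multi_schur_series_mat)
qed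

section \<open>The determinant at the fixed points\<close>

text \<open>The shifted c a(p, q) with c = 1 and with y negated, the sign convention of the
  classical polynomials.\<close>

definition flag_series :: "int \<Rightarrow> int \<Rightarrow> epoly fps" where
  "flag_series p q = series_quot (\<Prod>j\<in>{1..q}. one_plus (- y_poly j)) (\<Prod>i\<in>{1..p}. one_plus (- x_poly i))"

definition flag_schur :: "triple \<Rightarrow> epoly" where
  "flag_schur \<tau> = multi_schur (triple_ks \<tau>) (triple_part \<tau>)
     (\<lambda>k. flag_series (tp \<tau> (triple_index \<tau> k)) (tq \<tau> (triple_index \<tau> k)))"

lemma graded_flag_series: "graded (flag_series p q)"
  unfolding flag_series_def
proof (rule graded_quot[OF series_quot_mult])
  show "graded (\<Prod>i\<in>{1..p}. one_plus (- x_poly i))"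
    by (rule graded_prod) (intro graded_one_plus xfil_uminus xfil_x)
  show "graded (\<Prod>j\<in>{1..q}. one_plus (- y_poly j))"
    by (rule graded_prod) (intro graded_one_plus xfil_uminus xfil_y)
qed simp_all

definition loc_series :: "(int \<Rightarrow> int) \<Rightarrow> int \<Rightarrow> int \<Rightarrow> epoly fps" where
  "loc_series v p q = series_quot (\<Prod>j\<in>{1..q}. one_plus (- y_poly j)) (\<Prod>i\<in>{1..p}. one_plus (- y_poly (v i)))"

lemma loc_series_mult:
  "loc_series v p q * (\<Prod>i\<in>{1..p}. one_plus (- y_poly (v i))) = (\<Prod>j\<in>{1..q}. one_plus (- y_poly j))"
  unfolding loc_series_def by (rule series_quot_mult) simp

lemma loc_flag_schur:
  "loc v (flag_schur \<tau>) = multi_schur (triple_ks \<tau>) (triple_part \<tau>)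
     (\<lambda>k. loc_series v (tp \<tau> (triple_index \<tau> k)) (tq \<tau> (triple_index \<tau> k)))"
proof -
  let ?\<rho> = "\<lambda>u. case u of
     CVar k \<Rightarrow> var_poly (CVar k)
   | XVar j \<Rightarrow> if 1 \<le> j then y_poly (v j) else x_poly j
   | YVar j \<Rightarrow> y_poly j"
  have ev: "eval_epoly ?\<rho> = loc v" by (simp add: loc_def)
  have "hom_fps ?\<rho> (flag_series p q) = loc_series v p q" for p q
  proof (rule fps_cancel_unit)
    let ?X = "\<Prod>i\<in>{1..p}. one_plus (- y_poly (v i))"
    have "hom_fps ?\<rho> (\<Prod>i\<in>{1..p}. one_plus (- x_poly i)) = ?X"
      unfolding hom_fps_prod hom_fps_one_plus ev by (rule prod.cong) simp_all
    then have "hom_fps ?\<rho> (flag_series p q) * ?X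
        = hom_fps ?\<rho> (flag_series p q * (\<Prod>i\<in>{1..p}. one_plus (- x_poly i)))"
      by (simp add: hom_fps_mult)
    also have "\<dots> = hom_fps ?\<rho> (\<Prod>j\<in>{1..q}. one_plus (- y_poly j))"
      unfolding flag_series_def by (subst series_quot_mult) simp_all
    also have "\<dots> = (\<Prod>j\<in>{1..q}. one_plus (- y_poly j))"
      unfolding hom_fps_prod hom_fps_one_plus ev by simp
    also have "\<dots> = loc_series v p q * ?X" by (rule loc_series_mult[symmetric])
    finally show "hom_fps ?\<rho> (flag_series p q) * ?X = loc_series v p q * ?X" .
  qed simp
  then show ?thesis unfolding flag_schur_def ev[symmetric] eval_multi_schur by simp
qed

text \<open>The positions whose factors cancel between numerator and denominator of
  \<open>loc_series v p q\<close>.\<close>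

definition kept :: "(int \<Rightarrow> int) \<Rightarrow> int \<Rightarrow> int \<Rightarrow> int set" where
  "kept v p q = {a. 1 \<le> a \<and> a \<le> p \<and> v a \<le> q}"

lemma S_plus_nonpos: "v \<in> S_plus \<Longrightarrow> a \<le> 0 \<Longrightarrow> v a = a"
  by (simp add: S_plus_def)

lemma S_plus_inj: "v \<in> S_plus \<Longrightarrow> inj v"
  by (simp add: S_plus_def S_Z_def bij_def)

lemma split_positions:
  assumes v: "v \<in> S_plus" and q: "0 \<le> q"
  shows "{1..p} = high v p q \<union> kept v p q" "high v p q \<inter> kept v p q = {}"
    "finite (kept v p q)" "finite (high v p q)"
proof -
  have "1 \<le> a" if "a \<in> high v p q" for a
    using S_plus_nonpos[OF v, of a] that q by (cases "1 \<le> a") (auto simp: high_def)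
  then show "{1..p} = high v p q \<union> kept v p q" by (auto simp: high_def kept_def)
  show "high v p q \<inter> kept v p q = {}" by (auto simp: high_def kept_def)
  show "finite (kept v p q)" by (rule finite_subset[of _ "{1..p}"]) (auto simp: kept_def)
  show "finite (high v p q)" using v by (intro finite_high) (simp add: S_plus_def)
qed

lemma split_values:
  assumes v: "v \<in> S_plus" and p: "0 \<le> p"
  shows "{1..q} = v ` low v p q \<union> v ` kept v p q" "v ` low v p q \<inter> v ` kept v p q = {}"
    "finite (low v p q)"
proof -
  have S: "v \<in> S_Z" using v by (simp add: S_plus_def)
  show "{1..q} = v ` low v p q \<union> v ` kept v p q"
  proof (intro equalityI subsetI)
    fix b assume b: "b \<in> {1..q}"
    obtain a where a: "v a = b" using S_Z_surj[OF S] by (rule exE)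
    have "1 \<le> a" using S_plus_nonpos[OF v, of a] a b by (cases "1 \<le> a") auto
    then have "a \<in> low v p q \<union> kept v p q" using a b by (auto simp: low_def kept_def)
    then show "b \<in> v ` low v p q \<union> v ` kept v p q" using a by blast
  next
    fix b assume "b \<in> v ` low v p q \<union> v ` kept v p q"
    then obtain a where a: "b = v a" "a \<in> low v p q \<union> kept v p q" by blast
    then have "1 \<le> a" "v a \<le> q" using p by (auto simp: low_def kept_def)
    then show "b \<in> {1..q}" using S_plus_pos[OF v, of a] a(1) by simp
  qed
  have "low v p q \<inter> kept v p q = {}" by (auto simp: low_def kept_def)
  then show "v ` low v p q \<inter> v ` kept v p q = {}"
    using image_Int[OF S_plus_inj[OF v], of "low v p q" "kept v p q"] by simp
  show "finite (low v p q)" by (rule finite_low[OF S])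
qed

lemma loc_series_reduced:
  assumes v: "v \<in> S_plus" and pq: "0 \<le> p" "0 \<le> q"
  shows "loc_series v p q * (\<Prod>a\<in>high v p q. one_plus (- y_poly (v a)))
       = (\<Prod>b\<in>low v p q. one_plus (- y_poly (v b)))"
proof (rule fps_cancel_unit)
  let ?C = "\<Prod>a\<in>kept v p q. one_plus (- y_poly (v a))"
  note P = split_positions[OF v pq(2), of p] and Q = split_values[OF v pq(1), of q]
  have "loc_series v p q * (\<Prod>a\<in>high v p q. one_plus (- y_poly (v a))) * ?C
      = loc_series v p q * (\<Prod>i\<in>{1..p}. one_plus (- y_poly (v i)))"
    unfolding P(1) prod.union_disjoint[OF P(4,3,2)] by (simp add: mult.assoc)
  also have "\<dots> = (\<Prod>j\<in>{1..q}. one_plus (- y_poly j))" by (rule loc_series_mult)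
  also have "\<dots> = (\<Prod>j\<in>v ` low v p q. one_plus (- y_poly j)) * (\<Prod>j\<in>v ` kept v p q. one_plus (- y_poly j))"
    unfolding Q(1) by (rule prod.union_disjoint) (use P Q in auto)
  also have "\<dots> = (\<Prod>b\<in>low v p q. one_plus (- y_poly (v b))) * ?C"
    by (simp add: prod.reindex inj_on_subset[OF S_plus_inj[OF v]])
  finally show "loc_series v p q * (\<Prod>a\<in>high v p q. one_plus (- y_poly (v a))) * ?C
      = (\<Prod>b\<in>low v p q. one_plus (- y_poly (v b))) * ?C" .
qed simp

text \<open>The high positions at a later corner (p', q') together with the kept ones exhaust 1..p',
  so this multiplier clears the denominator of the earlier corner too. What remains has q - card
  kept + p' - p factors, where p' = card high + card kept.\<close>

lemma loc_series_degree:
  assumes v: "v \<in> S_plus" and p: "0 \<le> p" "p \<le> p'" and q: "0 \<le> q'" "q' \<le> q"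
    and m: "int m > q - p + int (card (high v p' q'))"
  shows "(loc_series v p q * (\<Prod>a\<in>high v p' q'. one_plus (- y_poly (v a)))) $ m = 0"
proof -
  let ?C = "\<Prod>a\<in>kept v p' q'. one_plus (- y_poly (v a))"
  let ?B = "{1..q} - v ` kept v p' q'" and ?A = "{p<..p'}"
  let ?N = "(\<Prod>j\<in>?B. one_plus (- y_poly j)) * (\<Prod>a\<in>?A. one_plus (- y_poly (v a)))"
  note P = split_positions[OF v q(1), of p']
  have sub: "v ` kept v p' q' \<subseteq> {1..q}"
  proof (rule image_subsetI)
    fix a assume "a \<in> kept v p' q'"
    then have "1 \<le> a" "v a \<le> q'" by (simp_all add: kept_def)
    then show "v a \<in> {1..q}" using q(2) S_plus_pos[OF v, of a] by simp
  qed
  have split: "{1..p'} = {1..p} \<union> ?A" using p by auto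
  have "loc_series v p q * (\<Prod>a\<in>high v p' q'. one_plus (- y_poly (v a))) = ?N"
  proof (rule fps_cancel_unit)
    have "loc_series v p q * (\<Prod>a\<in>high v p' q'. one_plus (- y_poly (v a))) * ?C
        = loc_series v p q * (\<Prod>i\<in>{1..p'}. one_plus (- y_poly (v i)))"
      unfolding P(1) prod.union_disjoint[OF P(4,3,2)] by (simp add: mult.assoc)
    also have "(\<Prod>i\<in>{1..p'}. one_plus (- y_poly (v i)))
        = (\<Prod>i\<in>{1..p}. one_plus (- y_poly (v i))) * (\<Prod>i\<in>?A. one_plus (- y_poly (v i)))"
      unfolding split by (rule prod.union_disjoint) auto
    also have "loc_series v p q * \<dots>
        = loc_series v p q * (\<Prod>i\<in>{1..p}. one_plus (- y_poly (v i))) * (\<Prod>i\<in>?A. one_plus (- y_poly (v i)))"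
      by (rule mult.assoc[symmetric])
    also have "loc_series v p q * (\<Prod>i\<in>{1..p}. one_plus (- y_poly (v i))) = (\<Prod>j\<in>{1..q}. one_plus (- y_poly j))"
      by (rule loc_series_mult)
    also have "(\<Prod>j\<in>{1..q}. one_plus (- y_poly j))
        = (\<Prod>j\<in>?B. one_plus (- y_poly j)) * (\<Prod>j\<in>v ` kept v p' q'. one_plus (- y_poly j))"
      by (rule prod.subset_diff[OF sub]) simp
    also have "(\<Prod>j\<in>v ` kept v p' q'. one_plus (- y_poly j)) = ?C"
      by (simp add: prod.reindex inj_on_subset[OF S_plus_inj[OF v]])
    finally show "loc_series v p q * (\<Prod>a\<in>high v p' q'. one_plus (- y_poly (v a))) * ?C = ?N * ?C"
      by (simp only: mult_ac)
  qed simp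
  moreover have "?N $ m = 0"
  proof (rule fps_mult_degree)
    show "(\<Prod>j\<in>?B. one_plus (- y_poly j)) $ d = 0" if "card ?B < d" for d
      by (rule prod_one_plus_degree) (use that in auto)
    show "(\<Prod>a\<in>?A. one_plus (- y_poly (v a))) $ d = 0" if "card ?A < d" for d
      by (rule prod_one_plus_degree) (use that in auto)
    have "card {1..p'} = card (high v p' q') + card (kept v p' q')"
      unfolding P(1) by (rule card_Un_disjoint[OF P(4,3,2)])
    moreover have "card (v ` kept v p' q') = card (kept v p' q')"
      by (rule card_image[OF inj_on_subset[OF S_plus_inj[OF v] subset_UNIV]])
    moreover have "card ?B = card {1..q} - card (v ` kept v p' q')"
      by (rule card_Diff_subset[OF finite_imageI[OF P(3)] sub])
    moreover have "card (v ` kept v p' q') \<le> card {1..q}" by (rule card_mono[OF _ sub]) simp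
    moreover have "card {1..p'} = nat p'" "card {1..q} = nat q" "card ?A = nat (p' - p)" by simp_all
    ultimately have "int (card ?B + card ?A) = q - p + int (card (high v p' q'))"
      using p q by linarith
    then show "card ?B + card ?A < m" using m by linarith
  qed
  ultimately show ?thesis by simp
qed

text \<open>Positive k and l make \<open>high\<close> and \<open>low\<close> nonempty, and a
  permutation fixing all integers up to 0 has no such pair of positions around a negative p or
  q.\<close>

lemma tight_S_plus_pos:
  assumes st: "staircase \<tau>" and t: "tight \<tau> w" and w: "w \<in> S_plus" and j: "j \<in> {1..tlen \<tau>}"
  shows "0 \<le> tp \<tau> j" "0 \<le> tq \<tau> j"
proof -
  have S: "w \<in> S_Z" using w by (simp add: S_plus_def)
  have card: "card (high w (tp \<tau> j) (tq \<tau> j)) = tk \<tau> j"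
    using t j by (simp add: tight_def rank_conditions_high)
  then have "high w (tp \<tau> j) (tq \<tau> j) \<noteq> {}" using tk_pos[OF st j] by auto
  then obtain a where a: "a \<le> tp \<tau> j" "tq \<tau> j < w a" by (auto simp: high_def)
  have "int (card (low w (tp \<tau> j) (tq \<tau> j))) = tl_val \<tau> j"
    using card_low_tl[OF st S, of j] card by simp
  then have "low w (tp \<tau> j) (tq \<tau> j) \<noteq> {}" using tl_pos[OF st j] by auto
  then obtain b where b: "tp \<tau> j < b" "w b \<le> tq \<tau> j" by (auto simp: low_def)
  show "0 \<le> tp \<tau> j"
  proof (rule ccontr)
    assume "\<not> 0 \<le> tp \<tau> j"
    then show False
      using S_plus_nonpos[OF w, of a] S_plus_nonpos[OF w, of b] S_plus_pos[OF w, of b] a b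
      by (cases "1 \<le> b") auto
  qed
  show "0 \<le> tq \<tau> j"
  proof (rule ccontr)
    assume "\<not> 0 \<le> tq \<tau> j"
    then show False
      using S_plus_nonpos[OF w, of a] S_plus_nonpos[OF w, of b] S_plus_pos[OF w, of b] a b
      by (cases "1 \<le> b") auto
  qed
qed

text \<open>The first k_i rows belong to corners up to i, so one polynomial of degree r, the rank of
  \<open>v\<close> at i, clears all their denominators. As r < k_i, too few columns survive.\<close>

lemma loc_flag_schur_vanishes:
  assumes st: "staircase \<tau>" and s: "1 \<le> tlen \<tau>" and v: "v \<in> S_plus"
    and pos: "\<And>j. j \<in> {1..tlen \<tau>} \<Longrightarrow> 0 \<le> tp \<tau> j \<and> 0 \<le> tq \<tau> j"
    and nd: "\<not> dominates \<tau> v"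
  shows "loc v (flag_schur \<tau>) = 0"
proof -
  obtain i where i: "i \<in> {1..tlen \<tau>}" "card (high v (tp \<tau> i) (tq \<tau> i)) < tk \<tau> i"
    using nd v by (auto simp: dominates_def S_plus_def not_le)
  let ?d = "\<Prod>a\<in>high v (tp \<tau> i) (tq \<tau> i). one_plus (- y_poly (v a))"
  let ?r = "card (high v (tp \<tau> i) (tq \<tau> i))"
  have S: "v \<in> S_Z" using v by (simp add: S_plus_def)
  show ?thesis
    unfolding loc_flag_schur multi_schur_series_mat
  proof (rule det_series_zero[OF i(2) tk_le_ks[OF st i(1)]])
    show "?d $ j = 0" if "?r < j" for j
      by (rule prod_one_plus_degree[OF finite_high[OF S] that])
  next
    fix row m assume row: "row < tk \<tau> i" and m: "?r \<le> m"
    let ?j = "triple_index \<tau> (Suc row)"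
    have ks: "Suc row \<le> triple_ks \<tau>" using row tk_le_ks[OF st i(1)] by simp
    have j: "?j \<in> {1..tlen \<tau>}" "Suc row \<le> tk \<tau> ?j" "?j \<le> i"
      using triple_index[OF st s ks] i(1) row by auto
    have pq: "0 \<le> tp \<tau> ?j" "tp \<tau> ?j \<le> tp \<tau> i" "0 \<le> tq \<tau> i" "tq \<tau> i \<le> tq \<tau> ?j"
      using pos[OF j(1)] pos[OF i(1)] tp_le[OF st j(1) i(1) j(3)] tq_le[OF st j(1) i(1) j(3)] by auto
    let ?e = "triple_part \<tau> (Suc row) - int row + int m"
    show "series_coeff (loc_series v (tp \<tau> ?j) (tq \<tau> ?j) * ?d) ?e = 0"
    proof (cases "?e < 0")
      case False
      \<comment> \<open>Here row < k_j and r \<le> m, so the index exceeds the degree bound.\<close>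
      have "tq \<tau> ?j - tp \<tau> ?j + int ?r < ?e"
        using j(2) m by (simp add: triple_part_def tl_val_def)
      then have "tq \<tau> ?j - tp \<tau> ?j + int ?r < int (nat ?e)" using False by simp
      from loc_series_degree[OF v pq this] show ?thesis using False by (simp add: series_coeff_def)
    qed (simp add: series_coeff_def)
  qed simp
qed

text \<open>Since \<alpha> lists the high sets as initial segments, the reduced denominators are
  nested products, as \<open>det_series_factors\<close> requires.\<close>

lemma loc_flag_schur_tight:
  assumes st: "staircase \<tau>" and s: "1 \<le> tlen \<tau>" and w: "w \<in> S_plus" and t: "tight \<tau> w"
  shows "loc w (flag_schur \<tau>) = (\<Prod>(a, b)\<in>inversions w. y_poly (w a) - y_poly (w b))"
proof -
  let ?i = "\<lambda>row. triple_index \<tau> (Suc row)"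
  let ?B = "\<lambda>row. low w (tp \<tau> (?i row)) (tq \<tau> (?i row))"
  have S: "w \<in> S_Z" using w by (simp add: S_plus_def)
  obtain \<alpha> where \<alpha>: "inj_on \<alpha> {1..triple_ks \<tau>}"
    "\<And>j. j \<in> {1..tlen \<tau>} \<Longrightarrow> \<alpha> ` {1..tk \<tau> j} = high w (tp \<tau> j) (tq \<tau> j)"
    "bij_betw (\<lambda>(k, b). (\<alpha> k, b))
      (SIGMA k:{1..triple_ks \<tau>}. low w (tp \<tau> (triple_index \<tau> k)) (tq \<tau> (triple_index \<tau> k)))
      (inversions w)"
    using tight_inversions[OF st t s] by blast
  have idx: "?i row \<in> {1..tlen \<tau>}" "row < tk \<tau> (?i row)" if "row < triple_ks \<tau>" for row
    using triple_index(1,2)[OF st s, of "Suc row"] that by auto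
  have cardB: "int (card (?B row)) = triple_part \<tau> (Suc row)" if "row < triple_ks \<tau>" for row
    using t idx(1)[OF that] card_low_tl[OF st S, of "?i row"]
    by (simp add: triple_part_def tight_def rank_conditions_high)
  have "loc w (flag_schur \<tau>)
      = multi_schur (triple_ks \<tau>) (\<lambda>k. int (card (low w (tp \<tau> (triple_index \<tau> k)) (tq \<tau> (triple_index \<tau> k)))))
          (\<lambda>k. loc_series w (tp \<tau> (triple_index \<tau> k)) (tq \<tau> (triple_index \<tau> k)))"
    unfolding loc_flag_schur
  proof (rule multi_schur_cong)
    fix k assume "k \<in> {1..triple_ks \<tau>}"
    then obtain row where "k = Suc row" "row < triple_ks \<tau>" by (cases k) auto
    then show "triple_part \<tau> k = int (card (low w (tp \<tau> (triple_index \<tau> k)) (tq \<tau> (triple_index \<tau> k)))) \<and>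
        loc_series w (tp \<tau> (triple_index \<tau> k)) (tq \<tau> (triple_index \<tau> k))
        = loc_series w (tp \<tau> (triple_index \<tau> k)) (tq \<tau> (triple_index \<tau> k))"
      using cardB by simp
  qed
  also have "\<dots> = (\<Prod>row<triple_ks \<tau>. \<Prod>b\<in>?B row. y_poly (w (\<alpha> (Suc row))) - y_poly (w b))"
    unfolding multi_schur_series_mat
  proof (rule det_series_factors[where K = "\<lambda>row. tk \<tau> (?i row)"])
    fix row assume row: "row < triple_ks \<tau>"
    show "row < tk \<tau> (?i row) \<and> tk \<tau> (?i row) \<le> triple_ks \<tau>"
      using idx[OF row] tk_le_ks[OF st] by blast
    show "finite (?B row)" by (rule finite_low[OF S])
    have high: "(\<Prod>k<tk \<tau> (?i row). one_plus (- y_poly (w (\<alpha> (Suc k)))))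
        = (\<Prod>a\<in>high w (tp \<tau> (?i row)) (tq \<tau> (?i row)). one_plus (- y_poly (w a)))"
    proof -
      have sub: "{1..tk \<tau> (?i row)} \<subseteq> {1..triple_ks \<tau>}" using tk_le_ks[OF st idx(1)[OF row]] by auto
      have "(\<Prod>k<tk \<tau> (?i row). one_plus (- y_poly (w (\<alpha> (Suc k)))))
          = (\<Prod>k\<in>{1..tk \<tau> (?i row)}. one_plus (- y_poly (w (\<alpha> k))))"
        by (rule prod.reindex_bij_witness[of _ "\<lambda>k. k - 1" Suc]) auto
      also have "\<dots> = (\<Prod>a\<in>\<alpha> ` {1..tk \<tau> (?i row)}. one_plus (- y_poly (w a)))"
        unfolding prod.reindex[OF inj_on_subset[OF \<alpha>(1) sub]] by simp
      finally show ?thesis unfolding \<alpha>(2)[OF idx(1)[OF row]] .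
    qed
    show "loc_series w (tp \<tau> (?i row)) (tq \<tau> (?i row)) * (\<Prod>k<tk \<tau> (?i row). one_plus (- y_poly (w (\<alpha> (Suc k)))))
        = (\<Prod>b\<in>?B row. one_plus (- y_poly (w b)))"
      unfolding high
      by (rule loc_series_reduced[OF w]) (rule tight_S_plus_pos[OF st t w idx(1)[OF row]])+
  next
    fix row row' assume row: "row < triple_ks \<tau>" "row \<le> row'" "row' < tk \<tau> (?i row)"
    have row': "row' < triple_ks \<tau>"
      \<comment> \<open>The rows from \<open>row\<close> to the end of its block share the same
        \<open>triple_index\<close>, hence the same series and the same \<open>low\<close>
        set.\<close>
      using row(3) tk_le_ks[OF st idx(1)[OF row(1)]] by simp
    have "?i row' \<le> ?i row"
      by (rule triple_index(3)[OF st s]) (use row row' idx(1)[OF row(1)] in auto)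
    moreover have "?i row \<le> ?i row'"
      by (rule triple_index(3)[OF st s]) (use row row' idx[OF row'] in auto)
    ultimately have "?i row' = ?i row" by simp
    then show "loc_series w (tp \<tau> (?i row')) (tq \<tau> (?i row')) = loc_series w (tp \<tau> (?i row)) (tq \<tau> (?i row))
        \<and> card (?B row') = card (?B row)" by simp
  qed
  also have "\<dots> = (\<Prod>k\<in>{1..triple_ks \<tau>}. \<Prod>b\<in>low w (tp \<tau> (triple_index \<tau> k)) (tq \<tau> (triple_index \<tau> k)).
      y_poly (w (\<alpha> k)) - y_poly (w b))"
    by (rule prod.reindex_bij_witness[of _ "\<lambda>k. k - 1" Suc]) auto
  also have "\<dots> = (\<Prod>x\<in>(SIGMA k:{1..triple_ks \<tau>}. low w (tp \<tau> (triple_index \<tau> k)) (tq \<tau> (triple_index \<tau> k))).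
      case (case x of (k, b) \<Rightarrow> (\<alpha> k, b)) of (a, b) \<Rightarrow> y_poly (w a) - y_poly (w b))"
    by (subst prod.Sigma) (simp_all add: finite_low[OF S] case_prod_unfold)
  also have "\<dots> = (\<Prod>(a, b)\<in>inversions w. y_poly (w a) - y_poly (w b))"
    by (rule prod.reindex_bij_betw[OF \<alpha>(3)])
  finally show ?thesis .
qed

lemma interpolates_flag_schur:
  assumes st: "staircase \<tau>" and s: "1 \<le> tlen \<tau>" and w: "w \<in> S_plus" and t: "tight \<tau> w"
  shows "interpolates w (flag_schur \<tau>)"
  unfolding interpolates_def
proof (intro conjI ballI impI)
  show "xfil (perm_length w) (flag_schur \<tau>)"
    unfolding flag_schur_def
    by (rule xfil_multi_schur) (simp_all add: graded_flag_series tight_perm_length[OF st t s])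
  show "loc w (flag_schur \<tau>) = (\<Prod>(a, b)\<in>inversions w. y_poly (w a) - y_poly (w b))"
    by (rule loc_flag_schur_tight[OF st s w t])
  fix v assume v: "v \<in> S_plus" "perm_length v \<le> perm_length w" "v \<noteq> w"
  then have "\<not> dominates \<tau> v" using tight_least[OF st t _ v(2)] by blast
  then show "loc v (flag_schur \<tau>) = 0"
    using tight_S_plus_pos[OF st t w] by (intro loc_flag_schur_vanishes[OF st s v(1)]) auto
qed (rule w)

section \<open>Shifting and uniqueness of the enriched polynomial\<close>

definition shift_triple :: "int \<Rightarrow> triple \<Rightarrow> triple" where
  "shift_triple m \<tau> = \<tau>\<lparr>tp := (\<lambda>i. tp \<tau> i + m), tq := (\<lambda>i. tq \<tau> i + m)\<rparr>"

lemma shift_triple_simps [simp]: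
  "tlen (shift_triple m \<tau>) = tlen \<tau>" "tk (shift_triple m \<tau>) = tk \<tau>"
  "tp (shift_triple m \<tau>) i = tp \<tau> i + m" "tq (shift_triple m \<tau>) i = tq \<tau> i + m"
  "tl_val (shift_triple m \<tau>) i = tl_val \<tau> i"
  "triple_ks (shift_triple m \<tau>) = triple_ks \<tau>"
  "triple_index (shift_triple m \<tau>) = triple_index \<tau>"
  "triple_part (shift_triple m \<tau>) = triple_part \<tau>"
  by (simp_all add: shift_triple_def tl_val_def triple_ks_def triple_index_def triple_part_def fun_eq_iff)

lemma staircase_shift: "staircase \<tau> \<Longrightarrow> staircase (shift_triple m \<tau>)"
  by (simp add: staircase_def monotone_on_def)

lemma high_shift: "a \<in> high (shift_perm m w) (p + m) (q + m) \<longleftrightarrow> a - m \<in> high w p q"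
  by (auto simp: high_def shift_perm_def)

lemma low_shift: "a \<in> low (shift_perm m w) (p + m) (q + m) \<longleftrightarrow> a - m \<in> low w p q"
  by (auto simp: low_def shift_perm_def)

lemma card_high_shift: "card (high (shift_perm m w) (p + m) (q + m)) = card (high w p q)"
proof (rule bij_betw_same_card)
  show "bij_betw (\<lambda>a. a - m) (high (shift_perm m w) (p + m) (q + m)) (high w p q)"
    by (rule bij_betw_byWitness[of _ "\<lambda>a. a + m"]) (auto simp: high_shift)
qed

lemma tight_shift:
  assumes t: "tight \<tau> w" and S: "shift_perm m w \<in> S_Z"
  shows "tight (shift_triple m \<tau>) (shift_perm m w)"
proof -
  have "\<exists>j. essential (shift_triple m \<tau>) (shift_perm m w) a b j"
    if "(a, b) \<in> inversions (shift_perm m w)" for a b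
  proof -
    have "(a - m, b - m) \<in> inversions w" using that by (simp add: inversions_def shift_perm_def)
    then obtain j where "essential \<tau> w (a - m) (b - m) j" using t unfolding tight_def by blast
    then have "essential (shift_triple m \<tau>) (shift_perm m w) a b j"
      by (simp add: essential_def high_shift low_shift)
    then show ?thesis ..
  qed
  moreover have "rank_conditions (shift_triple m \<tau>) (shift_perm m w)"
    using t by (simp add: tight_def rank_conditions_high card_high_shift)
  ultimately show ?thesis using S unfolding tight_def by blast
qed

lemma shift_perm_S_plus:
  assumes w: "w \<in> S_Z"
  obtains m0 where "\<And>m. m \<ge> m0 \<Longrightarrow> shift_perm m w \<in> S_plus"
proof -
  obtain N where "N \<ge> 0" and N: "\<And>i. \<bar>i\<bar> > N \<Longrightarrow> w i = i" "\<And>i. \<bar>i\<bar> \<le> N \<Longrightarrow> \<bar>w i\<bar> \<le> N"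
    using S_Z_bound[OF w, of 0] by blast
  have "shift_perm m w \<in> S_plus" if m: "m \<ge> N + 1" for m
  proof -
    have eq: "shift_perm m w = (\<lambda>j. j + m) \<circ> w \<circ> (\<lambda>j. j - m)" by (simp add: shift_perm_def fun_eq_iff)
    have "bij (\<lambda>j::int. j + m)" "bij (\<lambda>j::int. j - m)"
      by (rule o_bij[of "\<lambda>j. j - m"]; simp add: fun_eq_iff) (rule o_bij[of "\<lambda>j. j + m"]; simp add: fun_eq_iff)
    then have "bij (shift_perm m w)"
      unfolding eq using w by (intro bij_comp) (simp_all add: S_Z_def)
    moreover have "{j. shift_perm m w j \<noteq> j} \<subseteq> (\<lambda>i. i + m) ` {i. w i \<noteq> i}"
    proof
      fix j assume "j \<in> {j. shift_perm m w j \<noteq> j}"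
      then have "j - m \<in> {i. w i \<noteq> i}" by (auto simp: shift_perm_def)
      then have "(j - m) + m \<in> (\<lambda>i. i + m) ` {i. w i \<noteq> i}" by (rule imageI)
      then show "j \<in> (\<lambda>i. i + m) ` {i. w i \<noteq> i}" by simp
    qed
    then have "finite {j. shift_perm m w j \<noteq> j}"
      by (rule finite_subset) (use w in \<open>simp add: S_Z_def\<close>)
    moreover have "shift_perm m w j = j" if "j \<le> 0" for j
      using N(1)[of "j - m"] that m by (simp add: shift_perm_def)
    ultimately show ?thesis by (simp add: S_plus_def S_Z_def)
  qed
  then show thesis by (rule that)
qed

section \<open>Shifting followed by c = 1\<close>

definition kill_subst :: "var \<Rightarrow> epoly" where
  "kill_subst v = (case v of CVar k \<Rightarrow> 0 | XVar i \<Rightarrow> x_poly i | YVar i \<Rightarrow> y_poly i)"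

definition shift_kill_subst :: "int \<Rightarrow> var \<Rightarrow> epoly" where
  "shift_kill_subst m v = (case v of
     CVar k \<Rightarrow> eval_epoly kill_subst (shift_chern m $ Suc k)
   | XVar i \<Rightarrow> x_poly (i + m)
   | YVar i \<Rightarrow> y_poly (i + m))"

lemma kill_shift_eval: "kill_chern (shift_poly m P) = eval_epoly (shift_kill_subst m) P"
proof -
  have kill: "kill_chern = eval_epoly kill_subst"
    by (simp add: kill_chern_def subst_poly_eq_eval kill_subst_def[abs_def])
  show ?thesis
    unfolding kill shift_poly_def subst_poly_eq_eval eval_comp
    by (rule eval_cong) (simp add: shift_kill_subst_def kill_subst_def split: var.split)
qed

abbreviation x_factor :: "int \<Rightarrow> epoly fps" where "x_factor i \<equiv> one_plus (- x_poly i)"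
abbreviation y_factor :: "int \<Rightarrow> epoly fps" where "y_factor i \<equiv> one_plus (y_poly i)"

lemma series_quot_nth_0 [simp]: "series_quot a b $ 0 = a $ 0"
  by (simp add: series_quot_def)

lemma hom_shift_kill_chern:
  assumes "0 \<le> m"
  shows "hom_fps (shift_kill_subst m) chern * (\<Prod>i\<in>{1..m}. x_factor i) = (\<Prod>i\<in>{1..m}. y_factor i)"
proof -
  let ?X = "\<Prod>i\<in>{1..m}. x_factor i" and ?Y = "\<Prod>i\<in>{1..m}. y_factor i"
  have sc: "shift_chern m = chern * series_quot ?Y ?X" using assms by (simp add: shift_chern_def)
  have "hom_fps (shift_kill_subst m) chern = hom_fps kill_subst (shift_chern m)"
  proof (rule fps_ext)
    fix n
    show "hom_fps (shift_kill_subst m) chern $ n = hom_fps kill_subst (shift_chern m) $ n"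
    proof (cases n)
      case 0
      then show ?thesis by (simp add: chern_def sc)
    next
      case (Suc k)
      then show ?thesis by (simp add: chern_def shift_kill_subst_def)
    qed
  qed
  also have "\<dots> = hom_fps kill_subst (series_quot ?Y ?X)"
  proof -
    have "hom_fps kill_subst chern = 1"
      by (rule fps_ext) (simp add: chern_def kill_subst_def split: nat.split)
    then show ?thesis unfolding sc hom_fps_mult by simp
  qed
  finally have "hom_fps (shift_kill_subst m) chern * ?X = hom_fps kill_subst (series_quot ?Y ?X) * ?X"
    by (rule arg_cong)
  also have "hom_fps kill_subst (series_quot ?Y ?X) * ?X
      = hom_fps kill_subst (series_quot ?Y ?X) * hom_fps kill_subst ?X"
    by (simp add: hom_fps_prod hom_fps_one_plus eval_uminus kill_subst_def)
  also have "\<dots> = hom_fps kill_subst ?Y"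
    unfolding hom_fps_mult[symmetric] by (subst series_quot_mult) simp_all
  also have "\<dots> = ?Y" by (simp add: hom_fps_prod hom_fps_one_plus kill_subst_def)
  finally show ?thesis .
qed

lemma prod_shift:
  fixes f :: "int \<Rightarrow> 'a::comm_monoid_mult"
  shows "(\<Prod>i\<in>{a..b}. f (i + m)) = (\<Prod>i\<in>{a + m..b + m}. f i)"
  by (rule prod.reindex_bij_witness[of _ "\<lambda>i. i - m" "\<lambda>i. i + m"]) auto

text \<open>Both sides are the product over 1..max a b. This treats both signs of p and q in a(p, q)
  at once.\<close>

lemma prod_interval_exchange:
  fixes f :: "int \<Rightarrow> 'a::comm_monoid_mult"
  assumes "0 \<le> a" "0 \<le> b"
  shows "(\<Prod>i\<in>{1..a}. f i) * (\<Prod>i\<in>{a+1..b}. f i) = (\<Prod>i\<in>{1..b}. f i) * (\<Prod>i\<in>{b+1..a}. f i)"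
proof -
  have join: "(\<Prod>i\<in>{1..a}. f i) * (\<Prod>i\<in>{a+1..b}. f i) = (\<Prod>i\<in>{1..b}. f i)" if "0 \<le> a" "a \<le> b" for a b
  proof -
    have "{1..b} = {1..a} \<union> {a+1..b}" using that by auto
    then show ?thesis by (simp add: prod.union_disjoint)
  qed
  show ?thesis
    using join[of a b] join[of b a] assms by (cases "a \<le> b") auto
qed

lemma hom_shift_kill_series:
  assumes m: "0 \<le> m" and p: "0 \<le> p + m" and q: "0 \<le> q + m"
  shows "hom_fps (shift_kill_subst m) (chern * a_series p q) * (\<Prod>i\<in>{1..p+m}. x_factor i)
       = (\<Prod>i\<in>{1..q+m}. y_factor i)"
proof -
  let ?h = "hom_fps (shift_kill_subst m)"
  let ?X = "\<lambda>a b. \<Prod>i\<in>{a..b}. x_factor i" and ?Y = "\<lambda>a b. \<Prod>i\<in>{a..b}. y_factor i"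
  have hX: "?h (?X a b) = ?X (a + m) (b + m)" for a b
    unfolding hom_fps_prod hom_fps_one_plus eval_uminus eval_var prod_shift[of x_factor m a b, symmetric]
    by (simp add: shift_kill_subst_def)
  have hY: "?h (?Y a b) = ?Y (a + m) (b + m)" for a b
    unfolding hom_fps_prod hom_fps_one_plus eval_var prod_shift[of y_factor m a b, symmetric]
    by (simp add: shift_kill_subst_def)
  let ?C = "?h chern" and ?A = "?h (a_series p q)"
  \<comment> \<open>The surplus factors, nontrivial only for negative p or q; they appear on both
    sides and are cancelled at the end.\<close>
  let ?U = "?X (p + m + 1) m * ?Y (q + m + 1) m"
  have "a_series p q * (?X 1 p * ?Y (q + 1) 0) = ?X (p + 1) 0 * ?Y 1 q"
    unfolding a_series_def by (rule series_quot_mult) simp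
  then have "?h (a_series p q * (?X 1 p * ?Y (q + 1) 0)) = ?h (?X (p + 1) 0 * ?Y 1 q)" by simp
  then have A: "?A * (?X (m + 1) (p + m) * ?Y (q + m + 1) m) = ?X (p + m + 1) m * ?Y (m + 1) (q + m)"
    unfolding hom_fps_mult hX hY by (simp add: ac_simps)
  have C: "?C * ?X 1 m = ?Y 1 m" by (rule hom_shift_kill_chern[OF m])
  have X: "?X 1 m * ?X (m + 1) (p + m) = ?X 1 (p + m) * ?X (p + m + 1) m"
    by (rule prod_interval_exchange[OF m p])
  have Y: "?Y 1 m * ?Y (m + 1) (q + m) = ?Y 1 (q + m) * ?Y (q + m + 1) m"
    by (rule prod_interval_exchange[OF m q])
  have "?C * ?A * ?X 1 (p + m) * ?U = ?C * ?A * (?X 1 (p + m) * ?X (p + m + 1) m) * ?Y (q + m + 1) m"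
    by (simp only: mult_ac)
  also have "\<dots> = (?C * ?X 1 m) * (?A * (?X (m + 1) (p + m) * ?Y (q + m + 1) m))"
    unfolding X[symmetric] by (simp only: mult_ac)
  also have "\<dots> = (?Y 1 m * ?Y (m + 1) (q + m)) * ?X (p + m + 1) m"
    unfolding A C by (simp only: mult_ac)
  also have "\<dots> = ?Y 1 (q + m) * ?U" unfolding Y by (simp only: mult_ac)
  finally have "?C * ?A * ?X 1 (p + m) = ?Y 1 (q + m)" by (rule fps_cancel_unit[rotated]) simp
  then show ?thesis by (simp only: hom_fps_mult)
qed

lemma negate_flag_series:
  fixes \<nu> defines "\<nu> \<equiv> (\<lambda>v. case v of
     CVar k \<Rightarrow> var_poly (CVar k) | XVar i \<Rightarrow> x_poly i | YVar i \<Rightarrow> - y_poly i)"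
  shows "hom_fps \<nu> (flag_series p q) * (\<Prod>i\<in>{1..p}. x_factor i) = (\<Prod>i\<in>{1..q}. y_factor i)"
proof -
  have "hom_fps \<nu> (\<Prod>i\<in>{1..p}. x_factor i) = (\<Prod>i\<in>{1..p}. x_factor i)"
    by (simp add: hom_fps_prod hom_fps_one_plus eval_uminus \<nu>_def)
  then have "hom_fps \<nu> (flag_series p q) * (\<Prod>i\<in>{1..p}. x_factor i)
      = hom_fps \<nu> (flag_series p q * (\<Prod>i\<in>{1..p}. x_factor i))"
    by (simp only: hom_fps_mult)
  also have "\<dots> = hom_fps \<nu> (\<Prod>j\<in>{1..q}. one_plus (- y_poly j))"
    unfolding flag_series_def by (subst series_quot_mult) simp_all
  also have "\<dots> = (\<Prod>i\<in>{1..q}. y_factor i)"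
    by (simp add: hom_fps_prod hom_fps_one_plus eval_uminus \<nu>_def)
  finally show ?thesis .
qed

lemma kill_shift_multi_schur:
  assumes m: "0 \<le> m"
    and pos: "\<And>k. k \<in> {1..triple_ks \<tau>} \<Longrightarrow>
      0 \<le> tp \<tau> (triple_index \<tau> k) + m \<and> 0 \<le> tq \<tau> (triple_index \<tau> k) + m"
  shows "kill_chern (shift_poly m (multi_schur (triple_ks \<tau>) (triple_part \<tau>) (triple_series \<tau>)))
       = negate_y (flag_schur (shift_triple m \<tau>))"
proof -
  let ?\<nu> = "\<lambda>v. case v of
     CVar k \<Rightarrow> var_poly (CVar k) | XVar i \<Rightarrow> x_poly i | YVar i \<Rightarrow> - y_poly i"
  have neg: "negate_y = eval_epoly ?\<nu>" by (simp add: negate_y_def subst_poly_eq_eval)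
  show ?thesis
    unfolding kill_shift_eval neg flag_schur_def eval_multi_schur shift_triple_simps
  proof (rule multi_schur_cong)
    fix k assume k: "k \<in> {1..triple_ks \<tau>}"
    let ?p = "tp \<tau> (triple_index \<tau> k)" and ?q = "tq \<tau> (triple_index \<tau> k)"
    have "hom_fps (shift_kill_subst m) (triple_series \<tau> k) * (\<Prod>i\<in>{1..?p+m}. x_factor i)
        = hom_fps ?\<nu> (flag_series (?p + m) (?q + m)) * (\<Prod>i\<in>{1..?p+m}. x_factor i)"
      unfolding negate_flag_series triple_series_def
      by (rule hom_shift_kill_series) (use m pos[OF k] in auto)
    then have "hom_fps (shift_kill_subst m) (triple_series \<tau> k) = hom_fps ?\<nu> (flag_series (?p + m) (?q + m))"
      by (rule fps_cancel_unit[OF prod_one_plus_nth_0])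
    then show "triple_part \<tau> k = triple_part \<tau> k \<and>
        hom_fps (shift_kill_subst m) (triple_series \<tau> k) = hom_fps ?\<nu> (flag_series (?p + m) (?q + m))"
      by (rule conjI[OF refl])
  qed
qed

section \<open>Realising complex points by shifts\<close>

lemma complex_poly_split:
  fixes p :: "complex poly"
  assumes "poly p 0 = 1"
  shows "\<exists>z. p = (\<Prod>i<degree p. [:1, z i:])"
  using assms
proof (induction "degree p" arbitrary: p)
  case 0
  then obtain a where "p = [:a:]" by (metis degree_eq_zeroE)
  then show ?case using 0 by simp
next
  case (Suc n)
  have "\<not> constant (poly p)" using Suc.hyps(2) by (simp add: constant_degree)
  then obtain r where r: "poly p r = 0" using fundamental_theorem_of_algebra by blast
  then have r0: "r \<noteq> 0" using Suc.prems by auto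
  obtain q where q: "p = [:- r, 1:] * q" using r by (auto simp: poly_eq_0_iff_dvd dvd_def)
  define q' where "q' = smult (- r) q"
  have "[:1, - inverse r:] * smult (- r) q = smult (- r) [:1, - inverse r:] * q"
    by (simp only: mult_smult_left mult_smult_right)
  also have "smult (- r) [:1, - inverse r:] = [:- r, 1:]" using r0 by simp
  finally have p: "p = [:1, - inverse r:] * q'" by (simp only: q q'_def)
  have "q' \<noteq> 0" using p Suc.prems by auto
  then have "degree p = Suc (degree q')" unfolding p using r0 by (subst degree_mult_eq) auto
  then have deg: "n = degree q'" using Suc.hyps(2) by simp
  have "poly q' 0 = 1" using Suc.prems unfolding p by simp
  from Suc.hyps(1)[OF deg this] obtain z where z: "q' = (\<Prod>i<degree q'. [:1, z i:])" by blast
  have "p = (\<Prod>i<Suc n. [:1, (case i of 0 \<Rightarrow> - inverse r | Suc j \<Rightarrow> z j):])"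
    unfolding prod.lessThan_Suc_shift using z deg p by simp
  then show ?case unfolding Suc.hyps(2) by (rule exI[of _ "\<lambda>i. case i of 0 \<Rightarrow> - inverse r | Suc j \<Rightarrow> z j"])
qed

text \<open>For large \<open>m\<close> the variables \<open>y\<^sub>1, \<dots>, y\<^sub>K\<close> do not occur among the images of the variables of
  \<open>D\<close>, and over \<open>\<complex>\<close> they can be chosen so that the images of the \<open>c\<^sub>k\<close> take prescribed values.\<close>

lemma shift_kill_point:
  fixes \<rho> :: "var \<Rightarrow> complex"
  assumes m: "int K + N + 1 \<le> m" and N: "0 \<le> N"
    and bound: "\<And>i. XVar i \<in> vars D \<Longrightarrow> - N \<le> i" "\<And>i. YVar i \<in> vars D \<Longrightarrow> - N \<le> i"
      "\<And>k. CVar k \<in> vars D \<Longrightarrow> k < K"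
  shows "\<exists>\<sigma> :: var \<Rightarrow> complex. \<forall>v\<in>vars D. eval_epoly \<sigma> (shift_kill_subst m v) = \<rho> v"
proof -
  let ?L = "\<lambda>z. 1 + fps_const z * (fps_X :: complex fps)"
  define T where "T = Abs_fps (\<lambda>n. case n of 0 \<Rightarrow> 1 | Suc k \<Rightarrow> \<rho> (CVar k))"
  \<comment> \<open>The shifted x-variables of \<open>D\<close> lie at m - N or beyond; the others
    are set to 0 and contribute trivial factors.\<close>
  define \<xi> where "\<xi> j = (if m - N \<le> j then \<rho> (XVar (j - m)) else 0)" for j
  define X where "X = (\<Prod>i\<in>{1..m}. ?L (- \<xi> i))"
  define W where "W = (\<Prod>j\<in>{m-N..m}. ?L (\<rho> (YVar (j - m))))"
  \<comment> \<open>With target series \<open>T\<close> for c, the shifted c equals the y-product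
    divided by \<open>X\<close>. \<open>W\<close> is the part of the y-product already prescribed,
    so the free y-variables have to produce \<open>S\<close>.\<close>
  define S where "S = T * X * inverse W"
  have L0: "(\<Prod>i\<in>A. ?L (f i)) $ 0 = 1" for A :: "int set" and f
    by (induction A rule: infinite_finite_induct) simp_all
  have W0: "W $ 0 = 1" and X0: "X $ 0 = 1" unfolding W_def X_def by (rule L0)+
  have SW: "S * W = T * X"
  proof -
    have "inverse W * W = 1" by (rule inverse_mult_eq_1) (simp add: W0)
    then show ?thesis by (simp add: S_def mult.assoc)
  qed
  have S0: "S $ 0 = 1" using W0 X0 by (simp add: S_def T_def)
  \<comment> \<open>Only c_1, ..., c_K can occur in \<open>D\<close>, so matching up to order K
    suffices, and the truncation is a polynomial that splits into linear factors.\<close>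
  define E where "E = (\<Sum>k\<le>K. monom (S $ k) k)"
  have coeffE: "coeff E n = (if n \<le> K then S $ n else 0)" for n
    by (simp add: E_def coeff_sum)
  have degE: "degree E \<le> K" by (rule degree_le) (simp add: coeffE)
  have "poly E 0 = 1" by (simp add: poly_0_coeff_0 coeffE S0)
  then obtain z where z: "E = (\<Prod>i<degree E. [:1, z i:])" using complex_poly_split by blast
  \<comment> \<open>The factors of \<open>E\<close> occupy y_1, ..., y_K at most; the bound on m
    places these below m - N, disjoint from the prescribed variables.\<close>
  define \<eta> where "\<eta> j = (if m - N \<le> j then \<rho> (YVar (j - m))
      else if 1 \<le> j \<and> j \<le> int (degree E) then z (nat (j - 1)) else 0)" for j
  have E: "fps_of_poly E = (\<Prod>j\<in>{1..m-N-1}. ?L (\<eta> j))"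
  proof -
    have lin: "fps_of_poly [:1, c:] = ?L c" for c :: complex
      by (simp add: fps_of_poly_pCons)
    have "fps_of_poly E = (\<Prod>i<degree E. ?L (z i))"
      by (subst z) (simp only: fps_of_poly_prod lin)
    also have "\<dots> = (\<Prod>j\<in>{1..int (degree E)}. ?L (\<eta> j))"
      by (rule prod.reindex_bij_witness[of _ "\<lambda>j. nat (j - 1)" "\<lambda>i. int i + 1"])
        (use m degE in \<open>auto simp: \<eta>_def\<close>)
    also have "\<dots> = (\<Prod>j\<in>{1..m-N-1}. ?L (\<eta> j))"
      by (rule prod.mono_neutral_left) (use m degE in \<open>auto simp: \<eta>_def\<close>)
    finally show ?thesis .
  qed
  have EW: "fps_of_poly E * W = (\<Prod>j\<in>{1..m}. ?L (\<eta> j))"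
  proof -
    have "{1..m} = {1..m-N-1} \<union> {m-N..m}" using m N by auto
    then have "(\<Prod>j\<in>{1..m}. ?L (\<eta> j)) = (\<Prod>j\<in>{1..m-N-1}. ?L (\<eta> j)) * (\<Prod>j\<in>{m-N..m}. ?L (\<eta> j))"
      by (simp add: prod.union_disjoint)
    also have "(\<Prod>j\<in>{m-N..m}. ?L (\<eta> j)) = W" unfolding W_def by (rule prod.cong) (auto simp: \<eta>_def)
    finally show ?thesis using E by simp
  qed
  define \<sigma> where "\<sigma> v = (case v of CVar k \<Rightarrow> 0 | XVar j \<Rightarrow> \<xi> j | YVar j \<Rightarrow> \<eta> j)" for v
  define H where "H = hom_fps \<sigma> (hom_fps (shift_kill_subst m) chern)"
  have "0 \<le> m" using m N by simp
  from arg_cong[OF hom_shift_kill_chern[OF this], of "hom_fps \<sigma>"]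
  have HX: "H * X = fps_of_poly E * W"
    unfolding EW hom_fps_mult hom_fps_prod hom_fps_one_plus_linear H_def X_def
    by (simp add: eval_uminus \<sigma>_def)
  \<comment> \<open>The difference of \<open>E\<close> and \<open>S\<close> starts beyond t^K, and
    \<open>X\<close> is a unit, so the difference of \<open>H\<close> and \<open>T\<close> starts
    there too.\<close>
  have agree: "H $ n = T $ n" if "n \<le> K" for n
  proof -
    have "((H - T) * X) $ k = 0" if "k \<le> K" for k
    proof -
      have "(H - T) * X = (fps_of_poly E - S) * W"
        using HX SW by (simp add: algebra_simps)
      then have "((H - T) * X) $ k = (\<Sum>i=0..k. (coeff E i - S $ i) * W $ (k - i))"
        by (simp add: fps_mult_nth)
      also have "\<dots> = 0" using that by (intro sum.neutral) (simp add: coeffE)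
      finally show ?thesis .
    qed
    moreover have "H - T = (H - T) * X * inverse X"
    proof -
      have "X * inverse X = 1" using inverse_mult_eq_1[of X] X0 by (simp add: mult.commute)
      then show ?thesis by (simp add: mult.assoc)
    qed
    then have "(H - T) $ n = (\<Sum>i=0..n. ((H - T) * X) $ i * inverse X $ (n - i))"
      by (simp only: fps_mult_nth[of "(H - T) * X" "inverse X" n, symmetric])
    ultimately have "(H - T) $ n = 0" using that by simp
    then show ?thesis by simp
  qed
  have "eval_epoly \<sigma> (shift_kill_subst m v) = \<rho> v" if v: "v \<in> vars D" for v
  proof (cases v)
    case (CVar k)
    have "H $ Suc k = T $ Suc k" using bound(3)[of k] v CVar by (intro agree) simp
    then show ?thesis using CVar by (simp add: H_def T_def chern_def)
  next
    case (XVar i)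
    then show ?thesis using bound(1)[of i] v by (simp add: shift_kill_subst_def \<sigma>_def \<xi>_def)
  next
    case (YVar i)
    then show ?thesis using bound(2)[of i] v by (simp add: shift_kill_subst_def \<sigma>_def \<eta>_def)
  qed
  then show ?thesis by blast
qed

lemma enriched_schubert_unique:
  assumes w: "w \<in> S_Z" and P: "is_enriched_schubert w P" and Q: "is_enriched_schubert w Q"
  shows "P = Q"
proof (rule ccontr)
  assume "P \<noteq> Q"
  let ?D = "P - Q"
  obtain \<rho> :: "var \<Rightarrow> complex" where \<rho>: "eval_epoly \<rho> ?D \<noteq> 0"
    using exists_nonzero_point[of ?D] \<open>P \<noteq> Q\<close> by auto
  define index where "index v = (case v of CVar k \<Rightarrow> int k | XVar i \<Rightarrow> \<bar>i\<bar> | YVar i \<Rightarrow> \<bar>i\<bar>)" for v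
  define N where "N = (\<Sum>v\<in>vars ?D. index v)"
  have nonneg: "0 \<le> index v" for v by (simp add: index_def split: var.split)
  have le: "index v \<le> N" if "v \<in> vars ?D" for v
    unfolding N_def by (rule member_le_sum[OF that]) (simp_all add: nonneg)
  have N0: "0 \<le> N" unfolding N_def by (rule sum_nonneg) (rule nonneg)
  obtain m0 where m0: "\<And>m. m \<ge> m0 \<Longrightarrow> shift_perm m w \<in> S_plus"
    using shift_perm_S_plus[OF w] by blast
  \<comment> \<open>Large enough both for \<open>shift_kill_point\<close> and for the defining
    condition of the enriched polynomial to apply at this m.\<close>
  define m where "m = max m0 (int (Suc (nat N)) + N + 1)"
  have m: "int (Suc (nat N)) + N + 1 \<le> m" "m0 \<le> m" by (simp_all add: m_def)
  have "\<exists>\<sigma> :: var \<Rightarrow> complex. \<forall>v\<in>vars ?D. eval_epoly \<sigma> (shift_kill_subst m v) = \<rho> v"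
  proof (rule shift_kill_point[OF m(1) N0])
    show "- N \<le> i" if "XVar i \<in> vars ?D" for i using le[OF that] by (simp add: index_def)
    show "- N \<le> i" if "YVar i \<in> vars ?D" for i using le[OF that] by (simp add: index_def)
    show "k < Suc (nat N)" if "CVar k \<in> vars ?D" for k using le[OF that] by (simp add: index_def)
  qed
  then obtain \<sigma> :: "var \<Rightarrow> complex"
    where \<sigma>: "\<forall>v\<in>vars ?D. eval_epoly \<sigma> (shift_kill_subst m v) = \<rho> v" by (rule exE)
  have "0 < m" using m(1) N0 by simp
  then have "kill_chern (shift_poly m P) = kill_chern (shift_poly m Q)"
    using P Q m0[OF m(2)] by (simp add: is_enriched_schubert_def)
  then have "eval_epoly (shift_kill_subst m) ?D = 0" by (simp add: kill_shift_eval eval_diff)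
  then have "0 = eval_epoly \<sigma> (eval_epoly (shift_kill_subst m) ?D)" by simp
  also have "\<dots> = eval_epoly \<rho> ?D"
    unfolding eval_comp by (rule eval_cong) (use \<sigma> in simp)
  finally show False using \<rho> by simp
qed

lemma is_enriched_multi_schur:
  assumes A: "type_A_triple \<tau>"
  shows "is_enriched_schubert (triple_perm \<tau>)
    (multi_schur (triple_ks \<tau>) (triple_part \<tau>) (triple_series \<tau>))"
  unfolding is_enriched_schubert_def
proof (intro allI impI)
  fix m :: int assume m: "0 < m" "shift_perm m (triple_perm \<tau>) \<in> S_plus"
  let ?\<tau> = "shift_triple m \<tau>" and ?w = "shift_perm m (triple_perm \<tau>)"
  have st: "staircase \<tau>" by (rule type_A_staircase[OF A])
  have s: "1 \<le> tlen \<tau>" using A by (simp add: type_A_triple_def)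
  have st': "staircase ?\<tau>" by (rule staircase_shift[OF st])
  have t: "tight ?\<tau> ?w"
    using m(2) by (intro tight_shift tight_triple_perm[OF st]) (simp add: S_plus_def)
  have "interpolates ?w (flag_schur ?\<tau>)"
    by (rule interpolates_flag_schur[OF st' _ m(2) t]) (unfold shift_triple_simps, rule s)
  then have "double_schubert ?w = flag_schur ?\<tau>" by (rule double_schubert_eqI)
  moreover have "kill_chern (shift_poly m (multi_schur (triple_ks \<tau>) (triple_part \<tau>) (triple_series \<tau>)))
      = negate_y (flag_schur ?\<tau>)"
  proof (rule kill_shift_multi_schur)
    fix k assume "k \<in> {1..triple_ks \<tau>}"
    then have "triple_index \<tau> k \<in> {1..tlen ?\<tau>}" using triple_index(1)[OF st s] by simp
    from tight_S_plus_pos[OF st' t m(2) this]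
    show "0 \<le> tp \<tau> (triple_index \<tau> k) + m \<and> 0 \<le> tq \<tau> (triple_index \<tau> k) + m" by simp
  qed (use m in simp)
  ultimately show "kill_chern (shift_poly m (multi_schur (triple_ks \<tau>) (triple_part \<tau>) (triple_series \<tau>)))
      = negate_y (double_schubert ?w)" by simp
qed

theorem theorem4p1:
  fixes \<tau> :: triple
  assumes "type_A_triple \<tau>"
  shows "enriched_schubert (triple_perm \<tau>)
           = multi_schur (triple_ks \<tau>) (triple_part \<tau>) (triple_series \<tau>)
       \<and> multi_schur (triple_ks \<tau>) (triple_part \<tau>) (triple_series \<tau>)
           = det (mat (triple_ks \<tau>) (triple_ks \<tau>) (\<lambda>(i, j).
               let k = i + 1; l = j + 1 in
               series_coeff (triple_series \<tau> k) (triple_part \<tau> k + int l - int k)))"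
proof
  have S: "triple_perm \<tau> \<in> S_Z"
    using tight_triple_perm[OF type_A_staircase[OF assms]] by (simp add: tight_def)
  note enriched = is_enriched_multi_schur[OF assms]
  show "enriched_schubert (triple_perm \<tau>) = multi_schur (triple_ks \<tau>) (triple_part \<tau>) (triple_series \<tau>)"
    unfolding enriched_schubert_def
    by (rule the_equality, rule enriched, rule enriched_schubert_unique[OF S _ enriched])
qed (simp only: multi_schur_def)

end
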